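(* Let $\mu=\mu_x$ and $\nu=\nu_y$ be $\emptyset$-invariant global Keisler measures, and assume that $\mu$ is Borel-definable over $\emptyset$. If $\varphi(x,y)$ is almost sure stable with respect to $\mu$ and $\nu$, then for every model $M$ and every $\varepsilon>0$ there are formulas $\phi_1(x),\ldots,\phi_n(x)$ and $\theta_1(y),\ldots,\theta_m(y)$ such that (1) each $\phi_i$ is a Boolean combination of formulas $\varphi(x,b)$ with the tuples $b$ $\nu$-wide over $M$; (2) each $\theta_j$ is a Boolean combination of formulas $\varphi(a,y)$ with the tuples $a$ $\mu$-wide over $M$; (3) $\mu(\phi_1\vee\cdots\vee\phi_n)=1$ and $\nu(\theta_1\vee\cdots\vee\theta_m)=1$; and such that for every $1\le i\le n$ and $1\le j\le m$, either $$\mu\otimes\nu(\varphi(x,y)\wedge\phi_i(x)\wedge\theta_j(y))\geq(1-\varepsilon)^2\cdot\mu\otimes\nu(\phi_i(x)\wedge\theta_j(y))$$ or $$\mu\otimes\nu(\neg\varphi(x,y)\wedge\phi_i(x)\wedge\theta_j(y))\geq(1-\varepsilon)^2\cdot\mu\otimes\nu(\phi_i(x)\wedge\theta_j(y)).$$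
   Context: Fix a complete first-order theory $T$ in a language $L$ with infinite models and work in a monster model $\mathbb{M}$; $x,y$ are finite tuples of variables. A global Keisler measure $\mu_x$ is a finitely additive probability measure on the $L_x(\mathbb{M})$-definable sets; it is identified with its unique regular Borel probability extension to $S_x(\mathbb{M})$, and for a model $N$, $\mu|_N$ denotes the regular Borel probability measure on $S_x(N)$ induced by the restriction of $\mu$ to $L_x(N)$. $\mu$ is $\emptyset$-invariant if $\mu(\psi(x,b))=\mu(\psi(x,b'))$ whenever $\psi\in L$ and $b\equiv b'$; it is Borel-definable over $\emptyset$ if moreover for every $L$-formula $\psi(x,y)$ the map $S_y(\emptyset)\to[0,1]$, $\mathrm{tp}(b)\mapsto\mu(\psi(x,b))$, is Borel measurable. Then $\mu\otimes\nu$ is the global measure in variables $x,y$ given, for a formula $\psi(x,y)$ with parameters in a model $N$, by $\mu\otimes\nu(\psi(x,y))=\int_{\mathrm{tp}(b/N)\in S_y(N)}\mu(\psi(x,b))\,d\nu|_N$ (independent of $N$). A partial type (or a tuple over a set) is $\mu$-wide if it implies no formula of $\mu$-measure zero (resp. its type is), similarly for $\nu$. A finite sequence of tuples (each in the sort of $x$ or of $y$) is $M$-independent if the type of each entry over $M$ and the preceding entries is $\mu$-wide (for $x$-sort entries) or $\nu$-wide (for $y$-sort entries). $\varphi(x,y)\in L$ is almost sure stable with respect to $\mu$ and $\nu$ if for some $k$ there are no model $M$ and tuple $(a_1,b_1,\ldots,a_k,b_k)$ such that $(a_1,b_1,\ldots,a_k,b_k)$ or $(b_k,a_k,\ldots,b_1,a_1)$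 is $M$-independent and $\varphi(a_i,b_j)$ holds iff $i\le j$.
   Formalization: The claim is proved for 0 < ε < 2 instead of every ε > 0; for ε > 2 it is false since (1-ε)² > 1 would force all rectangles to be null, contradicting (3), and for ε = 2 it fails for an equivalence relation with infinitely many named classes of weights 2^-n. *)

theory Defs
  imports "HOL-Probability.Probability"
begin

unbundle cardinal_syntax

section \<open>First-order logic\<close>

text \<open>
  The languages are single-sorted.  A structure carries its language: the sets of function and
  relation symbols (either may be empty) and their arities.
\<close>

datatype 'f tm = Var nat | Fn 'f "'f tm list"

datatype ('f, 'r) fm =
    Equal "'f tm" "'f tm"
  | Rel 'r "'f tm list"
  | Neg "('f, 'r) fm"
  | Conj "('f, 'r) fm" "('f, 'r) fm"
  | Ex nat "('f, 'r) fm"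

record ('f, 'r) lang =
  funs :: "'f set"
  rels :: "'r set"
  farity :: "'f \<Rightarrow> nat"
  rarity :: "'r \<Rightarrow> nat"

record ('f, 'r, 'm) struct = "('f, 'r) lang" +
  carrier :: "'m set"
  fint :: "'f \<Rightarrow> 'm list \<Rightarrow> 'm"
  rint :: "'r \<Rightarrow> 'm list \<Rightarrow> bool"

primrec tm_wf :: "('f, 'r, 'z) lang_scheme \<Rightarrow> 'f tm \<Rightarrow> bool" where
  "tm_wf L (Var i) \<longleftrightarrow> True"
| "tm_wf L (Fn f ts) \<longleftrightarrow> f \<in> funs L \<and> length ts = farity L f \<and> list_all (tm_wf L) ts"

primrec tm_vars :: "'f tm \<Rightarrow> nat set" where
  "tm_vars (Var i) = {i}"
| "tm_vars (Fn f ts) = \<Union>(set (map tm_vars ts))"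

primrec fm_wf :: "('f, 'r, 'z) lang_scheme \<Rightarrow> ('f, 'r) fm \<Rightarrow> bool" where
  "fm_wf L (Equal s t) \<longleftrightarrow> tm_wf L s \<and> tm_wf L t"
| "fm_wf L (Rel r ts) \<longleftrightarrow> r \<in> rels L \<and> length ts = rarity L r \<and> list_all (tm_wf L) ts"
| "fm_wf L (Neg \<phi>) \<longleftrightarrow> fm_wf L \<phi>"
| "fm_wf L (Conj \<phi> \<psi>) \<longleftrightarrow> fm_wf L \<phi> \<and> fm_wf L \<psi>"
| "fm_wf L (Ex i \<phi>) \<longleftrightarrow> fm_wf L \<phi>"

primrec free_vars :: "('f, 'r) fm \<Rightarrow> nat set" where
  "free_vars (Equal s t) = tm_vars s \<union> tm_vars t"
| "free_vars (Rel r ts) = \<Union>(set (map tm_vars ts))"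
| "free_vars (Neg \<phi>) = free_vars \<phi>"
| "free_vars (Conj \<phi> \<psi>) = free_vars \<phi> \<union> free_vars \<psi>"
| "free_vars (Ex i \<phi>) = free_vars \<phi> - {i}"

text \<open>The \<open>L\<close>-formulas in the tuple of variables \<open>0, \<dots>, n - 1\<close>; sentences for \<open>n = 0\<close>.\<close>

definition formulas :: "('f, 'r, 'z) lang_scheme \<Rightarrow> nat \<Rightarrow> ('f, 'r) fm set" where
  "formulas L n = {\<phi>. fm_wf L \<phi> \<and> free_vars \<phi> \<subseteq> {..<n}}"

definition is_struct :: "('f, 'r, 'm) struct \<Rightarrow> bool" where
  "is_struct S \<longleftrightarrow> carrier S \<noteq> {} \<and>
     (\<forall>f\<in>funs S. \<forall>as. length as = farity S f \<longrightarrow> set as \<subseteq> carrier S \<longrightarrow> fint S f as \<in> carrier S)"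

primrec tm_val :: "('f, 'r, 'm) struct \<Rightarrow> (nat \<Rightarrow> 'm) \<Rightarrow> 'f tm \<Rightarrow> 'm" where
  "tm_val S e (Var i) = e i"
| "tm_val S e (Fn f ts) = fint S f (map (tm_val S e) ts)"

primrec sat_env :: "('f, 'r, 'm) struct \<Rightarrow> (nat \<Rightarrow> 'm) \<Rightarrow> ('f, 'r) fm \<Rightarrow> bool" where
  "sat_env S e (Equal s t) \<longleftrightarrow> tm_val S e s = tm_val S e t"
| "sat_env S e (Rel r ts) \<longleftrightarrow> rint S r (map (tm_val S e) ts)"
| "sat_env S e (Neg \<phi>) \<longleftrightarrow> \<not> sat_env S e \<phi>"
| "sat_env S e (Conj \<phi> \<psi>) \<longleftrightarrow> sat_env S e \<phi> \<and> sat_env S e \<psi>"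
| "sat_env S e (Ex i \<phi>) \<longleftrightarrow> (\<exists>a\<in>carrier S. sat_env S (e(i := a)) \<phi>)"

text \<open>
  Satisfaction \<open>S \<Turnstile> \<phi>(a)\<close> by a finite tuple; only used when the free variables of
  \<open>\<phi>\<close> are among \<open>0, \<dots>, length a - 1\<close>.
\<close>

definition sat :: "('f, 'r, 'm) struct \<Rightarrow> 'm list \<Rightarrow> ('f, 'r) fm \<Rightarrow> bool" where
  "sat S a \<phi> \<longleftrightarrow> sat_env S (\<lambda>i. a ! i) \<phi>"

definition complete_theory :: "('f, 'r, 'z) lang_scheme \<Rightarrow> ('f, 'r) fm set \<Rightarrow> bool" where
  "complete_theory L T \<longleftrightarrow> T \<subseteq> formulas L 0 \<and> (\<forall>\<sigma>\<in>formulas L 0. \<sigma> \<in> T \<or> Neg \<sigma> \<in> T)"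

definition models :: "('f, 'r, 'm) struct \<Rightarrow> ('f, 'r) fm set \<Rightarrow> bool" where
  "models S T \<longleftrightarrow> (\<forall>\<sigma>\<in>T. sat S [] \<sigma>)"

definition elementary_substruct :: "('f, 'r, 'm) struct \<Rightarrow> 'm set \<Rightarrow> bool" where
  "elementary_substruct S M \<longleftrightarrow> M \<subseteq> carrier S \<and> is_struct (S\<lparr>carrier := M\<rparr>) \<and>
     (\<forall>a. set a \<subseteq> M \<longrightarrow>
        (\<forall>\<phi>\<in>formulas S (length a). sat (S\<lparr>carrier := M\<rparr>) a \<phi> \<longleftrightarrow> sat S a \<phi>))"


section \<open>Definable sets and types\<close>

definition tuples :: "('f, 'r, 'm) struct \<Rightarrow> nat \<Rightarrow> 'm list set" where
  "tuples S n = {a. length a = n \<and> set a \<subseteq> carrier S}"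

text \<open>
  For a formula whose first variables are \<open>x\<close> and whose remaining ones are \<open>y\<close>, these are the
  sets defined by \<open>\<psi>(x, b)\<close> (with \<open>n\<close> the length of \<open>x\<close>) and by \<open>\<psi>(a, y)\<close> (with \<open>n\<close> the
  length of \<open>y\<close>).
\<close>

definition fibre_x :: "('f, 'r, 'm) struct \<Rightarrow> nat \<Rightarrow> ('f, 'r) fm \<Rightarrow> 'm list \<Rightarrow> 'm list set" where
  "fibre_x S n \<psi> b = {a \<in> tuples S n. sat S (a @ b) \<psi>}"

definition fibre_y :: "('f, 'r, 'm) struct \<Rightarrow> nat \<Rightarrow> ('f, 'r) fm \<Rightarrow> 'm list \<Rightarrow> 'm list set" where
  "fibre_y S n \<psi> a = {b \<in> tuples S n. sat S (a @ b) \<psi>}"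

text \<open>
  The Boolean algebra of subsets of \<open>S\<^sup>n\<close> definable by formulas with parameters in \<open>A\<close>.  As
  usual, \<open>L(A)\<close>-formulas are identified with the sets they define in the monster model; types
  and measures live on this algebra.
\<close>

definition definable :: "('f, 'r, 'm) struct \<Rightarrow> nat \<Rightarrow> 'm set \<Rightarrow> 'm list set set" where
  "definable S n A = {fibre_x S n \<psi> c |\<psi> c. set c \<subseteq> A \<and> \<psi> \<in> formulas S (n + length c)}"

definition complete_types :: "('f, 'r, 'm) struct \<Rightarrow> nat \<Rightarrow> 'm set \<Rightarrow> 'm list set set set" where
  "complete_types S n A = {p. p \<subseteq> definable S n A \<and>
     (\<forall>F\<subseteq>p. finite F \<longrightarrow> tuples S n \<inter> \<Inter>F \<noteq> {}) \<and>
     (\<forall>X\<in>definable S n A. X \<in> p \<or> tuples S n - X \<in> p)}"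

definition tp :: "('f, 'r, 'm) struct \<Rightarrow> nat \<Rightarrow> 'm set \<Rightarrow> 'm list \<Rightarrow> 'm list set set" where
  "tp S n A a = {X \<in> definable S n A. a \<in> X}"

definition realizes :: "('f, 'r, 'm) struct \<Rightarrow> nat \<Rightarrow> 'm list \<Rightarrow> 'm list set set \<Rightarrow> bool" where
  "realizes S n a p \<longleftrightarrow> a \<in> tuples S n \<and> (\<forall>X\<in>p. a \<in> X)"

definition realization :: "('f, 'r, 'm) struct \<Rightarrow> nat \<Rightarrow> 'm list set set \<Rightarrow> 'm list" where
  "realization S n p = (SOME a. realizes S n a p)"

definition cylinder ::
  "('f, 'r, 'm) struct \<Rightarrow> nat \<Rightarrow> 'm set \<Rightarrow> 'm list set \<Rightarrow> 'm list set set set" where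
  "cylinder S n A X = {p \<in> complete_types S n A. X \<in> p}"

definition type_space ::
  "('f, 'r, 'm) struct \<Rightarrow> nat \<Rightarrow> 'm set \<Rightarrow> 'm list set set topology" where
  "type_space S n A = topology_generated_by (cylinder S n A ` definable S n A)"


section \<open>Monster models\<close>

definition saturated :: "'k rel \<Rightarrow> ('f, 'r, 'm) struct \<Rightarrow> bool" where
  "saturated \<kappa> S \<longleftrightarrow> (\<forall>A\<subseteq>carrier S. |A| <o \<kappa> \<longrightarrow>
     (\<forall>p\<in>complete_types S 1 A. \<exists>a. realizes S 1 a p))"

definition partial_elementary :: "('f, 'r, 'm) struct \<Rightarrow> 'm set \<Rightarrow> ('m \<Rightarrow> 'm) \<Rightarrow> bool" where
  "partial_elementary S A f \<longleftrightarrow> A \<subseteq> carrier S \<and> f ` A \<subseteq> carrier S \<and>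
     (\<forall>a. set a \<subseteq> A \<longrightarrow> (\<forall>\<phi>\<in>formulas S (length a). sat S a \<phi> \<longleftrightarrow> sat S (map f a) \<phi>))"

definition automorphism :: "('f, 'r, 'm) struct \<Rightarrow> ('m \<Rightarrow> 'm) \<Rightarrow> bool" where
  "automorphism S \<sigma> \<longleftrightarrow> bij_betw \<sigma> (carrier S) (carrier S) \<and>
     (\<forall>f\<in>funs S. \<forall>a\<in>tuples S (farity S f). \<sigma> (fint S f a) = fint S f (map \<sigma> a)) \<and>
     (\<forall>r\<in>rels S. \<forall>a\<in>tuples S (rarity S r). rint S r a \<longleftrightarrow> rint S r (map \<sigma> a))"

definition strongly_homogeneous :: "'k rel \<Rightarrow> ('f, 'r, 'm) struct \<Rightarrow> bool" where
  "strongly_homogeneous \<kappa> S \<longleftrightarrow> (\<forall>A f. |A| <o \<kappa> \<longrightarrow> partial_elementary S A f \<longrightarrow>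
     (\<exists>\<sigma>. automorphism S \<sigma> \<and> (\<forall>a\<in>A. \<sigma> a = f a)))"

text \<open>
  \<open>S\<close> is a monster model of the complete theory \<open>T\<close> with infinite models; \<open>\<kappa>\<close> is the bound for
  smallness, only required to exceed the number of formulas of the language (so it is
  uncountable).
\<close>

definition monster_model :: "'k rel \<Rightarrow> ('f, 'r) fm set \<Rightarrow> ('f, 'r, 'm) struct \<Rightarrow> bool" where
  "monster_model \<kappa> T S \<longleftrightarrow>
     Card_order \<kappa> \<and> |{\<phi>. fm_wf S \<phi>}| <o \<kappa> \<and>
     complete_theory S T \<and> is_struct S \<and> models S T \<and> infinite (carrier S) \<and>
     saturated \<kappa> S \<and> strongly_homogeneous \<kappa> S"

text \<open>``Model'' means small elementary substructure of the monster model.\<close>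

definition small_model :: "'k rel \<Rightarrow> ('f, 'r, 'm) struct \<Rightarrow> 'm set \<Rightarrow> bool" where
  "small_model \<kappa> S M \<longleftrightarrow> elementary_substruct S M \<and> |M| <o \<kappa>"


section \<open>Keisler measures\<close>

text \<open>
  A global Keisler measure in \<open>n\<close> variables is represented by a function on subsets of
  \<open>S\<^sup>n\<close> of which only the values on definable sets are relevant.
\<close>

definition keisler_measure ::
  "('f, 'r, 'm) struct \<Rightarrow> nat \<Rightarrow> ('m list set \<Rightarrow> real) \<Rightarrow> bool" where
  "keisler_measure S n \<mu> \<longleftrightarrow> \<mu> (tuples S n) = 1 \<and>
     (\<forall>X\<in>definable S n (carrier S). 0 \<le> \<mu> X) \<and>
     (\<forall>X\<in>definable S n (carrier S). \<forall>Y\<in>definable S n (carrier S).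
        X \<inter> Y = {} \<longrightarrow> \<mu> (X \<union> Y) = \<mu> X + \<mu> Y)"

definition invariant_measure ::
  "('f, 'r, 'm) struct \<Rightarrow> nat \<Rightarrow> ('m list set \<Rightarrow> real) \<Rightarrow> bool" where
  "invariant_measure S n \<mu> \<longleftrightarrow>
     (\<forall>k. \<forall>\<psi>\<in>formulas S (n + k). \<forall>b\<in>tuples S k. \<forall>b'\<in>tuples S k.
        tp S k {} b = tp S k {} b' \<longrightarrow> \<mu> (fibre_x S n \<psi> b) = \<mu> (fibre_x S n \<psi> b'))"

definition borel_sets_of :: "'a topology \<Rightarrow> 'a measure" where
  "borel_sets_of X = sigma (topspace X) {U. openin X U}"

text \<open>
  Borel definability over the empty set of an invariant measure, for parameter variables of
  any finite length \<open>k\<close>.  By invariance the map does not depend on the realization.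
\<close>

definition borel_definable ::
  "('f, 'r, 'm) struct \<Rightarrow> nat \<Rightarrow> ('m list set \<Rightarrow> real) \<Rightarrow> bool" where
  "borel_definable S n \<mu> \<longleftrightarrow> invariant_measure S n \<mu> \<and>
     (\<forall>k. \<forall>\<psi>\<in>formulas S (n + k).
        (\<lambda>t. \<mu> (fibre_x S n \<psi> (realization S k t)))
          \<in> borel_measurable (borel_sets_of (type_space S k {})))"

definition regular_borel_probability :: "'a topology \<Rightarrow> 'a measure \<Rightarrow> bool" where
  "regular_borel_probability X m \<longleftrightarrow>
     prob_space m \<and> sets m = sets (borel_sets_of X) \<and>
     (\<forall>B\<in>sets m.
        emeasure m B = (SUP K\<in>{K. compactin X K \<and> K \<subseteq> B}. emeasure m K) \<and>
        emeasure m B = (INF U\<in>{U. openin X U \<and> B \<subseteq> U}. emeasure m U))"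

text \<open>The measure \<open>\<mu>|\<^sub>N\<close> on the space of types over \<open>N\<close>.\<close>

definition restriction_measure ::
  "('f, 'r, 'm) struct \<Rightarrow> nat \<Rightarrow> ('m list set \<Rightarrow> real) \<Rightarrow> 'm set \<Rightarrow> 'm list set set measure" where
  "restriction_measure S n \<mu> N = (THE m. regular_borel_probability (type_space S n N) m \<and>
     (\<forall>X\<in>definable S n N. measure m (cylinder S n N X) = \<mu> X))"

text \<open>
  \<open>\<mu> \<otimes> \<nu>\<close> on a definable set \<open>X \<subseteq> S\<^sup>p \<times> S\<^sup>q\<close>, a pair \<open>(a, b)\<close> being coded by \<open>a @ b\<close>.
  The choices of a model \<open>N\<close> over which \<open>X\<close> is definable and of realizations of types over
  \<open>N\<close> are immaterial if \<open>\<mu>\<close> and \<open>\<nu>\<close> are invariant.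
\<close>

definition keisler_product ::
  "'k rel \<Rightarrow> ('f, 'r, 'm) struct \<Rightarrow> nat \<Rightarrow> nat \<Rightarrow> ('m list set \<Rightarrow> real) \<Rightarrow> ('m list set \<Rightarrow> real)
     \<Rightarrow> 'm list set \<Rightarrow> real" where
  "keisler_product \<kappa> S p q \<mu> \<nu> X =
     (let N = (SOME N. small_model \<kappa> S N \<and> X \<in> definable S (p + q) N)
      in \<integral>t. \<mu> {a \<in> tuples S p. a @ realization S q t \<in> X} \<partial>restriction_measure S q \<nu> N)"


section \<open>Wideness and almost sure stability\<close>

text \<open>
  A partial type implies a formula (modulo the elementary diagram of \<open>S\<close>) iff a finite part of
  it does; finite conjunctions can be compared within \<open>S\<close>.
\<close>

definition type_implies ::
  "('f, 'r, 'm) struct \<Rightarrow> nat \<Rightarrow> 'm list set set \<Rightarrow> 'm list set \<Rightarrow> bool" where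
  "type_implies S n \<pi> X \<longleftrightarrow> (\<exists>F\<subseteq>\<pi>. finite F \<and> tuples S n \<inter> \<Inter>F \<subseteq> X)"

definition wide_type ::
  "('f, 'r, 'm) struct \<Rightarrow> nat \<Rightarrow> ('m list set \<Rightarrow> real) \<Rightarrow> 'm list set set \<Rightarrow> bool" where
  "wide_type S n \<mu> \<pi> \<longleftrightarrow>
     \<not> (\<exists>X\<in>definable S n (carrier S). type_implies S n \<pi> X \<and> \<mu> X = 0)"

definition wide_over ::
  "('f, 'r, 'm) struct \<Rightarrow> nat \<Rightarrow> ('m list set \<Rightarrow> real) \<Rightarrow> 'm set \<Rightarrow> 'm list \<Rightarrow> bool" where
  "wide_over S n \<mu> A a \<longleftrightarrow> a \<in> tuples S n \<and> wide_type S n \<mu> (tp S n A a)"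

text \<open>
  Entries \<open>Inl a\<close> are in the sort of \<open>x\<close> and entries \<open>Inr b\<close> in the sort of \<open>y\<close>; the tags are
  needed because the two tuples of variables may have the same length.
\<close>

definition independent_seq ::
  "('f, 'r, 'm) struct \<Rightarrow> nat \<Rightarrow> nat \<Rightarrow> ('m list set \<Rightarrow> real) \<Rightarrow> ('m list set \<Rightarrow> real)
     \<Rightarrow> 'm set \<Rightarrow> ('m list + 'm list) list \<Rightarrow> bool" where
  "independent_seq S p q \<mu> \<nu> M s \<longleftrightarrow>
     (\<forall>i<length s.
        let A = M \<union> (\<Union>j<i. set (case_sum id id (s ! j)))
        in case s ! i of Inl a \<Rightarrow> wide_over S p \<mu> A a | Inr b \<Rightarrow> wide_over S q \<nu> A b)"

definition almost_sure_stable ::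
  "'k rel \<Rightarrow> ('f, 'r, 'm) struct \<Rightarrow> nat \<Rightarrow> nat \<Rightarrow> ('m list set \<Rightarrow> real) \<Rightarrow> ('m list set \<Rightarrow> real)
     \<Rightarrow> ('f, 'r) fm \<Rightarrow> bool" where
  "almost_sure_stable \<kappa> S p q \<mu> \<nu> \<phi> \<longleftrightarrow>
     (\<exists>k. \<not> (\<exists>M a b. small_model \<kappa> S M \<and>
        (let s = concat (map (\<lambda>i. [Inl (a i), Inr (b i)]) [1..<Suc k])
         in independent_seq S p q \<mu> \<nu> M s \<or> independent_seq S p q \<mu> \<nu> M (rev s)) \<and>
        (\<forall>i\<in>{1..k}. \<forall>j\<in>{1..k}. sat S (a i @ b j) \<phi> \<longleftrightarrow> i \<le> j)))"

text \<open>Boolean combinations of members of \<open>B\<close>, complements being taken in \<open>U\<close>.\<close>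

inductive_set boolean_combinations :: "'a set \<Rightarrow> 'a set set \<Rightarrow> 'a set set" for U B where
  basic: "X \<in> B \<Longrightarrow> X \<in> boolean_combinations U B"
| compl: "X \<in> boolean_combinations U B \<Longrightarrow> U - X \<in> boolean_combinations U B"
| inter: "X \<in> boolean_combinations U B \<Longrightarrow> Y \<in> boolean_combinations U B
    \<Longrightarrow> X \<inter> Y \<in> boolean_combinations U B"

text \<open>The sets defined by \<open>\<phi>(x, y)\<close> and by \<open>\<phi>\<^sub>1(x) \<and> \<phi>\<^sub>2(y)\<close>, pairs coded as above.\<close>

definition relation_set :: "('f, 'r, 'm) struct \<Rightarrow> nat \<Rightarrow> nat \<Rightarrow> ('f, 'r) fm \<Rightarrow> 'm list set" where
  "relation_set S p q \<phi> = {a @ b |a b. a \<in> tuples S p \<and> b \<in> tuples S q \<and> sat S (a @ b) \<phi>}"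

definition rectangle :: "'m list set \<Rightarrow> 'm list set \<Rightarrow> 'm list set" where
  "rectangle X Y = {a @ b |a b. a \<in> X \<and> b \<in> Y}"

end

theory Submission
  imports Defs
begin

text \<open>
  Say that a set \<open>A\<close> of positive measure is \<open>\<epsilon>\<close>-good if, for all sufficiently wide \<open>b\<close>, one of
  \<open>A \<inter> \<phi>(x, b)\<close> and \<open>A - \<phi>(x, b)\<close> has measure at most \<open>\<epsilon> \<mu>(A)\<close>.  If no good subset of
  \<open>A\<close> has measure at least \<open>\<epsilon>\<^sup>h \<mu>(A)\<close>, then there is a binary tree of height \<open>h\<close> of sets of positive measure,
  each split by an instance \<open>\<phi>(x, b)\<close>.  In such a tree one alternately chooses a wide \<open>a\<close>, thins out the
  tree so that all remaining splitting parameters agree on \<open>\<phi>(a, y)\<close>, and chooses a wide splitting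
  parameter \<open>b\<close> and a side; for large \<open>h\<close> this yields an independent half-graph, contradicting
  almost sure stability.  So good subsets of a fixed proportion exist, finitely many good sets
  exhaust the space up to a small error, and the error is absorbed by one of them.  The situation is
  symmetric in \<open>x\<close> and \<open>y\<close>.  For good \<open>\<Phi>\<close> and \<open>\<Theta>\<close>, if neither truth value of \<open>\<phi>\<close> dominates
  \<open>\<Phi> \<times> \<Theta>\<close>, then both majority values of \<open>b \<in> \<Theta>\<close> on \<open>\<Phi>\<close> occur with positive probability
  (here Borel definability is used), and choosing alternately elements of \<open>\<Phi>\<close> and \<open>\<Theta>\<close> against
  the majority values already present gives a half-graph once more.
\<close>

subsection \<open>Finitely additive probabilities\<close>

text \<open>Each new entry of the half-graph must be wide over everything chosen before it, so
  nothing can be prepared over one fixed base. Goodness and trees therefore quantify over small sets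
  \<open>C\<close>, and each choice is made over the base enlarged by the entries so far. The truth
  values cannot be prescribed either: chains of length \<open>2 * k\<close> with arbitrary colours
  are built, and the pigeonhole principle selects one colour. The same length explains the condition
  \<open>2 * k * \<eta> < \<epsilon>\<close>: every earlier entry forbids at most an \<eta>-fraction
  of \<Phi> or \<Theta>, and all of them together must leave room. Of the two factors 1 -
  \<epsilon>, one pays for the minority inside the fibre over b, the other for the part of \<Theta>
  with the wrong majority value. On the analytic side, the product is an integral against a measure
  given by a definite description, so existence and uniqueness of regular extensions are proved. The
  set of b with a given majority value is only a Borel set of types; the link to combinatorics is
  that such a set, if of positive measure, contains types of tuples that are wide over any
  prescribed small set.\<close>

locale finitely_additive_prob = algebra \<Omega> \<D> for \<Omega> :: "'a set" and \<D> +
  fixes \<mu> :: "'a set \<Rightarrow> real"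
  assumes nonneg: "A \<in> \<D> \<Longrightarrow> 0 \<le> \<mu> A"
    and additive: "A \<in> \<D> \<Longrightarrow> B \<in> \<D> \<Longrightarrow> A \<inter> B = {} \<Longrightarrow> \<mu> (A \<union> B) = \<mu> A + \<mu> B"
    and total: "\<mu> \<Omega> = 1"
begin

lemma measure_empty: "\<mu> {} = 0"
  using additive[of "{}" "{}"] by simp

lemma measure_split: "A \<in> \<D> \<Longrightarrow> B \<in> \<D> \<Longrightarrow> \<mu> A = \<mu> (A \<inter> B) + \<mu> (A - B)"
  using additive[of "A \<inter> B" "A - B"] by (simp add: Int Diff Int_Diff_Un Int_Diff_disjoint)

lemma measure_mono: "A \<in> \<D> \<Longrightarrow> B \<in> \<D> \<Longrightarrow> A \<subseteq> B \<Longrightarrow> \<mu> A \<le> \<mu> B"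
  using measure_split[of B A] nonneg[of "B - A"] by (simp add: Diff Int_absorb1)

lemma measure_diff: "A \<in> \<D> \<Longrightarrow> B \<in> \<D> \<Longrightarrow> B \<subseteq> A \<Longrightarrow> \<mu> (A - B) = \<mu> A - \<mu> B"
  using measure_split[of A B] by (simp add: Int_absorb1)

lemma measure_Un_le: "A \<in> \<D> \<Longrightarrow> B \<in> \<D> \<Longrightarrow> \<mu> (A \<union> B) \<le> \<mu> A + \<mu> B"
  using additive[of A "B - A"] measure_mono[of "B - A" B] by (simp add: Diff)

lemma measure_UN_le:
  fixes c :: real
  assumes "finite I" and "\<And>i. i \<in> I \<Longrightarrow> A i \<in> \<D>" and "\<And>i. i \<in> I \<Longrightarrow> \<mu> (A i) \<le> c"
  shows "(\<Union>i\<in>I. A i) \<in> \<D> \<and> \<mu> (\<Union>i\<in>I. A i) \<le> card I * c"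
  using assms
proof (induction I)
  case empty
  then show ?case by (simp add: measure_empty)
next
  case (insert i I)
  then have IH: "(\<Union>i\<in>I. A i) \<in> \<D>" "\<mu> (\<Union>i\<in>I. A i) \<le> card I * c" by auto
  have "\<mu> (A i \<union> (\<Union>i\<in>I. A i)) \<le> \<mu> (A i) + \<mu> (\<Union>i\<in>I. A i)"
    using insert.prems IH by (intro measure_Un_le) auto
  also have "\<dots> \<le> c + card I * c" using IH insert.prems by (intro add_mono) auto
  finally show ?case using IH insert by (auto simp: algebra_simps)
qed

end


subsection \<open>Almost sure stability, abstractly\<close>

text \<open>
  \<open>WX C a\<close> stands for ``\<open>a\<close> is wide over \<open>C\<close>'' and \<open>eX a\<close> for the set of entries of the
  tuple \<open>a\<close>; likewise for \<open>Y\<close>.  The two values of \<open>c\<close> in the last assumption account for the two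
  orders of construction in the definition of almost sure stability.
\<close>

locale wide_relation =
  x: finitely_additive_prob X DX \<mu> + y: finitely_additive_prob Y DY \<nu>
  for X :: "'a set" and DX \<mu> and Y :: "'b set" and DY \<nu> +
  fixes WX :: "'c set \<Rightarrow> 'a \<Rightarrow> bool" and WY :: "'c set \<Rightarrow> 'b \<Rightarrow> bool"
    and eX :: "'a \<Rightarrow> 'c set" and eY :: "'b \<Rightarrow> 'c set"
    and small :: "'c set \<Rightarrow> bool" and E :: "'a \<Rightarrow> 'b \<Rightarrow> bool" and M :: "'c set" and k :: nat
  assumes fibreX: "b \<in> Y \<Longrightarrow> {a \<in> X. E a b} \<in> DX"
    and fibreY: "a \<in> X \<Longrightarrow> {b \<in> Y. E a b} \<in> DY"
    and WX_ex: "small C \<Longrightarrow> A \<in> DX \<Longrightarrow> 0 < \<mu> A \<Longrightarrow> \<exists>a\<in>A. WX C a"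
    and WY_ex: "small C \<Longrightarrow> B \<in> DY \<Longrightarrow> 0 < \<nu> B \<Longrightarrow> \<exists>b\<in>B. WY C b"
    and WX_in: "WX C a \<Longrightarrow> a \<in> X"
    and WY_in: "WY C b \<Longrightarrow> b \<in> Y"
    and WX_anti: "WX C a \<Longrightarrow> C' \<subseteq> C \<Longrightarrow> WX C' a"
    and WY_anti: "WY C b \<Longrightarrow> C' \<subseteq> C \<Longrightarrow> WY C' b"
    and small_M: "small M"
    and small_Un: "small C \<Longrightarrow> small C' \<Longrightarrow> small (C \<union> C')"
    and small_eX: "a \<in> X \<Longrightarrow> small (eX a)"
    and small_eY: "b \<in> Y \<Longrightarrow> small (eY b)"
    and no_half_graph: "\<not> (\<exists>a b c.
       (\<forall>i<k. WX (M \<union> (\<Union>j<i. eX (a j) \<union> eY (b j))) (a i) \<and>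
              WY (M \<union> (\<Union>j<i. eX (a j) \<union> eY (b j)) \<union> eX (a i)) (b i)) \<and>
       (\<forall>i<k. \<forall>j<k. E (a i) (b j) = (if i \<le> j then c else \<not> c)))"
begin

definition prev :: "(nat \<Rightarrow> 'a) \<Rightarrow> (nat \<Rightarrow> 'b) \<Rightarrow> nat \<Rightarrow> 'c set" where
  "prev a b i = M \<union> (\<Union>j<i. eX (a j) \<union> eY (b j))"

text \<open>
  The colour \<open>c i\<close> is the truth value of \<open>E (a i)\<close> at the later elements of \<open>Y\<close>, and the opposite
  of that of \<open>E _ (b i)\<close> at the later elements of \<open>X\<close>.
\<close>

definition chain :: "nat \<Rightarrow> (nat \<Rightarrow> 'a) \<Rightarrow> (nat \<Rightarrow> 'b) \<Rightarrow> (nat \<Rightarrow> bool) \<Rightarrow> bool" where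
  "chain n a b c \<longleftrightarrow>
     (\<forall>i<n. WX (prev a b i) (a i) \<and> WY (prev a b i \<union> eX (a i)) (b i)) \<and>
     (\<forall>i<n. \<forall>j<n. c i = c j \<longrightarrow> E (a i) (b j) = (if i \<le> j then c i else \<not> c i))"

lemma small_prev:
  assumes "\<And>i. i < n \<Longrightarrow> a i \<in> X" "\<And>i. i < n \<Longrightarrow> b i \<in> Y"
  shows "small (prev a b n)"
  using assms
proof (induction n)
  case 0
  then show ?case by (simp add: prev_def small_M)
next
  case (Suc n)
  have "prev a b (Suc n) = prev a b n \<union> (eX (a n) \<union> eY (b n))"
    by (auto simp: prev_def lessThan_Suc)
  then show ?case
    using Suc by (auto intro!: small_Un small_eX small_eY)
qed

lemma chain_in: "chain n a b c \<Longrightarrow> i < n \<Longrightarrow> a i \<in> X \<and> b i \<in> Y"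
  unfolding chain_def using WX_in WY_in by blast

lemma chain_small: "chain n a b c \<Longrightarrow> small (prev a b n)"
  using chain_in by (intro small_prev) blast+

text \<open>Among \<open>2 * k\<close> indices, \<open>k\<close> have the same colour and give a half-graph.\<close>

lemma no_chain: "\<not> chain (2 * k) a b c"
proof
  assume ch: "chain (2 * k) a b c"
  define I where "I d = {i. i < 2 * k \<and> c i = d}" for d
  have "card (I True) + card (I False) = card (I True \<union> I False)"
    by (rule card_Un_disjoint[symmetric]) (auto simp: I_def)
  also have "I True \<union> I False = {..<2 * k}" by (auto simp: I_def)
  finally have "k \<le> card (I True) \<or> k \<le> card (I False)" by auto
  then obtain d where "k \<le> card (I d)" by blast
  then obtain J where J: "J \<subseteq> I d" "card J = k" "finite J"
    using obtain_subset_with_card_n by metis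
  define f where "f i = sorted_list_of_set J ! i" for i
  have f_in: "f i \<in> J" if "i < k" for i
    using that J by (metis f_def length_sorted_list_of_set nth_mem set_sorted_list_of_set)
  have f_less: "f i < f j \<longleftrightarrow> i < j" if "i < k" "j < k" for i j
  proof -
    have "f i < f j" if "i < j" "j < k" for i j
      using that J strict_sorted_list_of_set[of J] unfolding f_def
      by (simp add: sorted_wrt_nth_less)
    then show ?thesis using that by (metis less_asym linorder_neqE_nat)
  qed
  have f2: "f i < 2 * k" "c (f i) = d" if "i < k" for i
    using f_in[OF that] J by (auto simp: I_def)
  \<comment> \<open>Passing to a subsequence only removes earlier entries, so the base shrinks and
    wideness is inherited.\<close>
  have sub: "M \<union> (\<Union>j<i. eX (a (f j)) \<union> eY (b (f j))) \<subseteq> prev a b (f i)" if "i < k" for i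
    unfolding prev_def using f_less that by (fastforce dest: order.strict_trans)
  have "WX (M \<union> (\<Union>j<i. eX (a (f j)) \<union> eY (b (f j)))) (a (f i))"
    "WY (M \<union> (\<Union>j<i. eX (a (f j)) \<union> eY (b (f j))) \<union> eX (a (f i))) (b (f i))" if "i < k" for i
    using ch f2(1)[OF that] sub[OF that] unfolding chain_def
    by (meson WX_anti WY_anti Un_mono order_refl)+
  moreover have "E (a (f i)) (b (f j)) = (if i \<le> j then d else \<not> d)" if "i < k" "j < k" for i j
    using ch f2 f_less that unfolding chain_def by (metis not_le)
  ultimately show False
    using no_half_graph[unfolded not_ex, rule_format, of "\<lambda>i. a (f i)" "\<lambda>i. b (f i)" d]
    by simp
qed

text \<open>Colours are compared only when they agree. Towards an earlier \<open>b j\<close> the new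
  \<open>u\<close> takes the value opposite to \<open>c j\<close>, which is the right one whenever
  \<open>c j = d\<close>; the values of earlier \<open>a i\<close> at \<open>v\<close> matter only
  for \<open>c i = d\<close>.\<close>

lemma chain_Suc:
  assumes ch: "chain n a b c"
    and wx: "WX (prev a b n) u" and wy: "WY (prev a b n \<union> eX u) v"
    and "\<And>j. j < n \<Longrightarrow> E u (b j) = (\<not> c j)"
    and "\<And>i. i < n \<Longrightarrow> c i = d \<Longrightarrow> E (a i) v = d"
    and "E u v = d"
  shows "chain (Suc n) (a(n := u)) (b(n := v)) (c(n := d))"
proof -
  have "prev (a(n := u)) (b(n := v)) i = prev a b i" if "i \<le> n" for i
    using that by (auto simp: prev_def)
  then show ?thesis
    using assms unfolding chain_def by (auto simp: less_Suc_eq)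
qed


subsection \<open>Bounded rank\<close>

abbreviation fib :: "'b \<Rightarrow> 'a set" where
  "fib b \<equiv> {a \<in> X. E a b}"

text \<open>
  A measured version of the local 2-rank.  Quantifying over all small \<open>C\<close>, rather than over one base,
  makes any appeal to the invariance of the measures unnecessary.
\<close>

primrec tree :: "('b \<Rightarrow> bool) \<Rightarrow> nat \<Rightarrow> 'a set \<Rightarrow> bool" where
  "tree Q 0 A \<longleftrightarrow> A \<in> DX \<and> 0 < \<mu> A"
| "tree Q (Suc n) A \<longleftrightarrow> A \<in> DX \<and> (\<forall>C. small C \<longrightarrow>
     (\<exists>b. WY C b \<and> Q b \<and> tree Q n (A \<inter> fib b) \<and> tree Q n (A - fib b)))"

text \<open>The same splitting parameters serve for the larger set, since both halves grow with
  it.\<close>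

lemma tree_mono:
  "tree Q n A \<Longrightarrow> A \<subseteq> A' \<Longrightarrow> A' \<in> DX \<Longrightarrow> tree Q n A'"
proof (induction n arbitrary: A A')
  case 0
  then show ?case using x.measure_mono[of A A'] by auto
next
  case (Suc n)
  show ?case
    unfolding tree.simps
  proof (intro conjI allI impI)
    fix C assume "small C"
    then obtain b where b: "WY C b" "Q b" "tree Q n (A \<inter> fib b)" "tree Q n (A - fib b)"
      using Suc.prems by auto
    have "tree Q n (A' \<inter> fib b)" "tree Q n (A' - fib b)"
      using Suc.prems fibreX[OF WY_in[OF b(1)]]
      by (intro Suc.IH[OF b(3)] Suc.IH[OF b(4)] Int_mono Diff_mono x.Int x.Diff order_refl; simp)+
    then show "\<exists>b. WY C b \<and> Q b \<and> tree Q n (A' \<inter> fib b) \<and> tree Q n (A' - fib b)"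
      using b by blast
  qed (use Suc.prems in auto)
qed

lemma tree_pos: "tree Q n A \<Longrightarrow> A \<in> DX \<and> 0 < \<mu> A"
proof (induction n arbitrary: A)
  case (Suc n)
  then obtain b where "WY M b" "tree Q n (A \<inter> fib b)" using small_M by auto
  then show ?case
    using Suc x.measure_mono[of "A \<inter> fib b" A] by fastforce
qed simp

text \<open>A partition property of trees, with \<open>R\<close> colouring the splitting parameters.
  If both alternatives fail, this is witnessed over small sets \<open>C1\<close> and
  \<open>C0\<close>; a splitting parameter wide over their union has one of the two colours and
  refutes the witness for that colour.\<close>

lemma tree_colour:
  "tree Q (n + m) A \<Longrightarrow> tree (\<lambda>b. Q b \<and> R b) n A \<or> tree (\<lambda>b. Q b \<and> \<not> R b) m A"
proof (induction "n + m" arbitrary: n m A)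
  case 0
  then show ?case by simp
next
  case (Suc l)
  show ?case
  proof (cases "n = 0 \<or> m = 0")
    case True
    then show ?thesis using tree_pos[OF Suc.prems] by auto
  next
    case False
    then obtain n' m' where nm: "n = Suc n'" "m = Suc m'" by (metis not0_implies_Suc)
    have A: "A \<in> DX" using tree_pos[OF Suc.prems] by simp
    show ?thesis
    proof (rule ccontr)
      assume neg: "\<not> ?thesis"
      then obtain C1 where C1: "small C1" "\<And>b. WY C1 b \<Longrightarrow> Q b \<Longrightarrow> R b \<Longrightarrow>
          \<not> (tree (\<lambda>b. Q b \<and> R b) n' (A \<inter> fib b) \<and> tree (\<lambda>b. Q b \<and> R b) n' (A - fib b))"
        using nm A by auto
      from neg obtain C0 where C0: "small C0" "\<And>b. WY C0 b \<Longrightarrow> Q b \<Longrightarrow> \<not> R b \<Longrightarrow>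
          \<not> (tree (\<lambda>b. Q b \<and> \<not> R b) m' (A \<inter> fib b) \<and> tree (\<lambda>b. Q b \<and> \<not> R b) m' (A - fib b))"
        using nm A by auto
      have "tree Q (Suc l) A" using Suc.prems Suc.hyps(2) by metis
      moreover have "small (C0 \<union> C1)" using small_Un C0(1) C1(1) by blast
      ultimately obtain b where b: "WY (C0 \<union> C1) b" "Q b" "tree Q l (A \<inter> fib b)" "tree Q l (A - fib b)"
        unfolding tree.simps by blast
      have ws: "WY C0 b" "WY C1 b" using b(1) WY_anti by blast+
      have l: "l = n' + m" "l = n + m'" using nm Suc.hyps by auto
      \<comment> \<open>Each half carries shorter trees in both colours: its tree has height n' + m
        = n + m', and by monotonicity the other alternatives, height n or m, would already give such
        a tree on \<open>A\<close>.\<close>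
      have col: "tree (\<lambda>b. Q b \<and> R b) n' Z \<and> tree (\<lambda>b. Q b \<and> \<not> R b) m' Z"
        if "tree Q l Z" "Z \<subseteq> A" for Z
      proof -
        have neg': "\<not> tree (\<lambda>b. Q b \<and> R b) n Z" "\<not> tree (\<lambda>b. Q b \<and> \<not> R b) m Z"
          using neg tree_mono[OF _ that(2) A] by blast+
        have "tree Q (n' + m) Z" "tree Q (n + m') Z" using that l by simp_all
        then show ?thesis using Suc.hyps(1)[OF l(1)] Suc.hyps(1)[OF l(2)] neg' by blast
      qed
      show False
        using col[OF b(3)] col[OF b(4)] C0(2)[OF ws(1) b(2)] C1(2)[OF ws(2) b(2)] by auto
    qed
  qed
qed

text \<open>Read backwards from the end of the chain: to keep height h after a step, one level is
  spent on the new splitting parameter, and the thinning by colour before it halves the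
  height.\<close>

primrec chain_height :: "nat \<Rightarrow> nat \<Rightarrow> nat" where
  "chain_height 0 h = h"
| "chain_height (Suc n) h = chain_height n (2 * Suc h)"

text \<open>\<open>Q\<close> and \<open>A\<close> make the future compatible with the past: every
  remaining splitting parameter has the prescribed value at each \<open>a i\<close>, and every
  remaining point the prescribed value at each \<open>b j\<close>. The hypotheses of
  \<open>chain_Suc\<close> then hold for any further choice.\<close>

lemma tree_chain:
  "tree (\<lambda>_. True) (chain_height n h) X \<Longrightarrow> \<exists>a b c A Q. chain n a b c \<and> tree Q h A \<and>
     (\<forall>v i. Q v \<longrightarrow> i < n \<longrightarrow> E (a i) v = c i) \<and> (\<forall>u\<in>A. \<forall>j<n. E u (b j) = (\<not> c j))"
proof (induction n arbitrary: h)
  case 0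
  then show ?case
    by (intro exI[of _ "\<lambda>_. undefined"] exI[of _ "\<lambda>_. undefined"] exI[of _ "\<lambda>_. True"]
        exI[of _ X] exI[of _ "\<lambda>_. True"]) (simp add: chain_def)
next
  case (Suc n)
  then have "tree (\<lambda>_. True) (chain_height n (2 * Suc h)) X" by simp
  from Suc.IH[OF this] obtain a b c A Q where
    IH: "chain n a b c \<and> tree Q (2 * Suc h) A \<and>
      (\<forall>v i. Q v \<longrightarrow> i < n \<longrightarrow> E (a i) v = c i) \<and> (\<forall>u\<in>A. \<forall>j<n. E u (b j) = (\<not> c j))"
    by (elim exE)
  then have ch: "chain n a b c" and t: "tree Q (Suc h + Suc h) A"
    and Q: "\<And>v i. Q v \<Longrightarrow> i < n \<Longrightarrow> E (a i) v = c i"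
    and A: "\<And>u j. u \<in> A \<Longrightarrow> j < n \<Longrightarrow> E u (b j) = (\<not> c j)"
    unfolding mult_2 by blast+
  obtain u where u: "u \<in> A" "WX (prev a b n) u"
    using WX_ex[OF chain_small[OF ch]] tree_pos[OF t] by blast
  have "tree (\<lambda>v. Q v \<and> E u v = True) (Suc h) A \<or> tree (\<lambda>v. Q v \<and> E u v = False) (Suc h) A"
    using tree_colour[OF t, of "\<lambda>v. E u v"] by simp
  then obtain d where d: "tree (\<lambda>v. Q v \<and> E u v = d) (Suc h) A"
    by (elim disjE) (rule that, assumption)+
  have "small (prev a b n \<union> eX u)"
    using small_Un chain_small[OF ch] small_eX u WX_in by blast
  then obtain v where v: "WY (prev a b n \<union> eX u) v" "Q v" "E u v = d"
    "tree (\<lambda>v. Q v \<and> E u v = d) h (A \<inter> fib v)" "tree (\<lambda>v. Q v \<and> E u v = d) h (A - fib v)"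
    using d by auto
  \<comment> \<open>The half on which the value at \<open>v\<close> is opposite to \<open>d\<close>,
    as required of later points.\<close>
  define A' where "A' = (if d then A - fib v else A \<inter> fib v)"
  have AX: "A \<subseteq> X" using tree_pos[OF t] x.sets_into_space by blast
  have "chain (Suc n) (a(n := u)) (b(n := v)) (c(n := d))"
    by (rule chain_Suc[OF ch u(2) v(1)]) (use A Q u v in auto)
  moreover have "tree (\<lambda>v. Q v \<and> E u v = d) h A'" using v by (cases d) (simp_all add: A'_def)
  moreover have "E ((a(n := u)) i) w = (c(n := d)) i" if "Q w \<and> E u w = d" "i < Suc n" for w i
    using that Q by (auto simp: less_Suc_eq)
  moreover have "E w ((b(n := v)) j) = (\<not> (c(n := d)) j)" if "w \<in> A'" "j < Suc n" for w j
    using that A AX by (auto simp: less_Suc_eq A'_def split: if_splits)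
  ultimately show ?case
    by (intro exI[of _ "a(n := u)"] exI[of _ "b(n := v)"] exI[of _ "c(n := d)"] exI[of _ A']
        exI[of _ "\<lambda>v. Q v \<and> E u v = d"]) blast
qed

lemma tree_bounded: "\<not> tree (\<lambda>_. True) (chain_height (2 * k) 0) A"
proof
  assume t: "tree (\<lambda>_. True) (chain_height (2 * k) 0) A"
  then have "A \<subseteq> X" using tree_pos x.sets_into_space by blast
  then show False using tree_chain[OF tree_mono[OF t]] no_chain by blast
qed


subsection \<open>Good sets\<close>

definition bc :: "'a set set" where
  "bc = boolean_combinations X {fib b |b. WY M b}"

text \<open>The existential \<open>C\<close> is dual to the universal one in \<open>tree\<close>: if
  a set of positive measure is not good, then over every small set some wide parameter splits it
  into two halves that are both large.\<close>

definition good :: "real \<Rightarrow> 'a set \<Rightarrow> bool" where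
  "good \<epsilon> A \<longleftrightarrow> A \<in> DX \<and> 0 < \<mu> A \<and> (\<exists>C. small C \<and>
     (\<forall>b. WY C b \<longrightarrow> \<mu> (A \<inter> fib b) \<le> \<epsilon> * \<mu> A \<or> \<mu> (A - fib b) \<le> \<epsilon> * \<mu> A))"

lemma bc_DX: "A \<in> bc \<Longrightarrow> A \<in> DX"
  unfolding bc_def by (induction rule: boolean_combinations.induct) (auto intro: fibreX WY_in)

lemma bc_fib: "WY M b \<Longrightarrow> fib b \<in> bc"
  unfolding bc_def by (auto intro: boolean_combinations.basic)

lemma bc_Diff:
  assumes "A \<in> bc" "B \<in> bc"
  shows "A - B \<in> bc"
proof -
  have "A - B = A \<inter> (X - B)" using x.sets_into_space[OF bc_DX[OF assms(1)]] by blast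
  then show ?thesis using assms unfolding bc_def by (auto intro: boolean_combinations.intros)
qed

lemma bc_Int: "A \<in> bc \<Longrightarrow> B \<in> bc \<Longrightarrow> A \<inter> B \<in> bc"
  unfolding bc_def by (rule boolean_combinations.inter)

text \<open>Boolean combinations are generated without a constant for the whole space, so one
  instance is needed to start from; the full set \<open>Y\<close> has positive measure and thus
  contains a wide parameter.\<close>

lemma bc_X: "X \<in> bc"
proof -
  obtain b where b: "WY M b" using WY_ex[OF small_M, of Y] y.total by auto
  have "X - (fib b - fib b) \<in> bc"
    using bc_Diff[OF bc_fib[OF b] bc_fib[OF b]] unfolding bc_def
    by (rule boolean_combinations.compl)
  then show ?thesis by simp
qed

lemma bc_Un:
  assumes "A \<in> bc" "B \<in> bc"
  shows "A \<union> B \<in> bc"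
proof -
  have "A \<union> B = X - ((X - A) - B)"
    using assms[THEN bc_DX, THEN x.sets_into_space] by blast
  then show ?thesis using assms bc_Diff bc_X by metis
qed

lemma bc_Union: "finite P \<Longrightarrow> P \<subseteq> bc \<Longrightarrow> \<Union>P \<in> bc"
proof (induction rule: finite_induct)
  case empty
  show ?case using bc_Diff[OF bc_X bc_X] by simp
qed (auto intro: bc_Un)

text \<open>As long as goodness fails, a split leaves more than the fraction \<epsilon> of the
  measure on both sides. Hence after at most h splits either a good set of proportion at least
  \<open>\<epsilon> ^ h\<close> has appeared, or all branches continue to height h.\<close>

lemma good_subset_or_tree:
  assumes "A \<in> bc" "0 < \<mu> A" "0 < \<epsilon>" "\<epsilon> \<le> 1"
  shows "tree (\<lambda>_. True) h A \<or> (\<exists>A'\<in>bc. A' \<subseteq> A \<and> good \<epsilon> A' \<and> \<epsilon> ^ h * \<mu> A \<le> \<mu> A')"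
  using assms(1,2)
proof (induction h arbitrary: A)
  case 0
  then show ?case by (simp add: bc_DX)
next
  case (Suc h)
  show ?case
  proof (rule disjCI)
    assume neg: "\<not> (\<exists>A'\<in>bc. A' \<subseteq> A \<and> good \<epsilon> A' \<and> \<epsilon> ^ Suc h * \<mu> A \<le> \<mu> A')"
    show "tree (\<lambda>_. True) (Suc h) A"
      unfolding tree.simps
    proof (intro conjI allI impI)
      show AD: "A \<in> DX" using Suc bc_DX by simp
      fix C assume C: "small C"
      have "\<epsilon> ^ Suc h * \<mu> A \<le> \<mu> A"
        using assms Suc.prems power_le_one[of \<epsilon> "Suc h"] by (intro mult_left_le_one_le) auto
      then have "\<not> good \<epsilon> A" using neg Suc.prems by blast
      \<comment> \<open>Wideness over \<open>C\<close> is demanded by the tree, wideness over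
        \<open>M\<close> keeps the two halves in \<open>bc\<close>.\<close>
      moreover have "small (C \<union> M)" using C small_M small_Un by blast
      ultimately obtain b where b: "WY (C \<union> M) b"
        "\<epsilon> * \<mu> A < \<mu> (A \<inter> fib b)" "\<epsilon> * \<mu> A < \<mu> (A - fib b)"
        unfolding good_def using AD Suc.prems by (auto simp: not_le)
      have wb: "WY C b" "WY M b" using WY_anti[OF b(1)] by auto
      have sub: "tree (\<lambda>_. True) h Z" if Z: "Z \<in> bc" "Z \<subseteq> A" "\<epsilon> * \<mu> A < \<mu> Z" for Z
      proof -
        have pos: "0 < \<mu> Z" using Z assms(3) Suc.prems by (smt (verit) mult_pos_pos)
        have "\<not> (\<exists>A'\<in>bc. A' \<subseteq> Z \<and> good \<epsilon> A' \<and> \<epsilon> ^ h * \<mu> Z \<le> \<mu> A')"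
        proof
          assume "\<exists>A'\<in>bc. A' \<subseteq> Z \<and> good \<epsilon> A' \<and> \<epsilon> ^ h * \<mu> Z \<le> \<mu> A'"
          then obtain A' where A': "A' \<in> bc" "A' \<subseteq> Z" "good \<epsilon> A'" "\<epsilon> ^ h * \<mu> Z \<le> \<mu> A'" by blast
          have "\<epsilon> ^ Suc h * \<mu> A = \<epsilon> ^ h * (\<epsilon> * \<mu> A)" by simp
          also have "\<dots> \<le> \<epsilon> ^ h * \<mu> Z" using Z assms(3) by (intro mult_left_mono) auto
          finally show False using neg A' Z by (meson order_trans)
        qed
        then show ?thesis using Suc.IH[OF Z(1) pos] by blast
      qed
      have "tree (\<lambda>_. True) h (A \<inter> fib b)" "tree (\<lambda>_. True) h (A - fib b)"
        using b wb Suc.prems by (auto intro!: sub bc_Int bc_Diff bc_fib)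
      then show "\<exists>b. WY C b \<and> True \<and>
          tree (\<lambda>_. True) h (A \<inter> fib b) \<and> tree (\<lambda>_. True) h (A - fib b)"
        using wb by blast
    qed
  qed
qed

text \<open>The proportion is uniform in \<open>A\<close> because the height bound of
  \<open>tree_bounded\<close> is; this makes the exhaustion below converge geometrically.\<close>

lemma good_subset:
  assumes "0 < \<epsilon>" "\<epsilon> \<le> 1"
  obtains c where "0 < c" "c \<le> 1"
    "\<And>A. A \<in> bc \<Longrightarrow> 0 < \<mu> A \<Longrightarrow> \<exists>A'\<in>bc. A' \<subseteq> A \<and> good \<epsilon> A' \<and> c * \<mu> A \<le> \<mu> A'"
proof (rule that)
  fix A assume "A \<in> bc" "0 < \<mu> A"
  then show "\<exists>A'\<in>bc. A' \<subseteq> A \<and> good \<epsilon> A' \<and> \<epsilon> ^ chain_height (2 * k) 0 * \<mu> A \<le> \<mu> A'"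
    using good_subset_or_tree[OF _ _ assms] tree_bounded by blast
qed (use assms in \<open>auto intro: power_le_one\<close>)

text \<open>Every round removes a good piece from the remainder and multiplies its measure by at
  most 1 - c. \<open>A0\<close> is quantified before \<delta> because the remainder will be compared
  with \<open>\<mu> A0\<close>.\<close>

lemma good_exhaustion:
  assumes \<epsilon>: "0 < \<epsilon>" "\<epsilon> \<le> 1"
  obtains A0 where "A0 \<in> bc" "good \<epsilon> A0"
    "\<And>\<delta>. 0 < \<delta> \<Longrightarrow> \<exists>P. finite P \<and> P \<subseteq> bc \<and> (\<forall>A\<in>P. good \<epsilon> A) \<and> \<mu> (X - (A0 \<union> \<Union>P)) < \<delta>"
proof -
  obtain c where c: "0 < c" "c \<le> 1"
    "\<And>A. A \<in> bc \<Longrightarrow> 0 < \<mu> A \<Longrightarrow> \<exists>A'\<in>bc. A' \<subseteq> A \<and> good \<epsilon> A' \<and> c * \<mu> A \<le> \<mu> A'"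
    using good_subset[OF \<epsilon>] by metis
  obtain A0 where A0: "A0 \<in> bc" "good \<epsilon> A0" using c(3)[OF bc_X] x.total by auto
  have *: "\<exists>P. finite P \<and> P \<subseteq> bc \<and> (\<forall>A\<in>P. good \<epsilon> A) \<and> \<mu> (X - (A0 \<union> \<Union>P)) \<le> (1 - c) ^ n" for n
  proof (induction n)
    case 0
    have "\<mu> (X - A0) \<le> 1" using x.measure_mono[of "X - A0" X] bc_DX[OF A0(1)] x.total by auto
    then show ?case by (intro exI[of _ "{}"]) simp
  next
    case (Suc n)
    then obtain P where P: "finite P" "P \<subseteq> bc" "\<forall>A\<in>P. good \<epsilon> A"
      "\<mu> (X - (A0 \<union> \<Union>P)) \<le> (1 - c) ^ n" by blast
    let ?R = "X - (A0 \<union> \<Union>P)"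
    have R: "?R \<in> bc" using A0 P bc_X by (intro bc_Diff bc_Un bc_Union)
    show ?case
    proof (cases "0 < \<mu> ?R")
      case True
      then obtain A' where A': "A' \<in> bc" "A' \<subseteq> ?R" "good \<epsilon> A'" "c * \<mu> ?R \<le> \<mu> A'"
        using c(3)[OF R] by blast
      have "X - (A0 \<union> \<Union>(insert A' P)) = ?R - A'" by blast
      then have "\<mu> (X - (A0 \<union> \<Union>(insert A' P))) = \<mu> ?R - \<mu> A'"
        using x.measure_diff[of ?R A'] A' R bc_DX by simp
      also have "\<dots> \<le> (1 - c) * \<mu> ?R" using A' by (simp add: algebra_simps)
      also have "\<dots> \<le> (1 - c) * (1 - c) ^ n" using P c by (intro mult_left_mono) auto
      finally show ?thesis using P A' by (intro exI[of _ "insert A' P"]) auto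
    next
      case False
      then have "\<mu> ?R \<le> (1 - c) ^ Suc n" using c by (smt (verit) zero_le_power)
      then show ?thesis using P by blast
    qed
  qed
  show thesis
  proof (rule that[OF A0])
    fix \<delta> :: real assume "0 < \<delta>"
    then obtain n where "(1 - c) ^ n < \<delta>" using real_arch_pow_inv[of \<delta> "1 - c"] c by auto
    then show "\<exists>P. finite P \<and> P \<subseteq> bc \<and> (\<forall>A\<in>P. good \<epsilon> A) \<and> \<mu> (X - (A0 \<union> \<Union>P)) < \<delta>"
      using *[of n] by (meson le_less_trans)
  qed
qed

text \<open>The exceptional set is absorbed by the piece \<open>A0\<close>, which was chosen before its measure
  was made small.\<close>

lemma good_cover:
  assumes \<epsilon>: "0 < \<epsilon>" "\<epsilon> \<le> 1"
  obtains P where "finite P" "P \<subseteq> bc" "\<forall>A\<in>P. good \<epsilon> A" "\<Union>P = X"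
proof -
  \<comment> \<open>Half of the tolerance is for the minority inside \<open>A0\<close>, the other
    half for the remainder to be added to it.\<close>
  have e2: "0 < \<epsilon> / 2" "\<epsilon> / 2 \<le> 1" using \<epsilon> by auto
  obtain A0 where A0: "A0 \<in> bc" "good (\<epsilon> / 2) A0" and
    ex: "\<And>\<delta>. 0 < \<delta> \<Longrightarrow> \<exists>P. finite P \<and> P \<subseteq> bc \<and> (\<forall>A\<in>P. good (\<epsilon> / 2) A) \<and> \<mu> (X - (A0 \<union> \<Union>P)) < \<delta>"
    using good_exhaustion[OF e2] by metis
  have pos: "0 < \<mu> A0" using A0 by (simp add: good_def)
  obtain P where P: "finite P" "P \<subseteq> bc" "\<And>A. A \<in> P \<Longrightarrow> good (\<epsilon> / 2) A"
    "\<mu> (X - (A0 \<union> \<Union>P)) < \<epsilon> / 2 * \<mu> A0"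
    using ex[of "\<epsilon> / 2 * \<mu> A0"] pos \<epsilon> by (auto simp: mult_pos_pos)
  define R where "R = X - (A0 \<union> \<Union>P)"
  have R: "R \<in> bc" unfolding R_def using A0 P bc_X by (intro bc_Diff bc_Un bc_Union)
  note D = bc_DX[OF A0(1)] bc_DX[OF R]
  have \<mu>A: "\<mu> A0 \<le> \<mu> (A0 \<union> R)" using D by (intro x.measure_mono) auto
  have mono: "good \<epsilon> A" if good_A: "good (\<epsilon> / 2) A" for A
  proof -
    have A: "A \<in> DX" "0 < \<mu> A" using that by (simp_all add: good_def)
    then have "\<epsilon> / 2 * \<mu> A \<le> \<epsilon> * \<mu> A" using \<epsilon> by (intro mult_right_mono) auto
    moreover obtain C where C: "small C" "\<And>b. WY C b \<Longrightarrow>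
        \<mu> (A \<inter> fib b) \<le> \<epsilon> / 2 * \<mu> A \<or> \<mu> (A - fib b) \<le> \<epsilon> / 2 * \<mu> A"
      using good_A unfolding good_def by blast
    ultimately have "\<mu> (A \<inter> fib b) \<le> \<epsilon> * \<mu> A \<or> \<mu> (A - fib b) \<le> \<epsilon> * \<mu> A" if "WY C b" for b
      using C(2)[OF that] by linarith
    then show ?thesis unfolding good_def using A C(1) by (intro conjI exI[of _ C]) auto
  qed
  have "good \<epsilon> (A0 \<union> R)"
  proof -
    obtain C where C: "small C" "\<And>b. WY C b \<Longrightarrow>
        \<mu> (A0 \<inter> fib b) \<le> \<epsilon> / 2 * \<mu> A0 \<or> \<mu> (A0 - fib b) \<le> \<epsilon> / 2 * \<mu> A0"
      using A0 unfolding good_def by blast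
    \<comment> \<open>The worst case is assumed on the remainder: all of \<open>R\<close> may lie in
      the minority.\<close>
    have bound: "\<mu> (Z1 \<union> Z2) \<le> \<epsilon> * \<mu> (A0 \<union> R)"
      if "\<mu> Z1 \<le> \<epsilon> / 2 * \<mu> A0" "Z1 \<in> DX" "Z2 \<in> DX" "Z2 \<subseteq> R" for Z1 Z2
    proof -
      have "\<mu> (Z1 \<union> Z2) \<le> \<mu> Z1 + \<mu> Z2" using that by (intro x.measure_Un_le)
      also have "\<mu> Z2 \<le> \<epsilon> / 2 * \<mu> A0"
        using x.measure_mono[of Z2 R] that D P(4) unfolding R_def by linarith
      finally have "\<mu> (Z1 \<union> Z2) \<le> \<epsilon> * \<mu> A0" using that by simp
      also have "\<dots> \<le> \<epsilon> * \<mu> (A0 \<union> R)" using \<mu>A \<epsilon> by (intro mult_left_mono) auto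
      finally show ?thesis .
    qed
    have "\<mu> ((A0 \<union> R) \<inter> fib b) \<le> \<epsilon> * \<mu> (A0 \<union> R) \<or> \<mu> ((A0 \<union> R) - fib b) \<le> \<epsilon> * \<mu> (A0 \<union> R)"
      if "WY C b" for b
    proof -
      have f: "fib b \<in> DX" using that WY_in fibreX by blast
      have "(A0 \<union> R) \<inter> fib b = (A0 \<inter> fib b) \<union> (R \<inter> fib b)"
        "(A0 \<union> R) - fib b = (A0 - fib b) \<union> (R - fib b)" by blast+
      then show ?thesis
        using C(2)[OF that] bound[of "A0 \<inter> fib b" "R \<inter> fib b"] bound[of "A0 - fib b" "R - fib b"] f D
        by auto
    qed
    then show ?thesis using C \<mu>A pos D unfolding good_def by auto
  qed
  moreover have "A0 \<union> R \<union> \<Union>P = X"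
  proof -
    have "A0 \<subseteq> X" "\<Union>P \<subseteq> X" using A0 P bc_DX x.sets_into_space by blast+
    then show ?thesis unfolding R_def by blast
  qed
  ultimately show thesis
    using P bc_Un[OF A0(1) R] mono by (intro that[of "insert (A0 \<union> R) P"]) blast+
qed


subsection \<open>Pairs of good sets\<close>

text \<open>A substitute for having measure at least \<delta> that makes sense for sets outside
  \<open>DY\<close>, such as the set of parameters with a given majority value: wide elements
  survive the removal of any member of \<open>DY\<close> of measure below \<delta>.\<close>

definition thick :: "real \<Rightarrow> 'b set \<Rightarrow> bool" where
  "thick \<delta> G \<longleftrightarrow> (\<forall>C D. small C \<longrightarrow> D \<in> DY \<longrightarrow> \<nu> D < \<delta> \<longrightarrow> (\<exists>b\<in>G - D. WY C b))"

text \<open>The colour \<open>d\<close> of a new pair is the majority value of \<open>u\<close> on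
  \<Theta>. By thickness of both sets, \<open>v\<close> can be taken with majority value opposite to
  \<open>d\<close> on \<Phi>, so the points of \<Phi> and \<Theta> unfit for later choices always
  form small sets. The part of goodness of \<Phi> that matters is contained in \<open>G1\<close> and
  \<open>G0\<close>.\<close>

lemma good_pair:
  fixes \<epsilon> \<eta> :: real
  assumes \<Phi>: "\<Phi> \<in> DX" "0 < \<mu> \<Phi>"
    and \<Theta>: "\<Theta> \<in> DY" "0 < \<nu> \<Theta>" "small C0" "\<And>a. WX C0 a \<Longrightarrow>
      \<nu> (\<Theta> \<inter> {b \<in> Y. E a b}) \<le> \<eta> * \<nu> \<Theta> \<or> \<nu> (\<Theta> - {b \<in> Y. E a b}) \<le> \<eta> * \<nu> \<Theta>"
    and \<eta>: "2 * k * \<eta> < \<epsilon>" "\<epsilon> \<le> 1" "0 \<le> \<eta>"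
    and G1: "thick (\<epsilon> * \<nu> \<Theta>) (\<Theta> \<inter> {b. \<mu> (\<Phi> - fib b) \<le> \<eta> * \<mu> \<Phi>})"
    and G0: "thick (\<epsilon> * \<nu> \<Theta>) (\<Theta> \<inter> {b. \<mu> (\<Phi> \<inter> fib b) \<le> \<eta> * \<mu> \<Phi>})"
  shows False
proof -
  have "n \<le> 2 * k \<Longrightarrow> \<exists>a b c. chain n a b c \<and>
     (\<forall>j<n. \<mu> {u \<in> \<Phi>. E u (b j) = c j} \<le> \<eta> * \<mu> \<Phi>) \<and>
     (\<forall>i<n. \<nu> {v \<in> \<Theta>. E (a i) v \<noteq> c i} \<le> \<eta> * \<nu> \<Theta>)" for n
  proof (induction n)
    case 0
    then show ?case
      by (intro exI[of _ "\<lambda>_. undefined"] exI[of _ "\<lambda>_. undefined"] exI[of _ "\<lambda>_. True"])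
        (simp add: chain_def)
  next
    case (Suc n)
    then have "n \<le> 2 * k" by simp
    from Suc.IH[OF this] obtain a b c where ch: "chain n a b c"
      and b: "\<And>j. j < n \<Longrightarrow> \<mu> {u \<in> \<Phi>. E u (b j) = c j} \<le> \<eta> * \<mu> \<Phi>"
      and a: "\<And>i. i < n \<Longrightarrow> \<nu> {v \<in> \<Theta>. E (a i) v \<noteq> c i} \<le> \<eta> * \<nu> \<Theta>"
      by (elim exE conjE) (rule that; blast)
    have \<Phi>X: "\<Phi> \<subseteq> X" and \<Theta>Y: "\<Theta> \<subseteq> Y" using \<Phi> \<Theta> x.sets_into_space y.sets_into_space by auto
    have DXc: "{u \<in> \<Phi>. E u v = d} \<in> DX" if "v \<in> Y" for v d
    proof -
      have "{u \<in> \<Phi>. E u v = d} = (if d then \<Phi> \<inter> fib v else \<Phi> - fib v)" using \<Phi>X by auto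
      then show ?thesis using \<Phi> fibreX[OF that] by auto
    qed
    have DYc: "{v \<in> \<Theta>. E u v \<noteq> d} \<in> DY" if "u \<in> X" for u d
    proof -
      have "{v \<in> \<Theta>. E u v \<noteq> d} = (if d then \<Theta> - {b \<in> Y. E u b} else \<Theta> \<inter> {b \<in> Y. E u b})"
        using \<Theta>Y by auto
      then show ?thesis using \<Theta> fibreY[OF that] by auto
    qed
    let ?U = "\<Union>j<n. {u \<in> \<Phi>. E u (b j) = c j}"
    have U: "?U \<in> DX \<and> \<mu> ?U \<le> card {..<n} * (\<eta> * \<mu> \<Phi>)"
      using b DXc chain_in[OF ch] by (intro x.measure_UN_le) auto
    \<comment> \<open>The n earlier parameters exclude less than the whole of \<Phi>, since
      \<open>2 * k * \<eta> < \<epsilon> \<le> 1\<close>.\<close>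
    have "n * \<eta> \<le> 2 * k * \<eta>" using Suc.prems \<eta> by (intro mult_right_mono) auto
    then have "n * \<eta> * \<mu> \<Phi> < \<mu> \<Phi>" using \<eta> \<Phi>(2) by simp
    then have "\<mu> ?U < \<mu> \<Phi>" using U by (simp add: mult.assoc)
    moreover have "?U \<subseteq> \<Phi>" by blast
    ultimately have "0 < \<mu> (\<Phi> - ?U)" using x.measure_diff[of \<Phi> ?U] U \<Phi> by simp
    moreover have "small (prev a b n \<union> C0)" using chain_small[OF ch] \<Theta>(3) small_Un by blast
    ultimately obtain u where u: "u \<in> \<Phi> - ?U" "WX (prev a b n \<union> C0) u"
      using WX_ex[of "prev a b n \<union> C0" "\<Phi> - ?U"] U \<Phi> by auto
    have wu: "WX (prev a b n) u" "WX C0 u" using WX_anti[OF u(2)] by auto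
    have uX: "u \<in> X" using wu WX_in by blast
    have "\<Theta> \<inter> {b \<in> Y. E u b} = {v \<in> \<Theta>. E u v \<noteq> False}" "\<Theta> - {b \<in> Y. E u b} = {v \<in> \<Theta>. E u v \<noteq> True}"
      using \<Theta>Y by auto
    then have "\<nu> {v \<in> \<Theta>. E u v \<noteq> False} \<le> \<eta> * \<nu> \<Theta> \<or> \<nu> {v \<in> \<Theta>. E u v \<noteq> True} \<le> \<eta> * \<nu> \<Theta>"
      using \<Theta>(4)[OF wu(2)] by (simp only:)
    then obtain d where d: "\<nu> {v \<in> \<Theta>. E u v \<noteq> d} \<le> \<eta> * \<nu> \<Theta>"
      by (elim disjE) (rule that, assumption)+
    define a' where "a' = a(n := u)"
    have a': "\<nu> {v \<in> \<Theta>. E (a' i) v \<noteq> (c(n := d)) i} \<le> \<eta> * \<nu> \<Theta>" "a' i \<in> X" if "i < Suc n" for i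
      using that a d uX chain_in[OF ch] by (auto simp: a'_def less_Suc_eq)
    \<comment> \<open>The new \<open>u\<close> is included: \<open>v\<close> must also follow the
      majority value of \<open>u\<close>, which gives \<open>E u v = d\<close>.\<close>
    let ?V = "\<Union>i<Suc n. {v \<in> \<Theta>. E (a' i) v \<noteq> (c(n := d)) i}"
    have V: "?V \<in> DY \<and> \<nu> ?V \<le> card {..<Suc n} * (\<eta> * \<nu> \<Theta>)"
      using a' DYc by (intro y.measure_UN_le) auto
    have "Suc n * \<eta> \<le> 2 * k * \<eta>" using Suc.prems \<eta> by (intro mult_right_mono) (auto simp del: of_nat_Suc)
    then have "Suc n * \<eta> * \<nu> \<Theta> < \<epsilon> * \<nu> \<Theta>" using \<eta> \<Theta>(2) by (intro mult_strict_right_mono) auto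
    then have "\<nu> ?V < \<epsilon> * \<nu> \<Theta>" using V by (simp add: mult.assoc del: of_nat_Suc)
    moreover have "thick (\<epsilon> * \<nu> \<Theta>) (\<Theta> \<inter> {v. \<mu> {u \<in> \<Phi>. E u v = d} \<le> \<eta> * \<mu> \<Phi>})"
    proof -
      have "{u \<in> \<Phi>. E u v = d} = (if d then \<Phi> \<inter> fib v else \<Phi> - fib v)" for v using \<Phi>X by auto
      then show ?thesis using G0 G1 by (cases d) simp_all
    qed
    moreover have "small (prev a b n \<union> eX u)" using chain_small[OF ch] small_eX[OF uX] small_Un by blast
    ultimately obtain v where v: "v \<in> \<Theta>" "\<mu> {u \<in> \<Phi>. E u v = d} \<le> \<eta> * \<mu> \<Phi>" "v \<notin> ?V"
      "WY (prev a b n \<union> eX u) v"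
      using V unfolding thick_def by blast
    have Ev: "E (a' i) v = (c(n := d)) i" if "i < Suc n" for i
      using v that by blast
    have "E u (b j) = (\<not> c j)" if "j < n" for j using u that by auto
    moreover have "E (a i) v = d" if "i < n" "c i = d" for i
      using Ev[of i] that by (simp add: a'_def)
    moreover have "E u v = d" using Ev[of n] by (simp add: a'_def)
    ultimately have ch': "chain (Suc n) a' (b(n := v)) (c(n := d))"
      unfolding a'_def by (intro chain_Suc[OF ch wu(1) v(4)])
    have b': "\<forall>j<Suc n. \<mu> {w \<in> \<Phi>. E w ((b(n := v)) j) = (c(n := d)) j} \<le> \<eta> * \<mu> \<Phi>"
      using b v by (auto simp: less_Suc_eq)
    show ?case
      by (intro exI[of _ a'] exI[of _ "b(n := v)"] exI[of _ "c(n := d)"] conjI ch' b') (use a'(1) in blast)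
  qed
  from this[OF order_refl] obtain a b c where "chain (2 * k) a b c" by (elim exE conjE)
  then show False using no_chain by simp
qed

end


subsection \<open>Regular Borel measures on Stone spaces\<close>

lemma space_borel_sets_of: "space (borel_sets_of T) = topspace T"
  unfolding borel_sets_of_def by (rule space_measure_of) (auto dest: openin_subset)

lemma sets_borel_sets_of: "sets (borel_sets_of T) = sigma_sets (topspace T) {U. openin T U}"
  unfolding borel_sets_of_def by (rule sets_measure_of) (auto dest: openin_subset)

lemma openin_borel: "openin T U \<Longrightarrow> U \<in> sets (borel_sets_of T)"
  by (simp add: sets_borel_sets_of sigma_sets.Basic)

lemma closedin_borel: "closedin T K \<Longrightarrow> K \<in> sets (borel_sets_of T)"
  using sets.Diff[OF sets.top openin_borel[of T "topspace T - K"]]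
  by (simp add: closedin_def space_borel_sets_of Diff_Diff_Int Int_absorb1)

lemma continuous_map_borel:
  assumes "continuous_map T T' f"
  shows "f \<in> borel_sets_of T \<rightarrow>\<^sub>M borel_sets_of T'"
  unfolding borel_sets_of_def[of T']
proof (rule measurable_sigma_sets[OF sets_measure_of])
  show "f \<in> space (borel_sets_of T) \<rightarrow> topspace T'"
    using assms by (auto simp: space_borel_sets_of continuous_map_def)
  fix U assume "U \<in> {U. openin T' U}"
  then have "openin T {x \<in> topspace T. f x \<in> U}"
    using assms by (auto simp: continuous_map_def)
  moreover have "f -` U \<inter> space (borel_sets_of T) = {x \<in> topspace T. f x \<in> U}"
    by (auto simp: space_borel_sets_of)
  ultimately show "f -` U \<inter> space (borel_sets_of T) \<in> sets (borel_sets_of T)"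
    by (simp add: openin_borel)
qed (auto dest: openin_subset)

text \<open>Inner regularity of a set is outer regularity of its complement, because complements of
  open sets are compact here.\<close>

lemma regular_borel_probabilityI:
  assumes T: "compact_space T" "Hausdorff_space T" and m: "prob_space m"
    and sets: "sets m = sets (borel_sets_of T)"
    and outer: "\<And>B e. B \<in> sets m \<Longrightarrow> 0 < e \<Longrightarrow>
      \<exists>U. openin T U \<and> B \<subseteq> U \<and> measure m U \<le> measure m B + e"
  shows "regular_borel_probability T m"
  unfolding regular_borel_probability_def
proof (intro conjI ballI m sets)
  interpret prob_space m by (rule m)
  have sp: "space m = topspace T" using sets_eq_imp_space_eq[OF sets] by (simp add: space_borel_sets_of)
  fix B assume B: "B \<in> sets m"
  show "emeasure m B = (INF U\<in>{U. openin T U \<and> B \<subseteq> U}. emeasure m U)"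
  proof (rule antisym)
    show "emeasure m B \<le> (INF U\<in>{U. openin T U \<and> B \<subseteq> U}. emeasure m U)"
      using sets openin_borel by (intro INF_greatest emeasure_mono) auto
    show "(INF U\<in>{U. openin T U \<and> B \<subseteq> U}. emeasure m U) \<le> emeasure m B"
    proof (rule ennreal_le_epsilon)
      fix e :: real assume "0 < e"
      then obtain U where U: "openin T U" "B \<subseteq> U" "measure m U \<le> measure m B + e"
        using outer[OF B] by blast
      have "(INF U\<in>{U. openin T U \<and> B \<subseteq> U}. emeasure m U) \<le> emeasure m U"
        using U by (intro INF_lower) auto
      also have "\<dots> \<le> emeasure m B + ennreal e"
        using U(3) \<open>0 < e\<close> by (simp add: emeasure_eq_measure flip: ennreal_plus)
      finally show "(INF U\<in>{U. openin T U \<and> B \<subseteq> U}. emeasure m U) \<le> emeasure m B + ennreal e" .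
    qed
  qed
  show "emeasure m B = (SUP K\<in>{K. compactin T K \<and> K \<subseteq> B}. emeasure m K)"
  proof (rule antisym)
    show "(SUP K\<in>{K. compactin T K \<and> K \<subseteq> B}. emeasure m K) \<le> emeasure m B"
      using B by (intro SUP_least emeasure_mono) auto
    show "emeasure m B \<le> (SUP K\<in>{K. compactin T K \<and> K \<subseteq> B}. emeasure m K)"
    proof (rule ennreal_le_epsilon)
      fix e :: real assume "0 < e"
      then obtain U where U: "openin T U" "topspace T - B \<subseteq> U"
        "measure m U \<le> measure m (topspace T - B) + e"
        using outer[of "topspace T - B"] B sp by (metis sets.compl_sets)
      let ?K = "topspace T - U"
      have UT: "U \<in> sets m" "B \<subseteq> topspace T" "U \<subseteq> topspace T"
        using openin_borel[OF U(1)] openin_subset[OF U(1)] sets.sets_into_space[OF B] sets sp by auto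
      have "compactin T ?K" using T U by (intro closedin_compact_space) auto
      moreover have "?K \<subseteq> B" using U UT by blast
      moreover have "measure m B \<le> measure m ?K + e"
        using U(3) prob_compl[OF B] prob_compl[OF UT(1)] sp by simp
      ultimately show "emeasure m B \<le> (SUP K\<in>{K. compactin T K \<and> K \<subseteq> B}. emeasure m K) + ennreal e"
        using \<open>0 < e\<close>
        by (intro order.trans[OF _ add_right_mono[OF SUP_upper[of ?K]]])
          (auto simp: emeasure_eq_measure simp flip: ennreal_plus)
    qed
  qed
qed

lemma regular_borel_probability_outer:
  "regular_borel_probability T m \<Longrightarrow> B \<in> sets m \<Longrightarrow>
    emeasure m B = (INF U\<in>{U. openin T U \<and> B \<subseteq> U}. emeasure m U)"
  unfolding regular_borel_probability_def by blast

lemma regular_borel_probability_inner: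
  assumes "regular_borel_probability T m" "Hausdorff_space T" "B \<in> sets m" "0 < e"
  obtains K where "compactin T K" "closedin T K" "K \<subseteq> B" "measure m B < measure m K + e"
proof -
  interpret prob_space m using assms by (simp add: regular_borel_probability_def)
  have eq: "emeasure m B = (SUP K\<in>{K. compactin T K \<and> K \<subseteq> B}. emeasure m K)"
    using assms unfolding regular_borel_probability_def by blast
  have "\<exists>K. compactin T K \<and> K \<subseteq> B \<and> measure m B < measure m K + e"
  proof (rule ccontr)
    assume neg: "\<not> ?thesis"
    \<comment> \<open>The empty set is compact, so \<open>e\<close> is at most the measure of
      \<open>B\<close> and \<open>ennreal\<close> does not truncate the difference below.\<close>
    then have "\<not> measure m B < measure m {} + e" by blast
    then have "e \<le> measure m B" by simp
    have "emeasure m B \<le> ennreal (measure m B - e)"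
      unfolding eq
    proof (rule SUP_least)
      fix K assume "K \<in> {K. compactin T K \<and> K \<subseteq> B}"
      then have "\<not> measure m B < measure m K + e" using neg by blast
      then have "measure m K \<le> measure m B - e" by linarith
      then show "emeasure m K \<le> ennreal (measure m B - e)"
        by (simp add: emeasure_eq_measure ennreal_leI)
    qed
    then show False
      using \<open>e \<le> measure m B\<close> assms(4) by (simp add: emeasure_eq_measure)
  qed
  then obtain K where K: "compactin T K" "K \<subseteq> B" "measure m B < measure m K + e" by blast
  then show ?thesis using assms(2) by (intro that[of K] compactin_imp_closedin) auto
qed

text \<open>To find an open hull of \<open>B\<close>, a compact set nearly filling the preimage of
  the complement of \<open>B\<close> is mapped forward; its image is compact, hence closed, and the
  complement of the image is the hull.\<close>

lemma regular_borel_probability_distr: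
  assumes m: "regular_borel_probability T m" and f: "continuous_map T T' f"
    and T: "Hausdorff_space T" "compact_space T'" "Hausdorff_space T'"
  shows "regular_borel_probability T' (distr m (borel_sets_of T') f)"
proof (rule regular_borel_probabilityI[OF T(2,3)])
  interpret prob_space m using m by (simp add: regular_borel_probability_def)
  have sm: "sets m = sets (borel_sets_of T)" using m by (simp add: regular_borel_probability_def)
  have fm: "f \<in> m \<rightarrow>\<^sub>M borel_sets_of T'"
    using continuous_map_borel[OF f] measurable_cong_sets[OF sm refl] by blast
  show P: "prob_space (distr m (borel_sets_of T') f)" by (rule prob_space_distr[OF fm])
  interpret D: prob_space "distr m (borel_sets_of T') f" by (rule P)
  show "sets (distr m (borel_sets_of T') f) = sets (borel_sets_of T')" by simp
  fix B and e :: real assume B: "B \<in> sets (distr m (borel_sets_of T') f)" and e: "0 < e"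
  let ?C = "topspace T' - B"
  have C: "?C \<in> sets (borel_sets_of T')"
    using B by (auto simp flip: space_borel_sets_of)
  obtain K where K: "compactin T K" "K \<subseteq> f -` ?C \<inter> space m" "closedin T K"
    "measure m (f -` ?C \<inter> space m) < measure m K + e"
    using regular_borel_probability_inner[OF m T(1) measurable_sets[OF fm C] e] by metis
  have fK: "closedin T' (f ` K)" "f ` K \<subseteq> ?C"
    using compactin_imp_closedin[OF T(3) image_compactin[OF K(1) f]] K by auto
  let ?U = "topspace T' - f ` K"
  have U: "openin T' ?U" "B \<subseteq> ?U"
    using fK B sets.sets_into_space[OF B] by (auto simp: space_borel_sets_of)
  have fKs: "f ` K \<in> sets (borel_sets_of T')" using fK closedin_borel by blast
  have "measure m K \<le> measure m (f -` (f ` K) \<inter> space m)"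
    using K measurable_sets[OF fm fKs] by (intro finite_measure_mono) auto
  then have "D.prob ?C \<le> D.prob (f ` K) + e"
    using K(4) by (simp add: measure_distr[OF fm C] measure_distr[OF fm fKs])
  moreover have "D.prob ?C = 1 - D.prob B" "D.prob ?U = 1 - D.prob (f ` K)"
    using D.prob_compl[OF B] D.prob_compl[of "f ` K"] fKs by (simp_all add: space_borel_sets_of)
  ultimately have "D.prob ?U \<le> D.prob B + e" by simp
  then show "\<exists>U. openin T' U \<and> B \<subseteq> U \<and> D.prob U \<le> D.prob B + e" using U by blast
qed

text \<open>Complements stay in the algebra, so its members are clopen and hence compact. Countable
  covers of them therefore reduce to finite ones, and finite additivity is enough for a countably
  additive extension.\<close>

locale stone_content =
  finitely_additive_prob "topspace T" \<C> \<mu> for T :: "'a topology" and \<C> \<mu> +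
  assumes compact: "compact_space T" and Hausdorff: "Hausdorff_space T"
    and open_\<C>: "C \<in> \<C> \<Longrightarrow> openin T C"
    and base: "openin T U \<Longrightarrow> x \<in> U \<Longrightarrow> \<exists>C\<in>\<C>. x \<in> C \<and> C \<subseteq> U"
begin

lemma closed_\<C>: "C \<in> \<C> \<Longrightarrow> closedin T C"
  using open_\<C>[of "topspace T - C"] sets_into_space[of C]
  by (simp add: closedin_def compl_sets)

lemma compact_\<C>: "C \<in> \<C> \<Longrightarrow> compactin T C"
  using closedin_compact_space[OF compact closed_\<C>] .

text \<open>The cover is refined to members of the algebra before a finite part is taken, so that
  \<mu> can be applied to the pieces.\<close>

lemma compact_cover:
  assumes K: "compactin T K" and U: "\<And>i. i \<in> I \<Longrightarrow> openin T (U i)" and sub: "K \<subseteq> (\<Union>i\<in>I. U i)"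
  obtains F where "finite F" "F \<subseteq> \<C>" "\<And>C. C \<in> F \<Longrightarrow> \<exists>i\<in>I. C \<subseteq> U i" "K \<subseteq> \<Union>F"
proof -
  define \<U> where "\<U> = {C \<in> \<C>. \<exists>i\<in>I. C \<subseteq> U i}"
  have "\<forall>C\<in>\<U>. openin T C" using open_\<C> by (auto simp: \<U>_def)
  moreover have "K \<subseteq> \<Union>\<U>"
  proof
    fix x assume "x \<in> K"
    then obtain i where "i \<in> I" "x \<in> U i" using sub by blast
    then show "x \<in> \<Union>\<U>" using base[OF U, of i x] by (auto simp: \<U>_def)
  qed
  ultimately obtain F where F: "finite F" "F \<subseteq> \<U>" "K \<subseteq> \<Union>F"
    using K unfolding compactin_def by meson
  show ?thesis using F by (intro that[of F]) (auto simp: \<U>_def)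
qed

lemma compact_open_between:
  assumes "compactin T K" "openin T U" "K \<subseteq> U"
  obtains C where "C \<in> \<C>" "K \<subseteq> C" "C \<subseteq> U"
proof -
  obtain F where F: "finite F" "F \<subseteq> \<C>" "\<And>C. C \<in> F \<Longrightarrow> \<exists>i\<in>{()}. C \<subseteq> U" "K \<subseteq> \<Union>F"
    using compact_cover[of K "{()}" "\<lambda>_. U"] assms by auto
  then show ?thesis by (intro that[of "\<Union>F"] finite_Union) auto
qed

section \<open>Caratheodory extension of a content on clopen sets\<close>

definition inner :: "'a set \<Rightarrow> ennreal" where
  "inner U = (SUP C\<in>{C\<in>\<C>. C \<subseteq> U}. ennreal (\<mu> C))"

definition outer :: "'a set \<Rightarrow> ennreal" where
  "outer E = (INF U\<in>{U. openin T U \<and> E \<subseteq> U}. inner U)"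

lemma inner_mono: "U \<subseteq> V \<Longrightarrow> inner U \<le> inner V"
  unfolding inner_def by (intro SUP_subset_mono) auto

lemma inner_\<C>: "C \<in> \<C> \<Longrightarrow> inner C = \<mu> C"
  unfolding inner_def
  by (intro antisym SUP_least SUP_upper) (auto intro!: ennreal_leI measure_mono)

lemma outer_open: "openin T U \<Longrightarrow> outer U = inner U"
  unfolding outer_def
  by (intro antisym INF_greatest INF_lower) (auto intro: inner_mono)

lemma outer_mono: "E \<subseteq> E' \<Longrightarrow> outer E \<le> outer E'"
  unfolding outer_def by (intro INF_superset_mono) auto

lemma outer_le: "openin T U \<Longrightarrow> E \<subseteq> U \<Longrightarrow> outer E \<le> inner U"
  unfolding outer_def by (intro INF_lower) auto

lemma outer_empty: "outer {} = 0"
  using outer_open[of "{}"] inner_\<C>[of "{}"] by (simp add: measure_empty)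

lemma outer_topspace: "outer (topspace T) = 1"
  using outer_open[of "topspace T"] inner_\<C>[of "topspace T"] total by simp

lemma content_UN_le:
  assumes "finite I" "\<And>i. i \<in> I \<Longrightarrow> A i \<in> \<C>"
  shows "\<mu> (\<Union>i\<in>I. A i) \<le> (\<Sum>i\<in>I. \<mu> (A i))"
  using assms
proof (induction I)
  case (insert i I)
  then have "(\<Union>i\<in>I. A i) \<in> \<C>" by auto
  then show ?case using insert measure_Un_le[of "A i" "\<Union>i\<in>I. A i"] by fastforce
qed (simp add: measure_empty)

text \<open>A clopen subset of the union is covered by finitely many clopen pieces, each inside some
  \<open>U i\<close>. Pieces assigned to the same index are merged, so that finite subadditivity
  yields one summand per index.\<close>

lemma inner_UN_le:
  fixes U :: "nat \<Rightarrow> 'a set"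
  assumes U: "\<And>i. openin T (U i)"
  shows "inner (\<Union>i. U i) \<le> (\<Sum>i. inner (U i))"
  unfolding inner_def[of "\<Union>i. U i"]
proof (rule SUP_least)
  fix C assume "C \<in> {C \<in> \<C>. C \<subseteq> (\<Union>i. U i)}"
  then have C: "C \<in> \<C>" "C \<subseteq> (\<Union>i. U i)" by auto
  obtain F where F: "finite F" "F \<subseteq> \<C>" "\<And>D. D \<in> F \<Longrightarrow> \<exists>i\<in>UNIV. D \<subseteq> U i" "C \<subseteq> \<Union>F"
    using compact_cover[of C UNIV U, OF compact_\<C>[OF C(1)] U C(2)] by metis
  then obtain g where g: "\<And>D. D \<in> F \<Longrightarrow> D \<subseteq> U (g D)" by metis
  define A where "A i = \<Union>{D \<in> F. g D = i}" for i
  have A: "A i \<in> \<C>" "A i \<subseteq> U i" for i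
    using F(1,2) g unfolding A_def by (auto intro!: finite_Union; blast)+
  have "C \<subseteq> (\<Union>i\<in>g ` F. A i)" using F(4) unfolding A_def by blast
  moreover have "(\<Union>i\<in>g ` F. A i) \<in> \<C>" using F A by auto
  ultimately have "\<mu> C \<le> \<mu> (\<Union>i\<in>g ` F. A i)" using C by (intro measure_mono)
  also have "\<dots> \<le> (\<Sum>i\<in>g ` F. \<mu> (A i))" using F A by (intro content_UN_le) auto
  finally have "ennreal (\<mu> C) \<le> ennreal (\<Sum>i\<in>g ` F. \<mu> (A i))" by (rule ennreal_leI)
  also have "\<dots> = (\<Sum>i\<in>g ` F. ennreal (\<mu> (A i)))" using A nonneg by (intro sum_ennreal[symmetric]) auto
  also have "\<dots> = (\<Sum>i\<in>g ` F. inner (A i))" using A inner_\<C> by simp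
  also have "\<dots> \<le> (\<Sum>i\<in>g ` F. inner (U i))" using A by (intro sum_mono inner_mono)
  also have "\<dots> \<le> (\<Sum>i. inner (U i))" using F by (intro sum_le_suminf) auto
  finally show "ennreal (\<mu> C) \<le> (\<Sum>i. inner (U i))" .
qed

lemma outer_countably_subadditive: "countably_subadditive (Pow (topspace T)) outer"
proof (simp add: countably_subadditive_def, safe)
  fix A :: "nat \<Rightarrow> 'a set" assume A: "range A \<subseteq> Pow (topspace T)"
  show "outer (\<Union>i. A i) \<le> (\<Sum>n. outer (A n))"
  proof (rule ennreal_le_epsilon)
    fix e :: real assume e: "0 < e" and fin: "(\<Sum>n. outer (A n)) < top"
    have "outer (A n) < outer (A n) + e * (1/2)^Suc n" for n
      using e fin by (auto simp add: less_top dest!: ennreal_suminf_lessD)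
    then have "\<exists>U. openin T U \<and> A n \<subseteq> U \<and> inner U < outer (A n) + e * (1/2)^Suc n" for n
      unfolding outer_def INF_less_iff by blast
    then obtain U where U: "\<And>n. openin T (U n)" "\<And>n. A n \<subseteq> U n"
      "\<And>n. inner (U n) < outer (A n) + e * (1/2)^Suc n" by metis
    have "outer (\<Union>i. A i) \<le> inner (\<Union>i. U i)" using U by (intro outer_le) auto
    also have "\<dots> \<le> (\<Sum>i. inner (U i))" by (rule inner_UN_le) (rule U)
    also have "\<dots> \<le> (\<Sum>n. outer (A n) + e * (1/2) ^ Suc n)"
      using U(3) by (intro suminf_le) (auto intro: less_imp_le)
    also have "\<dots> = (\<Sum>n. outer (A n)) + (\<Sum>n. ennreal e * ennreal ((1/2) ^ Suc n))"
      using e by (subst suminf_add[symmetric])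
        (auto simp del: ennreal_suminf_cmult simp add: ennreal_mult[symmetric])
    also have "\<dots> = (\<Sum>n. outer (A n)) + e"
      unfolding ennreal_suminf_cmult
      by (subst suminf_ennreal_eq[OF zero_le_power power_half_series]) auto
    finally show "outer (\<Union>i. A i) \<le> (\<Sum>n. outer (A n)) + e" .
  qed
qed

lemma outer_measure_space_outer: "outer_measure_space (Pow (topspace T)) outer"
  unfolding outer_measure_space_def
  using outer_countably_subadditive outer_mono outer_empty
  by (auto simp: positive_def increasing_def)

text \<open>If \<open>C\<close> is a clopen part of \<open>V \<inter> U\<close>, then
  \<open>V - C\<close> is still open, still contains \<open>E - U\<close>, and its clopen subsets
  are disjoint from \<open>C\<close>; additivity applies, and the supremum over \<open>C\<close>
  comes last.\<close>

lemma outer_split_open: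
  assumes U: "openin T U" and E: "E \<subseteq> topspace T"
  shows "outer (E \<inter> U) + outer (E - U) \<le> outer E"
  unfolding outer_def[of E]
proof (rule INF_greatest)
  fix V assume "V \<in> {V. openin T V \<and> E \<subseteq> V}"
  then have V: "openin T V" "E \<subseteq> V" by auto
  have *: "ennreal (\<mu> C) + outer (E - U) \<le> inner V" if C: "C \<in> \<C>" "C \<subseteq> V \<inter> U" for C
  proof -
    have "ennreal (\<mu> C) + outer (E - U) \<le> ennreal (\<mu> C) + inner (V - C)"
      using V C closed_\<C>[OF C(1)] by (intro add_left_mono outer_le) (auto intro: openin_diff)
    also have "\<dots> = (SUP D\<in>{D\<in>\<C>. D \<subseteq> V - C}. ennreal (\<mu> C) + ennreal (\<mu> D))"
      unfolding inner_def by (rule ennreal_SUP_add_right) auto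
    also have "\<dots> \<le> inner V"
    proof (rule SUP_least)
      fix D assume "D \<in> {D \<in> \<C>. D \<subseteq> V - C}"
      then have D: "D \<in> \<C>" "D \<subseteq> V - C" by auto
      have "ennreal (\<mu> C) + ennreal (\<mu> D) = ennreal (\<mu> C + \<mu> D)" using C D nonneg by simp
      also have "\<mu> C + \<mu> D = \<mu> (C \<union> D)" using C D by (subst additive) auto
      also have "ennreal (\<mu> (C \<union> D)) \<le> inner V"
        using C D unfolding inner_def by (intro SUP_upper) auto
      finally show "ennreal (\<mu> C) + ennreal (\<mu> D) \<le> inner V" .
    qed
    finally show ?thesis .
  qed
  have "outer (E \<inter> U) + outer (E - U) \<le> inner (V \<inter> U) + outer (E - U)"
    using V U by (intro add_right_mono outer_le) auto
  also have "\<dots> = (SUP C\<in>{C\<in>\<C>. C \<subseteq> V \<inter> U}. ennreal (\<mu> C) + outer (E - U))"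
    unfolding inner_def by (rule ennreal_SUP_add_left[symmetric]) auto
  also have "\<dots> \<le> inner V" using * by (intro SUP_least) auto
  finally show "outer (E \<inter> U) + outer (E - U) \<le> inner V" .
qed

lemma lambda_system_open:
  assumes U: "openin T U"
  shows "U \<in> lambda_system (topspace T) (Pow (topspace T)) outer"
proof -
  have P: "ring_of_sets (topspace T) (Pow (topspace T))" by (rule ring_of_sets_Pow)
  have "subadditive (Pow (topspace T)) outer"
    using outer_measure_space_outer ring_of_sets.countably_subadditive_subadditive[OF P]
    by (simp add: outer_measure_space_def)
  then have le: "outer (A \<union> B) \<le> outer A + outer B"
    if "A \<subseteq> topspace T" "B \<subseteq> topspace T" "A \<inter> B = {}" for A B
    using that by (auto simp: subadditive_def)
  have "outer (E \<inter> U) + outer (E - U) = outer E" if E: "E \<subseteq> topspace T" for E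
  proof (rule antisym[OF outer_split_open[OF U E]])
    have "(E \<inter> U) \<union> (E - U) = E" by blast
    then show "outer E \<le> outer (E \<inter> U) + outer (E - U)"
      using le[of "E \<inter> U" "E - U"] E by (simp add: Int_Diff_disjoint) (metis Diff_subset subset_trans le_infI1)
  qed
  then show ?thesis
    using openin_subset[OF U]
    by (simp add: algebra.lambda_system_eq[OF algebra_Pow])
qed

definition borel_extension :: "'a measure" where
  "borel_extension = measure_of (topspace T) {U. openin T U} outer"

lemma sets_borel_extension: "sets borel_extension = sets (borel_sets_of T)"
  and space_borel_extension: "space borel_extension = topspace T"
  unfolding borel_extension_def borel_sets_of_def
  by (simp_all add: sets_measure_of_conv space_measure_of_conv)

lemma emeasure_borel_extension:
  assumes "B \<in> sets (borel_sets_of T)"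
  shows "emeasure borel_extension B = outer B"
proof -
  let ?L = "lambda_system (topspace T) (Pow (topspace T)) outer"
  have L: "measure_space (topspace T) ?L outer"
    using sigma_algebra.caratheodory_lemma[OF sigma_algebra_Pow outer_measure_space_outer] .
  then have "sigma_sets (topspace T) {U. openin T U} \<subseteq> ?L"
    using lambda_system_open by (intro sigma_algebra.sigma_sets_subset) (auto simp: measure_space_def)
  then have "measure_space (topspace T) (sigma_sets (topspace T) {U. openin T U}) outer"
    by (intro measure_down[OF L] sigma_algebra_sigma_sets) (auto dest: openin_subset)
  then show ?thesis
    using assms unfolding sets_borel_sets_of measure_space_def
    by (intro emeasure_measure_of[OF borel_extension_def])
      (auto simp: sets_borel_extension sets_borel_sets_of dest: openin_subset)
qed

lemma borel_extension_regular:
  "regular_borel_probability T borel_extension"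
  "C \<in> \<C> \<Longrightarrow> measure borel_extension C = \<mu> C"
proof -
  show "measure borel_extension C = \<mu> C" if "C \<in> \<C>"
    using that openin_borel[OF open_\<C>[OF that]] open_\<C>[OF that] nonneg[OF that]
    by (simp add: measure_def emeasure_borel_extension outer_open inner_\<C>)
  show "regular_borel_probability T borel_extension"
  proof (rule regular_borel_probabilityI[OF compact Hausdorff _ sets_borel_extension])
    show P: "prob_space borel_extension"
      by (rule prob_spaceI)
        (simp add: space_borel_extension emeasure_borel_extension openin_borel outer_topspace)
    interpret prob_space borel_extension by (rule P)
    fix B and e :: real assume B: "B \<in> sets borel_extension" and e: "0 < e"
    have oB: "outer B = ennreal (prob B)"
      using B by (simp add: emeasure_borel_extension[symmetric] sets_borel_extension emeasure_eq_measure)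
    have "outer B < outer B + ennreal e" using e oB by (simp add: ennreal_less_iff flip: ennreal_plus)
    then obtain U where U: "openin T U" "B \<subseteq> U" "inner U < outer B + ennreal e"
      unfolding outer_def INF_less_iff by blast
    have "ennreal (prob U) = inner U"
      using U by (simp add: emeasure_eq_measure[symmetric] emeasure_borel_extension openin_borel outer_open)
    then have "ennreal (prob U) < ennreal (prob B + e)" using U(3) oB e by (simp flip: ennreal_plus)
    then have "prob U \<le> prob B + e" by (simp add: ennreal_less_iff)
    then show "\<exists>U. openin T U \<and> B \<subseteq> U \<and> prob U \<le> prob B + e" using U by blast
  qed
qed

text \<open>Between a compact set and an open set around it there is a clopen set, so inner
  regularity determines the measure of open sets from \<mu>. Outer regularity then determines the
  rest, whence uniqueness.\<close>

lemma regular_extension_open: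
  assumes m: "regular_borel_probability T m" "\<And>C. C \<in> \<C> \<Longrightarrow> measure m C = \<mu> C" and U: "openin T U"
  shows "emeasure m U = inner U"
proof -
  interpret prob_space m using m by (simp add: regular_borel_probability_def)
  have sm: "sets m = sets (borel_sets_of T)" using m by (simp add: regular_borel_probability_def)
  have mC: "emeasure m C = ennreal (\<mu> C)" if "C \<in> \<C>" for C
    using m(2)[OF that] by (simp add: emeasure_eq_measure)
  have "emeasure m U = (SUP K\<in>{K. compactin T K \<and> K \<subseteq> U}. emeasure m K)"
    using m(1) openin_borel[OF U] sm unfolding regular_borel_probability_def by blast
  also have "\<dots> \<le> inner U"
  proof (rule SUP_least)
    fix K assume "K \<in> {K. compactin T K \<and> K \<subseteq> U}"
    then obtain C where C: "C \<in> \<C>" "K \<subseteq> C" "C \<subseteq> U" using compact_open_between U by auto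
    have "emeasure m K \<le> emeasure m C"
      using C sm openin_borel[OF open_\<C>[OF C(1)]] by (intro emeasure_mono) auto
    also have "\<dots> \<le> inner U" using C mC unfolding inner_def by (auto intro: SUP_upper)
    finally show "emeasure m K \<le> inner U" .
  qed
  finally have "emeasure m U \<le> inner U" .
  moreover have "inner U \<le> emeasure m U"
    unfolding inner_def using mC sm openin_borel[OF U]
    by (intro SUP_least) (auto simp flip: mC intro!: emeasure_mono)
  ultimately show ?thesis by (rule antisym)
qed

lemma regular_extension_unique:
  assumes "regular_borel_probability T m" "\<And>C. C \<in> \<C> \<Longrightarrow> measure m C = \<mu> C"
    and "regular_borel_probability T m'" "\<And>C. C \<in> \<C> \<Longrightarrow> measure m' C = \<mu> C"
  shows "m = m'"
proof (rule measure_eqI)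
  show "sets m = sets m'" using assms by (simp add: regular_borel_probability_def)
  fix B assume B: "B \<in> sets m"
  then have B': "B \<in> sets m'" using assms by (simp add: regular_borel_probability_def)
  have "emeasure m B = (INF U\<in>{U. openin T U \<and> B \<subseteq> U}. emeasure m U)"
    by (rule regular_borel_probability_outer[OF assms(1) B])
  also have "\<dots> = (INF U\<in>{U. openin T U \<and> B \<subseteq> U}. emeasure m' U)"
    using regular_extension_open[OF assms(1,2)] regular_extension_open[OF assms(3,4)]
    by (intro INF_cong) auto
  also have "\<dots> = emeasure m' B"
    by (rule regular_borel_probability_outer[OF assms(3) B', symmetric])
  finally show "emeasure m B = emeasure m' B" .
qed

lemma ex1_regular_extension:
  "\<exists>!m. regular_borel_probability T m \<and> (\<forall>C\<in>\<C>. measure m C = \<mu> C)"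
  using borel_extension_regular regular_extension_unique by blast

end


subsection \<open>Renaming variables\<close>

lemma finite_tm_vars: "finite (tm_vars t)"
  by (induction t) auto

lemma finite_free_vars: "finite (free_vars \<phi>)"
  by (induction \<phi>) (auto simp: finite_tm_vars)

lemma tm_val_cong: "(\<And>i. i \<in> tm_vars t \<Longrightarrow> e i = e' i) \<Longrightarrow> tm_val S e t = tm_val S e' t"
proof (induction t)
  case (Fn f ts)
  then have "map (tm_val S e) ts = map (tm_val S e') ts" by (intro map_cong) auto
  then show ?case by (simp only: tm_val.simps)
qed simp

lemma sat_env_cong:
  "(\<And>i. i \<in> free_vars \<phi> \<Longrightarrow> e i = e' i) \<Longrightarrow> sat_env S e \<phi> \<longleftrightarrow> sat_env S e' \<phi>"
proof (induction \<phi> arbitrary: e e')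
  case (Equal s t)
  then show ?case using tm_val_cong[of s e e' S] tm_val_cong[of t e e' S] by simp
next
  case (Rel r ts)
  then have "map (tm_val S e) ts = map (tm_val S e') ts" by (intro map_cong tm_val_cong) auto
  then show ?case by (simp only: sat_env.simps)
next
  case (Neg \<phi>)
  have "sat_env S e \<phi> = sat_env S e' \<phi>" by (rule Neg.IH) (use Neg.prems in simp)
  then show ?case by simp
next
  case (Conj \<phi> \<psi>)
  have "sat_env S e \<phi> = sat_env S e' \<phi>" by (rule Conj.IH(1)) (use Conj.prems in simp)
  moreover have "sat_env S e \<psi> = sat_env S e' \<psi>" by (rule Conj.IH(2)) (use Conj.prems in simp)
  ultimately show ?case by simp
next
  case (Ex i \<phi>)
  have "sat_env S (e(i := a)) \<phi> = sat_env S (e'(i := a)) \<phi>" for a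
    by (rule Ex.IH) (use Ex.prems in simp)
  then show ?case by simp
qed

primrec tm_ren :: "'f tm \<Rightarrow> (nat \<Rightarrow> nat) \<Rightarrow> 'f tm" where
  "tm_ren (Var i) \<rho> = Var (\<rho> i)"
| "tm_ren (Fn f ts) \<rho> = Fn f (map (\<lambda>t. tm_ren t \<rho>) ts)"

text \<open>The bound variable moves above the images of all free variables, which prevents capture;
  the inserted 0 makes \<open>Max\<close> meaningful when there are none.\<close>

primrec fm_ren :: "('f, 'r) fm \<Rightarrow> (nat \<Rightarrow> nat) \<Rightarrow> ('f, 'r) fm" where
  "fm_ren (Equal s t) \<rho> = Equal (tm_ren s \<rho>) (tm_ren t \<rho>)"
| "fm_ren (Rel r ts) \<rho> = Rel r (map (\<lambda>t. tm_ren t \<rho>) ts)"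
| "fm_ren (Neg \<phi>) \<rho> = Neg (fm_ren \<phi> \<rho>)"
| "fm_ren (Conj \<phi> \<psi>) \<rho> = Conj (fm_ren \<phi> \<rho>) (fm_ren \<psi> \<rho>)"
| "fm_ren (Ex i \<phi>) \<rho> =
    (let j = Suc (Max (insert 0 (\<rho> ` (free_vars \<phi> - {i})))) in Ex j (fm_ren \<phi> (\<rho>(i := j))))"

lemma tm_val_ren: "tm_val S e (tm_ren t \<rho>) = tm_val S (e \<circ> \<rho>) t"
proof (induction t)
  case (Fn f ts)
  then have "map (\<lambda>t. tm_val S e (tm_ren t \<rho>)) ts = map (tm_val S (e \<circ> \<rho>)) ts" by (auto simp: comp_def)
  then show ?case by (simp only: tm_ren.simps tm_val.simps map_map comp_def)
qed simp

lemma tm_wf_ren: "tm_wf L (tm_ren t \<rho>) \<longleftrightarrow> tm_wf L t"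
  by (induction t) (auto simp: list_all_iff)

lemma tm_vars_ren: "tm_vars (tm_ren t \<rho>) = \<rho> ` tm_vars t"
  by (induction t) auto

lemma fm_wf_ren: "fm_wf L (fm_ren \<phi> \<rho>) \<longleftrightarrow> fm_wf L \<phi>"
  by (induction \<phi> arbitrary: \<rho>) (auto simp: tm_wf_ren list_all_iff Let_def)

lemma free_vars_ren: "free_vars (fm_ren \<phi> \<rho>) \<subseteq> \<rho> ` free_vars \<phi>"
proof (induction \<phi> arbitrary: \<rho>)
  case (Conj \<phi> \<psi>)
  then show ?case by (simp add: image_Un) (meson le_supI1 le_supI2)
next
  case (Ex i \<phi>)
  define j where "j = Suc (Max (insert 0 (\<rho> ` (free_vars \<phi> - {i}))))"
  have "free_vars (fm_ren \<phi> (\<rho>(i := j))) \<subseteq> (\<rho>(i := j)) ` free_vars \<phi>" by (rule Ex.IH)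
  then show ?case by (auto simp: Let_def j_def[symmetric])
qed (auto simp: tm_vars_ren)

lemma sat_env_ren: "sat_env S e (fm_ren \<phi> \<rho>) \<longleftrightarrow> sat_env S (e \<circ> \<rho>) \<phi>"
proof (induction \<phi> arbitrary: e \<rho>)
  case (Rel r ts)
  have "map (\<lambda>t. tm_val S e (tm_ren t \<rho>)) ts = map (tm_val S (e \<circ> \<rho>)) ts" by (simp add: tm_val_ren)
  then show ?case by (simp only: fm_ren.simps sat_env.simps map_map comp_def)
next
  case (Ex i \<phi>)
  define j where "j = Suc (Max (insert 0 (\<rho> ` (free_vars \<phi> - {i}))))"
  have "\<rho> v < j" if "v \<in> free_vars \<phi>" "v \<noteq> i" for v
    unfolding j_def using that by (intro le_imp_less_Suc Max_ge) (auto simp: finite_free_vars)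
  then have "sat_env S (e(j := a) \<circ> \<rho>(i := j)) \<phi> \<longleftrightarrow> sat_env S ((e \<circ> \<rho>)(i := a)) \<phi>" for a
    by (intro sat_env_cong) fastforce
  then show ?case by (simp only: fm_ren.simps Let_def j_def[symmetric] sat_env.simps Ex.IH)
qed (simp_all add: tm_val_ren)


subsection \<open>Definable sets\<close>

lemma tuples_append: "a \<in> tuples S n \<Longrightarrow> b \<in> tuples S m \<Longrightarrow> a @ b \<in> tuples S (n + m)"
  by (auto simp: tuples_def)

lemma tuples_split:
  assumes "z \<in> tuples S (n + m)"
  obtains a b where "a \<in> tuples S n" "b \<in> tuples S m" "z = a @ b"
proof (rule that)
  show "take n z \<in> tuples S n" "drop n z \<in> tuples S m"
    using assms by (auto simp: tuples_def dest: in_set_takeD in_set_dropD)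
qed simp

text \<open>Parameters as an environment instead of a list: closure properties then need no
  arithmetic with lengths, and only the values at free variables have to lie in
  \<open>A\<close>.\<close>

lemma definable_iff:
  "X \<in> definable S n A \<longleftrightarrow> (\<exists>\<psi> e. fm_wf S \<psi> \<and> (\<forall>i\<in>free_vars \<psi>. n \<le> i \<longrightarrow> e i \<in> A) \<and>
     X = {a \<in> tuples S n. sat_env S (\<lambda>i. if i < n then a ! i else e i) \<psi>})"
proof
  assume "X \<in> definable S n A"
  then obtain \<psi> c where c: "set c \<subseteq> A" "\<psi> \<in> formulas S (n + length c)" "X = fibre_x S n \<psi> c"
    by (auto simp: definable_def)
  have "sat S (a @ c) \<psi> \<longleftrightarrow> sat_env S (\<lambda>i. if i < n then a ! i else c ! (i - n)) \<psi>"
    if "a \<in> tuples S n" for a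
    using that unfolding sat_def by (intro sat_env_cong) (auto simp: tuples_def nth_append)
  moreover have "c ! (i - n) \<in> A" if "i \<in> free_vars \<psi>" "n \<le> i" for i
  proof -
    have "i < n + length c" using that c(2) by (auto simp: formulas_def)
    then have "i - n < length c" using that by simp
    then show ?thesis using nth_mem c(1) by blast
  qed
  ultimately show "\<exists>\<psi> e. fm_wf S \<psi> \<and> (\<forall>i\<in>free_vars \<psi>. n \<le> i \<longrightarrow> e i \<in> A) \<and>
     X = {a \<in> tuples S n. sat_env S (\<lambda>i. if i < n then a ! i else e i) \<psi>}"
    using c by (intro exI[of _ \<psi>] exI[of _ "\<lambda>i. c ! (i - n)"]) (auto simp: formulas_def fibre_x_def)
next
  assume "\<exists>\<psi> e. fm_wf S \<psi> \<and> (\<forall>i\<in>free_vars \<psi>. n \<le> i \<longrightarrow> e i \<in> A) \<and>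
     X = {a \<in> tuples S n. sat_env S (\<lambda>i. if i < n then a ! i else e i) \<psi>}"
  then obtain \<psi> e where \<psi>: "fm_wf S \<psi>" "\<And>i. i \<in> free_vars \<psi> \<Longrightarrow> n \<le> i \<Longrightarrow> e i \<in> A"
    "X = {a \<in> tuples S n. sat_env S (\<lambda>i. if i < n then a ! i else e i) \<psi>}" by blast
  \<comment> \<open>In a list, positions used by no free variable also need entries from
    \<open>A\<close>; if there are none to choose from, the list must be empty.\<close>
  have "\<exists>c. set c \<subseteq> A \<and> free_vars \<psi> \<subseteq> {..<n + length c} \<and>
      (\<forall>i\<in>free_vars \<psi>. n \<le> i \<longrightarrow> c ! (i - n) = e i)"
  proof (cases "A = {}")
    case True
    then have "free_vars \<psi> \<subseteq> {..<n}" using \<psi>(2) by (meson empty_iff lessThan_iff not_le subsetI)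
    then show ?thesis by (intro exI[of _ "[]"]) auto
  next
    case False
    then obtain d where d: "d \<in> A" by blast
    obtain K where K: "free_vars \<psi> \<subseteq> {..<K}" using finite_free_vars finite_nat_iff_bounded by blast
    show ?thesis
      using K d \<psi>(2)
      by (intro exI[of _ "map (\<lambda>i. if e i \<in> A then e i else d) [n..<n + K]"]) (auto; fastforce)
  qed
  then obtain c where c: "set c \<subseteq> A" "free_vars \<psi> \<subseteq> {..<n + length c}"
    "\<And>i. i \<in> free_vars \<psi> \<Longrightarrow> n \<le> i \<Longrightarrow> c ! (i - n) = e i" by blast
  have "sat S (a @ c) \<psi> \<longleftrightarrow> sat_env S (\<lambda>i. if i < n then a ! i else e i) \<psi>"
    if "a \<in> tuples S n" for a
    using that c(3) unfolding sat_def by (intro sat_env_cong) (auto simp: tuples_def nth_append)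
  then have "X = fibre_x S n \<psi> c" using \<psi>(3) by (auto simp: fibre_x_def)
  then show "X \<in> definable S n A" using c \<psi>(1) by (auto simp: definable_def formulas_def)
qed

text \<open>\<open>\<sigma>\<close> substitutes coordinates of the tuple (\<open>Inl\<close>) or parameters (\<open>Inr\<close>) for the variables.\<close>

lemma definable_subst:
  assumes "fm_wf S \<psi>"
    and \<sigma>: "\<And>i. i \<in> free_vars \<psi> \<Longrightarrow> (case \<sigma> i of Inl j \<Rightarrow> j < n | Inr d \<Rightarrow> d \<in> A)"
    and X: "X = {a \<in> tuples S n. sat_env S (\<lambda>i. case \<sigma> i of Inl j \<Rightarrow> a ! j | Inr d \<Rightarrow> d) \<psi>}"
  shows "X \<in> definable S n A"
proof -
  define \<rho> where "\<rho> i = (case \<sigma> i of Inl j \<Rightarrow> j | Inr d \<Rightarrow> n + i)" for i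
  define e where "e i = projr (\<sigma> (i - n))" for i
  have "e i \<in> A" if i: "i \<in> free_vars (fm_ren \<psi> \<rho>)" "n \<le> i" for i
  proof -
    obtain v where v: "v \<in> free_vars \<psi>" "i = \<rho> v" using i free_vars_ren by blast
    show ?thesis
      using \<sigma>[OF v(1)] v i(2) by (cases "\<sigma> v") (auto simp: \<rho>_def e_def)
  qed
  moreover have "sat_env S (\<lambda>i. if i < n then a ! i else e i) (fm_ren \<psi> \<rho>) \<longleftrightarrow>
      sat_env S (\<lambda>i. case \<sigma> i of Inl j \<Rightarrow> a ! j | Inr d \<Rightarrow> d) \<psi>" for a
    unfolding sat_env_ren
  proof (intro sat_env_cong)
    fix i assume "i \<in> free_vars \<psi>"
    then show "((\<lambda>i. if i < n then a ! i else e i) \<circ> \<rho>) i = (case \<sigma> i of Inl j \<Rightarrow> a ! j | Inr d \<Rightarrow> d)"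
      using \<sigma>[of i] by (cases "\<sigma> i") (auto simp: \<rho>_def e_def)
  qed
  ultimately show ?thesis
    unfolding definable_iff X using assms(1)
    by (intro exI[of _ "fm_ren \<psi> \<rho>"] exI[of _ e]) (auto simp: fm_wf_ren)
qed

lemma definable_mono: "A \<subseteq> B \<Longrightarrow> definable S n A \<subseteq> definable S n B"
  unfolding definable_def by fast

lemma definable_subset: "X \<in> definable S n A \<Longrightarrow> X \<subseteq> tuples S n"
  by (auto simp: definable_def fibre_x_def)

lemma definable_Compl: "X \<in> definable S n A \<Longrightarrow> tuples S n - X \<in> definable S n A"
  unfolding definable_iff
proof (elim exE conjE)
  fix \<psi> e assume "fm_wf S \<psi>" "\<forall>i\<in>free_vars \<psi>. n \<le> i \<longrightarrow> e i \<in> A"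
    "X = {a \<in> tuples S n. sat_env S (\<lambda>i. if i < n then a ! i else e i) \<psi>}"
  then show "\<exists>\<psi> e. fm_wf S \<psi> \<and> (\<forall>i\<in>free_vars \<psi>. n \<le> i \<longrightarrow> e i \<in> A) \<and>
     tuples S n - X = {a \<in> tuples S n. sat_env S (\<lambda>i. if i < n then a ! i else e i) \<psi>}"
    by (intro exI[of _ "Neg \<psi>"] exI[of _ e]) auto
qed

lemma definable_Int:
  assumes "X \<in> definable S n A" "Y \<in> definable S n A"
  shows "X \<inter> Y \<in> definable S n A"
proof -
  obtain \<psi> e where \<psi>: "fm_wf S \<psi>" "\<And>i. i \<in> free_vars \<psi> \<Longrightarrow> n \<le> i \<Longrightarrow> e i \<in> A"
    "X = {a \<in> tuples S n. sat_env S (\<lambda>i. if i < n then a ! i else e i) \<psi>}"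
    using assms(1) unfolding definable_iff by blast
  obtain \<xi> e' where \<xi>: "fm_wf S \<xi>" "\<And>i. i \<in> free_vars \<xi> \<Longrightarrow> n \<le> i \<Longrightarrow> e' i \<in> A"
    "Y = {a \<in> tuples S n. sat_env S (\<lambda>i. if i < n then a ! i else e' i) \<xi>}"
    using assms(2) unfolding definable_iff by blast
  obtain K where K: "free_vars \<psi> \<subseteq> {..<K}" using finite_free_vars finite_nat_iff_bounded by blast
  \<comment> \<open>The parameter variables of \<xi> move beyond all variables of \<psi>, so that
    the single environment \<open>u\<close> carries both sets of parameters.\<close>
  define \<rho> where "\<rho> i = (if i < n then i else i + K)" for i
  define u where "u i = (if i < K then e i else e' (i - K))" for i
  have "u i \<in> A" if "i \<in> free_vars (Conj \<psi> (fm_ren \<xi> \<rho>))" "n \<le> i" for i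
  proof (cases "i \<in> free_vars \<psi>")
    case True
    then show ?thesis using K \<psi>(2) that by (auto simp: u_def)
  next
    case False
    then have "i \<in> \<rho> ` free_vars \<xi>" using that free_vars_ren[of \<xi> \<rho>] by auto
    then show ?thesis using \<xi>(2) that by (auto simp: \<rho>_def u_def split: if_splits)
  qed
  moreover have "sat_env S (\<lambda>i. if i < n then a ! i else u i) \<psi> \<longleftrightarrow>
      sat_env S (\<lambda>i. if i < n then a ! i else e i) \<psi>" for a
    using K by (intro sat_env_cong) (auto simp: u_def)
  moreover have "sat_env S (\<lambda>i. if i < n then a ! i else u i) (fm_ren \<xi> \<rho>) \<longleftrightarrow>
      sat_env S (\<lambda>i. if i < n then a ! i else e' i) \<xi>" for a
    unfolding sat_env_ren by (intro sat_env_cong) (auto simp: u_def \<rho>_def)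
  ultimately show ?thesis
    unfolding definable_iff \<psi>(3) \<xi>(3) using \<psi>(1) \<xi>(1)
    by (intro exI[of _ "Conj \<psi> (fm_ren \<xi> \<rho>)"] exI[of _ u]) (auto simp: fm_wf_ren)
qed

text \<open>The formula is a true sentence without parameters, which also covers
  \<open>n = 0\<close> and empty \<open>A\<close>; its truth is where the nonempty carrier
  enters.\<close>

lemma tuples_definable:
  assumes "carrier S \<noteq> {}"
  shows "tuples S n \<in> definable S n A"
  unfolding definable_iff
  using assms by (intro exI[of _ "Ex 0 (Equal (Var 0) (Var 0))"]) auto

lemma algebra_definable:
  assumes "carrier S \<noteq> {}"
  shows "algebra (tuples S n) (definable S n A)"
proof -
  have "{} \<in> definable S n A"
    using definable_Compl[OF tuples_definable[OF assms]] by simp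
  then show ?thesis
    unfolding algebra_iff_Int
    by (intro conjI ballI subsetI PowI definable_Compl definable_Int) (auto dest: definable_subset)
qed

lemma fibre_x_definable:
  "\<psi> \<in> formulas S (n + length c) \<Longrightarrow> set c \<subseteq> A \<Longrightarrow> fibre_x S n \<psi> c \<in> definable S n A"
  by (auto simp: definable_def)

lemma fibre_y_definable:
  assumes "\<psi> \<in> formulas S (length a + n)" "set a \<subseteq> A"
  shows "fibre_y S n \<psi> a \<in> definable S n A"
proof (rule definable_subst[where \<sigma> = "\<lambda>i. if i < length a then Inr (a ! i) else Inl (i - length a)"])
  show "fm_wf S \<psi>" using assms by (simp add: formulas_def)
  have "sat S (a @ b) \<psi> \<longleftrightarrow> sat_env S (\<lambda>i. case if i < length a then Inr (a ! i) else Inl (i - length a) of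
      Inl j \<Rightarrow> b ! j | Inr d \<Rightarrow> d) \<psi>" for b
    unfolding sat_def by (intro sat_env_cong) (auto simp: nth_append)
  then show "fibre_y S n \<psi> a = {b \<in> tuples S n. sat_env S (\<lambda>i. case if i < length a then Inr (a ! i)
      else Inl (i - length a) of Inl j \<Rightarrow> b ! j | Inr d \<Rightarrow> d) \<psi>}"
    by (simp add: fibre_y_def)
qed (use assms in \<open>auto simp: formulas_def\<close>)

lemma definable_take:
  assumes "X \<in> definable S n A"
  shows "{z \<in> tuples S (n + m). take n z \<in> X} \<in> definable S (n + m) A"
proof -
  obtain \<psi> e where \<psi>: "fm_wf S \<psi>" "\<And>i. i \<in> free_vars \<psi> \<Longrightarrow> n \<le> i \<Longrightarrow> e i \<in> A"
    "X = {a \<in> tuples S n. sat_env S (\<lambda>i. if i < n then a ! i else e i) \<psi>}"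
    using assms unfolding definable_iff by blast
  define \<sigma> where "\<sigma> i = (if i < n then Inl i else Inr (e i))" for i
  have "sat_env S (\<lambda>i. if i < n then take n z ! i else e i) \<psi> \<longleftrightarrow>
    sat_env S (\<lambda>i. case \<sigma> i of Inl j \<Rightarrow> z ! j | Inr d \<Rightarrow> d) \<psi>" for z
    by (intro sat_env_cong) (auto simp: \<sigma>_def)
  moreover have "take n z \<in> tuples S n" if "z \<in> tuples S (n + m)" for z
    using that by (auto simp: tuples_def dest: in_set_takeD)
  ultimately show ?thesis
    using \<psi> by (intro definable_subst[where \<psi> = \<psi> and \<sigma> = \<sigma>]) (auto simp: \<sigma>_def)
qed

lemma definable_drop:
  assumes "Y \<in> definable S m A"
  shows "{z \<in> tuples S (n + m). drop n z \<in> Y} \<in> definable S (n + m) A"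
proof -
  obtain \<psi> e where \<psi>: "fm_wf S \<psi>" "\<And>i. i \<in> free_vars \<psi> \<Longrightarrow> m \<le> i \<Longrightarrow> e i \<in> A"
    "Y = {a \<in> tuples S m. sat_env S (\<lambda>i. if i < m then a ! i else e i) \<psi>}"
    using assms unfolding definable_iff by blast
  define \<sigma> where "\<sigma> i = (if i < m then Inl (n + i) else Inr (e i))" for i
  have "sat_env S (\<lambda>i. if i < m then drop n z ! i else e i) \<psi> \<longleftrightarrow>
    sat_env S (\<lambda>i. case \<sigma> i of Inl j \<Rightarrow> z ! j | Inr d \<Rightarrow> d) \<psi>" if "z \<in> tuples S (n + m)" for z
    using that by (intro sat_env_cong) (auto simp: \<sigma>_def tuples_def)
  moreover have "drop n z \<in> tuples S m" if "z \<in> tuples S (n + m)" for z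
    using that by (auto simp: tuples_def dest: in_set_dropD)
  ultimately show ?thesis
    using \<psi> by (intro definable_subst[where \<psi> = \<psi> and \<sigma> = \<sigma>]) (auto simp: \<sigma>_def)
qed

lemma rectangle_definable:
  assumes "X \<in> definable S n A" "Y \<in> definable S m A"
  shows "rectangle X Y \<in> definable S (n + m) A"
proof -
  have "rectangle X Y = {z \<in> tuples S (n + m). take n z \<in> X} \<inter> {z \<in> tuples S (n + m). drop n z \<in> Y}"
  proof (intro set_eqI iffI)
    fix z assume "z \<in> rectangle X Y"
    then obtain a b where ab: "z = a @ b" "a \<in> X" "b \<in> Y" by (auto simp: rectangle_def)
    then have t: "a \<in> tuples S n" "b \<in> tuples S m"
      using definable_subset[OF assms(1)] definable_subset[OF assms(2)] by auto
    then have "length a = n" by (simp add: tuples_def)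
    then show "z \<in> {z \<in> tuples S (n + m). take n z \<in> X} \<inter> {z \<in> tuples S (n + m). drop n z \<in> Y}"
      using ab tuples_append[OF t] by simp
  next
    fix z assume "z \<in> {z \<in> tuples S (n + m). take n z \<in> X} \<inter> {z \<in> tuples S (n + m). drop n z \<in> Y}"
    then show "z \<in> rectangle X Y"
      unfolding rectangle_def by (metis (mono_tags, lifting) IntE append_take_drop_id mem_Collect_eq)
  qed
  then show ?thesis using definable_take[OF assms(1)] definable_drop[OF assms(2)] by (auto intro: definable_Int)
qed

lemma relation_set_definable:
  assumes "\<phi> \<in> formulas S (p + q)"
  shows "relation_set S p q \<phi> \<in> definable S (p + q) A"
proof -
  have "relation_set S p q \<phi> = fibre_x S (p + q) \<phi> []"
  proof (intro set_eqI iffI)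
    fix z assume z: "z \<in> fibre_x S (p + q) \<phi> []"
    then have "z \<in> tuples S (p + q)" by (simp add: fibre_x_def)
    then obtain a b where "a \<in> tuples S p" "b \<in> tuples S q" "z = a @ b" by (rule tuples_split)
    then show "z \<in> relation_set S p q \<phi>"
      using z unfolding relation_set_def fibre_x_def by auto
  qed (auto simp: relation_set_def fibre_x_def tuples_append)
  then show ?thesis using fibre_x_definable[of \<phi> S "p + q" "[]" A] assms by simp
qed

text \<open>Parameters taken from \<open>a\<close> are traded for coordinates. This is what turns a
  type in n + m variables, once its first part is realized by \<open>a\<close>, into a type over
  \<open>A \<union> set a\<close>.\<close>

lemma definable_section:
  assumes a: "a \<in> tuples S n"
  shows "Y \<in> definable S m (A \<union> set a) \<longleftrightarrow> (\<exists>Z\<in>definable S (n + m) A. Y = {y \<in> tuples S m. a @ y \<in> Z})"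
proof
  assume "\<exists>Z\<in>definable S (n + m) A. Y = {y \<in> tuples S m. a @ y \<in> Z}"
  then obtain Z where Z: "Z \<in> definable S (n + m) A" "Y = {y \<in> tuples S m. a @ y \<in> Z}" by blast
  then obtain \<psi> e where \<psi>: "fm_wf S \<psi>" "\<And>i. i \<in> free_vars \<psi> \<Longrightarrow> n + m \<le> i \<Longrightarrow> e i \<in> A"
    "Z = {a \<in> tuples S (n + m). sat_env S (\<lambda>i. if i < n + m then a ! i else e i) \<psi>}"
    unfolding definable_iff by blast
  define \<sigma> where "\<sigma> i = (if i < n then Inr (a ! i) else if i < n + m then Inl (i - n) else Inr (e i))" for i
  have "sat_env S (\<lambda>i. if i < n + m then (a @ y) ! i else e i) \<psi> \<longleftrightarrow>
    sat_env S (\<lambda>i. case \<sigma> i of Inl j \<Rightarrow> y ! j | Inr d \<Rightarrow> d) \<psi>" for y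
    using a by (intro sat_env_cong) (auto simp: \<sigma>_def tuples_def nth_append)
  moreover have "a ! i \<in> set a" if "i < n" for i using a that by (auto simp: tuples_def)
  ultimately show "Y \<in> definable S m (A \<union> set a)"
    using \<psi> Z(2) a by (intro definable_subst[where \<psi> = \<psi> and \<sigma> = \<sigma>]) (auto simp: \<sigma>_def tuples_append)
next
  assume "Y \<in> definable S m (A \<union> set a)"
  then obtain \<psi> e where \<psi>: "fm_wf S \<psi>" "\<And>i. i \<in> free_vars \<psi> \<Longrightarrow> m \<le> i \<Longrightarrow> e i \<in> A \<union> set a"
    "Y = {a \<in> tuples S m. sat_env S (\<lambda>i. if i < m then a ! i else e i) \<psi>}"
    unfolding definable_iff by blast
  \<comment> \<open>Entries of \<open>a\<close> may repeat; any position holding the parameter will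
    do.\<close>
  define idx where "idx d = (SOME j. j < n \<and> a ! j = d)" for d
  have idx: "idx d < n \<and> a ! idx d = d" if "d \<in> set a" for d
    unfolding idx_def by (rule someI_ex) (use a that in \<open>auto simp: tuples_def in_set_conv_nth\<close>)
  define \<sigma> where "\<sigma> i = (if i < m then Inl (n + i) else if e i \<in> A then Inr (e i) else Inl (idx (e i)))" for i
  define Z where "Z = {z \<in> tuples S (n + m). sat_env S (\<lambda>i. case \<sigma> i of Inl j \<Rightarrow> z ! j | Inr d \<Rightarrow> d) \<psi>}"
  have e: "e i \<in> A \<or> e i \<in> set a" if "i \<in> free_vars \<psi>" "\<not> i < m" for i using \<psi>(2)[of i] that by auto
  have "Z \<in> definable S (n + m) A"
  proof (rule definable_subst[OF \<psi>(1) _ Z_def])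
    fix i assume i: "i \<in> free_vars \<psi>"
    show "case \<sigma> i of Inl j \<Rightarrow> j < n + m | Inr d \<Rightarrow> d \<in> A"
      using e[OF i] idx[of "e i"] by (auto simp: \<sigma>_def)
  qed
  moreover have "sat_env S (\<lambda>i. case \<sigma> i of Inl j \<Rightarrow> (a @ y) ! j | Inr d \<Rightarrow> d) \<psi> \<longleftrightarrow>
      sat_env S (\<lambda>i. if i < m then y ! i else e i) \<psi>" for y
  proof (intro sat_env_cong)
    fix i assume i: "i \<in> free_vars \<psi>"
    show "(case \<sigma> i of Inl j \<Rightarrow> (a @ y) ! j | Inr d \<Rightarrow> d) = (if i < m then y ! i else e i)"
      using e[OF i] idx[of "e i"] a by (auto simp: \<sigma>_def tuples_def nth_append)
  qed
  ultimately show "\<exists>Z\<in>definable S (n + m) A. Y = {y \<in> tuples S m. a @ y \<in> Z}"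
    using a \<psi>(3) by (intro bexI[of _ Z]) (auto simp: Z_def tuples_append)
qed

lemma definable_proj:
  assumes "Z \<in> definable S (n + 1) A"
  shows "{a \<in> tuples S n. \<exists>y\<in>tuples S 1. a @ y \<in> Z} \<in> definable S n A"
proof -
  obtain \<psi> e where \<psi>: "fm_wf S \<psi>" "\<And>i. i \<in> free_vars \<psi> \<Longrightarrow> n + 1 \<le> i \<Longrightarrow> e i \<in> A"
    "Z = {a \<in> tuples S (n + 1). sat_env S (\<lambda>i. if i < n + 1 then a ! i else e i) \<psi>}"
    using assms unfolding definable_iff by blast
  have "(\<exists>y\<in>tuples S 1. a @ y \<in> Z) \<longleftrightarrow> sat_env S (\<lambda>i. if i < n then a ! i else e i) (Ex n \<psi>)"
    if a: "a \<in> tuples S n" for a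
  proof -
    have "(\<exists>y\<in>tuples S 1. a @ y \<in> Z) \<longleftrightarrow> (\<exists>d\<in>carrier S. a @ [d] \<in> Z)"
    proof
      assume "\<exists>y\<in>tuples S 1. a @ y \<in> Z"
      then obtain y where "y \<in> tuples S 1" "a @ y \<in> Z" by blast
      then show "\<exists>d\<in>carrier S. a @ [d] \<in> Z"
        by (cases y) (auto simp: tuples_def)
    next
      assume "\<exists>d\<in>carrier S. a @ [d] \<in> Z"
      then obtain d where "d \<in> carrier S" "a @ [d] \<in> Z" by blast
      then show "\<exists>y\<in>tuples S 1. a @ y \<in> Z" by (intro bexI[of _ "[d]"]) (auto simp: tuples_def)
    qed
    moreover have "a @ [d] \<in> Z \<longleftrightarrow> sat_env S ((\<lambda>i. if i < n then a ! i else e i)(n := d)) \<psi>"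
      if "d \<in> carrier S" for d
    proof -
      have "a @ [d] \<in> tuples S (n + 1)" using a that by (auto simp: tuples_def)
      moreover have "sat_env S (\<lambda>i. if i < n + 1 then (a @ [d]) ! i else e i) \<psi> \<longleftrightarrow>
          sat_env S ((\<lambda>i. if i < n then a ! i else e i)(n := d)) \<psi>"
        using a by (intro sat_env_cong) (auto simp: tuples_def nth_append)
      ultimately show ?thesis using \<psi>(3) by simp
    qed
    ultimately show ?thesis by simp
  qed
  moreover have "\<forall>i\<in>free_vars (Ex n \<psi>). n \<le> i \<longrightarrow> e i \<in> A" using \<psi>(2) by auto
  ultimately show ?thesis
    unfolding definable_iff using \<psi>(1)
    by (intro exI[of _ "Ex n \<psi>"] exI[of _ e]) (auto simp del: sat_env.simps)
qed


subsection \<open>Types\<close>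

lemma tp_complete:
  assumes "carrier S \<noteq> {}" "a \<in> tuples S n"
  shows "tp S n A a \<in> complete_types S n A"
  unfolding complete_types_def
proof (intro CollectI conjI allI impI ballI)
  show "tp S n A a \<subseteq> definable S n A" by (auto simp: tp_def)
  fix F assume "F \<subseteq> tp S n A a"
  then have "a \<in> tuples S n \<inter> \<Inter>F" using assms by (auto simp: tp_def)
  then show "tuples S n \<inter> \<Inter>F \<noteq> {}" by blast
next
  fix X assume "X \<in> definable S n A"
  then show "X \<in> tp S n A a \<or> tuples S n - X \<in> tp S n A a"
    using assms definable_Compl by (auto simp: tp_def)
qed

lemma complete_type_definable: "t \<in> complete_types S n A \<Longrightarrow> X \<in> t \<Longrightarrow> X \<in> definable S n A"
  by (auto simp: complete_types_def)

lemma complete_type_fip: "t \<in> complete_types S n A \<Longrightarrow> F \<subseteq> t \<Longrightarrow> finite F \<Longrightarrow> tuples S n \<inter> \<Inter>F \<noteq> {}"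
  by (simp add: complete_types_def)

lemma complete_type_cases:
  "t \<in> complete_types S n A \<Longrightarrow> X \<in> definable S n A \<Longrightarrow> X \<in> t \<or> tuples S n - X \<in> t"
  by (simp add: complete_types_def)

lemma complete_type_finite:
  assumes t: "t \<in> complete_types S n A" and F: "F \<subseteq> t" "finite F" "tuples S n \<inter> \<Inter>F \<subseteq> X"
    and X: "X \<in> definable S n A"
  shows "X \<in> t"
proof (rule ccontr)
  assume "X \<notin> t"
  then have "tuples S n - X \<in> t" using complete_type_cases[OF t X] by blast
  then have "tuples S n \<inter> \<Inter>(insert (tuples S n - X) F) \<noteq> {}"
    using F by (intro complete_type_fip[OF t]) auto
  then show False using F(3) by blast
qed

lemma complete_type_Int:
  assumes "t \<in> complete_types S n A" "X \<in> t" "Y \<in> t"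
  shows "X \<inter> Y \<in> t"
  using assms complete_type_definable[OF assms(1)]
  by (intro complete_type_finite[of t S n A "{X, Y}"]) (auto intro: definable_Int)

lemma complete_type_mono:
  assumes "t \<in> complete_types S n A" "X \<in> t" "X \<subseteq> Y" "Y \<in> definable S n A"
  shows "Y \<in> t"
  using assms by (intro complete_type_finite[of t S n A "{X}"]) auto

lemma complete_type_Inter:
  assumes t: "t \<in> complete_types S n A" and F: "finite F" "F \<subseteq> t" and ne: "carrier S \<noteq> {}"
  shows "tuples S n \<inter> \<Inter>F \<in> t"
  using F
proof (induction F)
  case empty
  show ?case using complete_type_finite[OF t, of "{}" "tuples S n"] tuples_definable[OF ne] by simp
next
  case (insert X F)
  then have "X \<inter> (tuples S n \<inter> \<Inter>F) \<in> t"
    using complete_type_Int[OF t, of X "tuples S n \<inter> \<Inter>F"] by simp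
  moreover have "X \<inter> (tuples S n \<inter> \<Inter>F) = tuples S n \<inter> \<Inter>(insert X F)" by auto
  ultimately show ?case by simp
qed

lemma complete_type_Compl:
  assumes "t \<in> complete_types S n A" "X \<in> definable S n A"
  shows "tuples S n - X \<in> t \<longleftrightarrow> X \<notin> t"
  using complete_type_cases[OF assms] complete_type_fip[OF assms(1), of "{X, tuples S n - X}"] by auto

lemma complete_type_eqI:
  assumes t: "t \<in> complete_types S n A" and u: "u \<in> complete_types S n A" and sub: "t \<subseteq> u"
  shows "t = u"
proof
  show "u \<subseteq> t"
  proof
    fix X assume X: "X \<in> u"
    then have d: "X \<in> definable S n A" using complete_type_definable[OF u] by blast
    show "X \<in> t"
      using complete_type_Compl[OF t d] complete_type_Compl[OF u d] X sub by blast
  qed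
qed (rule sub)

lemma realizes_tp:
  assumes "carrier S \<noteq> {}" "t \<in> complete_types S n A" "realizes S n a t"
  shows "tp S n A a = t"
proof -
  have "t \<subseteq> tp S n A a"
    using assms(3) complete_type_definable[OF assms(2)] by (auto simp: tp_def realizes_def)
  then show ?thesis
    using complete_type_eqI[OF assms(2) tp_complete[OF assms(1)]] assms(3) by (auto simp: realizes_def)
qed

text \<open>A family maximal for the finite intersection property decides every definable set:
  finite subfamilies refuting a set and its complement would together be inconsistent.\<close>

lemma extend_to_complete_type:
  assumes P: "P \<subseteq> definable S n A" and fip: "\<And>F. F \<subseteq> P \<Longrightarrow> finite F \<Longrightarrow> tuples S n \<inter> \<Inter>F \<noteq> {}"
  obtains t where "t \<in> complete_types S n A" "P \<subseteq> t"
proof -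
  define \<A> where "\<A> = {t. t \<subseteq> definable S n A \<and> P \<subseteq> t \<and> (\<forall>F\<subseteq>t. finite F \<longrightarrow> tuples S n \<inter> \<Inter>F \<noteq> {})}"
  have "\<exists>t\<in>\<A>. \<forall>X\<in>\<A>. t \<subseteq> X \<longrightarrow> X = t"
  proof (rule subset_Zorn_nonempty)
    show "\<A> \<noteq> {}" using assms by (auto simp: \<A>_def)
    fix \<C> assume \<C>: "\<C> \<noteq> {}" "subset.chain \<A> \<C>"
    have "tuples S n \<inter> \<Inter>F \<noteq> {}" if F: "F \<subseteq> \<Union>\<C>" "finite F" for F
    proof -
      obtain t where t: "t \<in> \<C>" "F \<subseteq> t" using finite_subset_Union_chain[OF F(2,1) \<C>] by blast
      then have "t \<in> \<A>" using \<C>(2) by (auto simp: subset.chain_def)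
      then show ?thesis using t F by (auto simp: \<A>_def)
    qed
    moreover have "\<C> \<subseteq> \<A>" using \<C>(2) by (simp add: subset.chain_def)
    then have "t \<subseteq> definable S n A" "P \<subseteq> t" if "t \<in> \<C>" for t using that by (auto simp: \<A>_def)
    then have "\<Union>\<C> \<subseteq> definable S n A" "P \<subseteq> \<Union>\<C>" using \<C>(1) by blast+
    ultimately show "\<Union>\<C> \<in> \<A>" unfolding \<A>_def by blast
  qed
  then obtain t where t: "t \<in> \<A>" and mx: "\<And>X. X \<in> \<A> \<Longrightarrow> t \<subseteq> X \<Longrightarrow> X = t" by blast
  have tfip: "tuples S n \<inter> \<Inter>F \<noteq> {}" if "F \<subseteq> t" "finite F" for F using t that by (auto simp: \<A>_def)
  have "X \<in> t \<or> tuples S n - X \<in> t" if X: "X \<in> definable S n A" for X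
  proof (rule ccontr)
    assume neg: "\<not> ?thesis"
    have *: "\<exists>F\<subseteq>t. finite F \<and> tuples S n \<inter> \<Inter>F \<inter> Y = {}" if Y: "Y \<in> definable S n A" "Y \<notin> t" for Y
    proof -
      have "insert Y t \<notin> \<A>" using mx[of "insert Y t"] Y by blast
      then obtain F where F: "F \<subseteq> insert Y t" "finite F" "tuples S n \<inter> \<Inter>F = {}"
        using t Y by (auto simp: \<A>_def)
      then show ?thesis by (intro exI[of _ "F - {Y}"]) auto
    qed
    obtain F where F: "F \<subseteq> t" "finite F" "tuples S n \<inter> \<Inter>F \<inter> X = {}" using *[OF X] neg by blast
    obtain G where G: "G \<subseteq> t" "finite G" "tuples S n \<inter> \<Inter>G \<inter> (tuples S n - X) = {}"
      using *[OF definable_Compl[OF X]] neg by blast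
    have "tuples S n \<inter> \<Inter>(F \<union> G) \<noteq> {}" using F G by (intro tfip) auto
    then show False using F(3) G(3) by blast
  qed
  then have "t \<in> complete_types S n A" using t by (auto simp: complete_types_def \<A>_def)
  then show ?thesis using t by (intro that[of t]) (auto simp: \<A>_def)
qed

lemma restrict_complete_type:
  assumes "t \<in> complete_types S n B" "A \<subseteq> B"
  shows "t \<inter> definable S n A \<in> complete_types S n A"
proof -
  have X: "tuples S n - X \<in> definable S n A" "X \<in> definable S n B" if "X \<in> definable S n A" for X
    using that definable_mono[OF assms(2)] definable_Compl by blast+
  show ?thesis
    unfolding complete_types_def
  proof (intro CollectI conjI allI impI ballI)
    fix F assume "F \<subseteq> t \<inter> definable S n A" "finite F"
    then show "tuples S n \<inter> \<Inter>F \<noteq> {}" by (intro complete_type_fip[OF assms(1)]) auto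
  next
    fix X' assume "X' \<in> definable S n A"
    then show "X' \<in> t \<inter> definable S n A \<or> tuples S n - X' \<in> t \<inter> definable S n A"
      using complete_type_cases[OF assms(1) X(2)] X(1) by auto
  qed simp
qed

lemma tp_restrict: "A \<subseteq> B \<Longrightarrow> tp S n B a \<inter> definable S n A = tp S n A a"
  using definable_mono[of A B S n] by (auto simp: tp_def)


subsection \<open>Monster models\<close>

locale monster =
  fixes \<kappa> :: "'k rel" and T :: "('f, 'r) fm set" and S :: "('f, 'r, 'm) struct"
  assumes monster: "monster_model \<kappa> T S"
begin

definition small :: "'m set \<Rightarrow> bool" where
  "small A \<longleftrightarrow> A \<subseteq> carrier S \<and> |A| <o \<kappa>"

lemma card_order: "Card_order \<kappa>"
  using monster by (simp add: monster_model_def)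

lemma carrier_nonempty: "carrier S \<noteq> {}"
  using monster by (auto simp: monster_model_def)

text \<open>Equations between variables belong to every language. Hence \<kappa> is uncountable,
  finite sets are small, and small sets are closed under binary unions.\<close>

lemma infinite_formulas: "infinite {\<phi> :: ('f, 'r) fm. fm_wf S \<phi>}"
proof -
  have "inj (\<lambda>i. Equal (Var i) (Var i) :: ('f, 'r) fm)" by (auto simp: inj_def)
  then have "infinite (range (\<lambda>i. Equal (Var i) (Var i) :: ('f, 'r) fm))" by (simp add: finite_image_iff)
  then show ?thesis by (rule infinite_super[rotated]) auto
qed

lemma card_formulas: "|{\<phi> :: ('f, 'r) fm. fm_wf S \<phi>}| <o \<kappa>"
  using monster by (simp add: monster_model_def)

lemma infinite_Field: "infinite (Field \<kappa>)"
proof -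
  have "|{\<phi> :: ('f, 'r) fm. fm_wf S \<phi>}| \<le>o |Field \<kappa>|"
    using ordLess_imp_ordLeq[OF card_formulas] card_of_Field_ordIso[OF card_order]
      ordLeq_ordIso_trans ordIso_symmetric by blast
  then show ?thesis using infinite_formulas card_of_ordLeq_infinite by blast
qed

lemma small_Un: "small A \<Longrightarrow> small B \<Longrightarrow> small (A \<union> B)"
  using card_of_Un_ordLess_infinite_Field[OF infinite_Field card_order] by (auto simp: small_def)

lemma small_finite:
  assumes "finite A" "A \<subseteq> carrier S"
  shows "small A"
proof -
  have "|A| <o |{\<phi> :: ('f, 'r) fm. fm_wf S \<phi>}|"
    using assms(1) infinite_formulas card_of_ordLeq_infinite[of "{\<phi> :: ('f, 'r) fm. fm_wf S \<phi>}" A]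
      not_ordLess_iff_ordLeq[OF card_of_Well_order card_of_Well_order] by blast
  then show ?thesis using ordLess_transitive card_formulas assms(2) by (auto simp: small_def)
qed

lemma small_set: "a \<in> tuples S n \<Longrightarrow> small (set a)"
  by (intro small_finite) (auto simp: tuples_def)

lemma small_model_small: "small_model \<kappa> S M \<Longrightarrow> small M"
  by (simp add: small_model_def elementary_substruct_def small_def)

text \<open>Saturation speaks about one variable. Inductively, the type of the first n coordinates
  is realized by some \<open>a\<close>, and saturation is applied to the sections at
  \<open>a\<close>, which form a type over the still small set
  \<open>A \<union> set a\<close>.\<close>

lemma realize_complete_type:
  "small A \<Longrightarrow> t \<in> complete_types S n A \<Longrightarrow> \<exists>a. realizes S n a t"
proof (induction n arbitrary: t)
  case 0
  have "[] \<in> X" if "X \<in> t" for X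
    using complete_type_fip[OF 0(2), of "{X}"] that by (auto simp: tuples_def)
  then show ?case by (auto simp: realizes_def tuples_def intro!: exI[of _ "[]"])
next
  case (Suc n)
  have t: "t \<in> complete_types S (n + 1) A" using Suc.prems by simp
  define cyl where "cyl X = {z \<in> tuples S (n + 1). take n z \<in> X}" for X
  have cyl_def': "cyl X \<in> definable S (n + 1) A" if "X \<in> definable S n A" for X
    using definable_take[OF that] by (simp only: cyl_def)
  define t' where "t' = {X \<in> definable S n A. cyl X \<in> t}"
  have "t' \<in> complete_types S n A"
    unfolding complete_types_def
  proof (intro CollectI conjI allI impI ballI)
    show "t' \<subseteq> definable S n A" by (auto simp: t'_def)
    fix F assume F: "F \<subseteq> t'" "finite F"
    then have "tuples S (n + 1) \<inter> \<Inter>(cyl ` F) \<noteq> {}"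
      by (intro complete_type_fip[OF t]) (auto simp: t'_def)
    then obtain z where z: "z \<in> tuples S (n + 1)" "\<And>X. X \<in> F \<Longrightarrow> z \<in> cyl X" by blast
    have "take n z \<in> tuples S n \<inter> \<Inter>F"
      using z by (auto simp: cyl_def tuples_def dest: in_set_takeD)
    then show "tuples S n \<inter> \<Inter>F \<noteq> {}" by blast
  next
    fix X assume X: "X \<in> definable S n A"
    have "tuples S (n + 1) - cyl X = cyl (tuples S n - X)"
      by (auto simp: cyl_def tuples_def dest: in_set_takeD)
    then have "cyl X \<in> t \<or> cyl (tuples S n - X) \<in> t"
      using complete_type_cases[OF t cyl_def'[OF X]] by simp
    then show "X \<in> t' \<or> tuples S n - X \<in> t'"
      using X definable_Compl by (auto simp: t'_def)
  qed
  then obtain a where a: "a \<in> tuples S n" "\<And>X. X \<in> t' \<Longrightarrow> a \<in> X"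
    using Suc.IH[OF Suc.prems(1)] unfolding realizes_def by blast
  define sec where "sec Z = {y \<in> tuples S 1. a @ y \<in> Z}" for Z
  have sec_Int: "tuples S 1 \<inter> \<Inter>(sec ` F) = sec (tuples S (n + 1) \<inter> \<Inter>F)" for F
    using tuples_append[OF a(1), of _ 1] by (auto simp: sec_def)
  \<comment> \<open>The projection of \<open>Z\<close> is definable by an existential formula and
    belongs to the type realized by \<open>a\<close>, so some extension of \<open>a\<close> lies in
    \<open>Z\<close>.\<close>
  have sec_ne: "sec Z \<noteq> {}" if Z: "Z \<in> t" for Z
  proof -
    let ?X = "{a \<in> tuples S n. \<exists>y\<in>tuples S 1. a @ y \<in> Z}"
    have Zd: "Z \<in> definable S (n + 1) A" using complete_type_definable[OF t Z] .
    have X: "?X \<in> definable S n A" using definable_proj[OF Zd] .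
    have "Z \<subseteq> cyl ?X"
    proof
      fix z assume "z \<in> Z"
      then have "z \<in> tuples S (n + 1)" using definable_subset[OF Zd] by blast
      then obtain u y where "u \<in> tuples S n" "y \<in> tuples S 1" "z = u @ y" by (rule tuples_split)
      then show "z \<in> cyl ?X"
        using \<open>z \<in> Z\<close> \<open>z \<in> tuples S (n + 1)\<close> by (auto simp: cyl_def tuples_def)
    qed
    then have "?X \<in> t'" using complete_type_mono[OF t Z _ cyl_def'[OF X]] X by (simp add: t'_def)
    then show ?thesis using a(2) by (auto simp: sec_def)
  qed
  have "sec ` t \<in> complete_types S 1 (A \<union> set a)"
    unfolding complete_types_def
  proof (intro CollectI conjI allI impI ballI)
    show "sec ` t \<subseteq> definable S 1 (A \<union> set a)"
      using definable_section[OF a(1), of _ 1 A] complete_type_definable[OF t] by (auto simp: sec_def)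
    fix F assume "F \<subseteq> sec ` t" "finite F"
    then obtain G where G: "G \<subseteq> t" "finite G" "F = sec ` G" by (meson finite_subset_image)
    show "tuples S 1 \<inter> \<Inter>F \<noteq> {}"
      using sec_ne[OF complete_type_Inter[OF t G(2,1) carrier_nonempty]] sec_Int[of G] G(3) by simp
  next
    fix Y assume "Y \<in> definable S 1 (A \<union> set a)"
    then obtain Z where Z: "Z \<in> definable S (n + 1) A" "Y = sec Z"
      using definable_section[OF a(1), of Y 1 A] by (auto simp: sec_def)
    have "tuples S 1 - Y = sec (tuples S (n + 1) - Z)"
      using Z(2) tuples_append[OF a(1), of _ 1] by (auto simp: sec_def)
    then show "Y \<in> sec ` t \<or> tuples S 1 - Y \<in> sec ` t"
      using complete_type_cases[OF t Z(1)] Z(2) by auto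
  qed
  moreover have "small (A \<union> set a)" using small_Un[OF Suc.prems(1) small_set[OF a(1)]] .
  moreover have "saturated \<kappa> S" using monster by (simp add: monster_model_def)
  ultimately obtain y where "realizes S 1 y (sec ` t)"
    unfolding saturated_def small_def by meson
  then have y: "y \<in> tuples S 1" "\<And>Z. Z \<in> t \<Longrightarrow> y \<in> sec Z" by (auto simp: realizes_def)
  have "realizes S (n + 1) (a @ y) t"
    using y tuples_append[OF a(1) y(1)] by (auto simp: realizes_def sec_def)
  then show ?case by auto
qed

lemma realization:
  assumes "small A" "t \<in> complete_types S n A"
  shows "realization S n t \<in> tuples S n" "tp S n A (realization S n t) = t"
proof -
  have "realizes S n (realization S n t) t"
    unfolding realization_def using realize_complete_type[OF assms] by (rule someI_ex)
  then show "realization S n t \<in> tuples S n" "tp S n A (realization S n t) = t"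
    using realizes_tp[OF carrier_nonempty assms(2)] by (auto simp: realizes_def)
qed


subsection \<open>Small models\<close>

text \<open>Skolem functions, made total by a default element of the carrier.\<close>

definition witness :: "('f, 'r) fm \<Rightarrow> 'm list \<Rightarrow> 'm" where
  "witness \<psi> as = (case \<psi> of Ex i \<xi> \<Rightarrow>
      (if \<exists>d\<in>carrier S. sat_env S ((\<lambda>j. as ! j)(i := d)) \<xi>
       then SOME d. d \<in> carrier S \<and> sat_env S ((\<lambda>j. as ! j)(i := d)) \<xi>
       else SOME d. d \<in> carrier S)
    | _ \<Rightarrow> SOME d. d \<in> carrier S)"

lemma witness_in: "witness \<psi> as \<in> carrier S"
proof -
  have "(SOME d. d \<in> carrier S) \<in> carrier S" using carrier_nonempty by (meson ex_in_conv someI_ex)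
  moreover have "(SOME d. d \<in> carrier S \<and> sat_env S ((\<lambda>j. as ! j)(i := d)) \<xi>) \<in> carrier S"
    if "\<exists>d\<in>carrier S. sat_env S ((\<lambda>j. as ! j)(i := d)) \<xi>" for i \<xi>
    using someI_ex[of "\<lambda>d. d \<in> carrier S \<and> sat_env S ((\<lambda>j. as ! j)(i := d)) \<xi>"] that by blast
  ultimately show ?thesis by (auto simp: witness_def split: fm.split)
qed

lemma witness_sat:
  assumes "d \<in> carrier S" "sat_env S ((\<lambda>j. as ! j)(i := d)) \<xi>"
  shows "sat_env S ((\<lambda>j. as ! j)(i := witness (Ex i \<xi>) as)) \<xi>"
  using someI_ex[of "\<lambda>d. d \<in> carrier S \<and> sat_env S ((\<lambda>j. as ! j)(i := d)) \<xi>"] assms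
  by (auto simp: witness_def)

section \<open>Skolem hulls and the downward Loewenheim-Skolem theorem\<close>

primrec hull_stage :: "'m set \<Rightarrow> nat \<Rightarrow> 'm set" where
  "hull_stage A 0 = A"
| "hull_stage A (Suc n) = hull_stage A n \<union>
    (\<Union>l. (\<lambda>(\<psi>, as). witness \<psi> as) `
       ({\<psi>. fm_wf S \<psi>} \<times> {as. length as = l \<and> set as \<subseteq> hull_stage A n}))"

definition skolem_hull :: "'m set \<Rightarrow> 'm set" where
  "skolem_hull A = (\<Union>n. hull_stage A n)"

lemma hull_superset: "A \<subseteq> skolem_hull A"
  unfolding skolem_hull_def using hull_stage.simps(1)[of A] by blast

lemma hull_carrier:
  assumes "A \<subseteq> carrier S"
  shows "skolem_hull A \<subseteq> carrier S"
proof -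
  have "hull_stage A n \<subseteq> carrier S" for n
    using assms witness_in by (induction n) auto
  then show ?thesis by (auto simp: skolem_hull_def)
qed

lemma hull_stage_mono: "m \<le> n \<Longrightarrow> hull_stage A m \<subseteq> hull_stage A n"
  by (rule lift_Suc_mono_le[of "hull_stage A"]) auto

lemma hull_witness:
  assumes "set as \<subseteq> skolem_hull A" "fm_wf S \<psi>"
  shows "witness \<psi> as \<in> skolem_hull A"
proof -
  have "\<exists>n. set as \<subseteq> hull_stage A n"
    using assms(1)
  proof (induction as)
    case (Cons a as)
    then obtain m n where "a \<in> hull_stage A m" "set as \<subseteq> hull_stage A n" by (auto simp: skolem_hull_def)
    then show ?case
      using hull_stage_mono[of m "max m n" A] hull_stage_mono[of n "max m n" A]
      by (intro exI[of _ "max m n"]) auto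
  qed simp
  then obtain n where n: "set as \<subseteq> hull_stage A n" by blast
  then have "(\<psi>, as) \<in> {\<psi>. fm_wf S \<psi>} \<times> {bs. length bs = length as \<and> set bs \<subseteq> hull_stage A n}"
    using assms(2) by simp
  then have "witness \<psi> as \<in> hull_stage A (Suc n)" by (simp only: hull_stage.simps) force
  then show ?thesis by (auto simp: skolem_hull_def simp del: hull_stage.simps)
qed

lemma card_lists_length:
  assumes "infinite C" "|A| \<le>o |C|"
  shows "|{as. length as = l \<and> set as \<subseteq> A}| \<le>o |C|"
proof (induction l)
  case 0
  have "{as. length as = 0 \<and> set as \<subseteq> A} = {[]}" by auto
  then show ?case
    using card_of_singl_ordLeq[of C "[]"] assms(1) by auto
next
  case (Suc l)
  have "{as. length as = Suc l \<and> set as \<subseteq> A} =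
      (\<lambda>(a, as). a # as) ` (A \<times> {as. length as = l \<and> set as \<subseteq> A})"
    by (force simp: length_Suc_conv)
  moreover have "|A \<times> {as. length as = l \<and> set as \<subseteq> A}| \<le>o |C|"
    by (rule card_of_Times_ordLeq_infinite_Field[OF _ assms(2) Suc card_of_Card_order])
      (simp only: Field_card_of assms(1) not_False_eq_True)
  ultimately show ?case by (simp only:) (rule ordLeq_transitive[OF card_of_image])
qed

text \<open>All stages are bounded by one fixed cardinal, that of the formulas together with
  \<open>A\<close>. It is infinite and below \<kappa>, so the countable union obeys the same bound,
  whereas bounding stages by \<kappa> alone would not keep their union below \<kappa>.\<close>

lemma hull_small:
  assumes "small A"
  shows "small (skolem_hull A)"
proof -
  let ?F = "{\<psi> :: ('f, 'r) fm. fm_wf S \<psi>}"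
  let ?C = "?F <+> A"
  have inf: "infinite ?C" using infinite_formulas by simp
  have F: "|?F| \<le>o |?C|" by (rule card_of_Plus1)
  have nat: "|UNIV :: nat set| \<le>o |?C|" using inf infinite_iff_card_of_nat by blast
  have stage: "|hull_stage A n| \<le>o |?C|" for n
  proof (induction n)
    case 0
    then show ?case using card_of_Plus2 by simp
  next
    case (Suc n)
    have "|?F \<times> {as. length as = l \<and> set as \<subseteq> hull_stage A n}| \<le>o |?C|" for l
      by (rule card_of_Times_ordLeq_infinite_Field[OF _ F card_lists_length[OF inf Suc] card_of_Card_order])
        (simp only: Field_card_of inf not_False_eq_True)
    then have "|(\<lambda>(\<psi>, as). witness \<psi> as) ` (?F \<times> {as. length as = l \<and> set as \<subseteq> hull_stage A n})| \<le>o |?C|" for l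
      by (rule ordLeq_transitive[OF card_of_image])
    then have "|\<Union>l. (\<lambda>(\<psi>, as). witness \<psi> as) ` (?F \<times> {as. length as = l \<and> set as \<subseteq> hull_stage A n})| \<le>o |?C|"
      by (intro card_of_UNION_ordLeq_infinite[OF inf nat]) blast
    then show ?case
      unfolding hull_stage.simps using Suc inf
      by (intro card_of_Un_ordLeq_infinite_Field[OF _ _ _ card_of_Card_order[of ?C]])
        (simp_all only: Field_card_of not_False_eq_True)
  qed
  have "|skolem_hull A| \<le>o |?C|"
    unfolding skolem_hull_def by (intro card_of_UNION_ordLeq_infinite[OF inf nat]) (use stage in blast)
  moreover have "|?C| <o \<kappa>"
    using assms by (intro card_of_Plus_ordLess_infinite_Field infinite_Field card_order card_formulas)
      (simp add: small_def)
  ultimately show ?thesis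
    using ordLeq_ordLess_trans hull_carrier assms by (auto simp: small_def)
qed

lemma tm_val_carrier: "tm_val (S\<lparr>carrier := N\<rparr>) e t = tm_val S e t"
proof (induction t)
  case (Fn f ts)
  then have "map (tm_val (S\<lparr>carrier := N\<rparr>) e) ts = map (tm_val S e) ts" by (intro map_cong) auto
  then show ?case by (simp only: tm_val.simps) simp
qed simp

lemma hull_sat:
  assumes A: "A \<subseteq> carrier S" "skolem_hull A \<noteq> {}"
  shows "fm_wf S \<psi> \<Longrightarrow> range e \<subseteq> skolem_hull A \<Longrightarrow> sat_env (S\<lparr>carrier := skolem_hull A\<rparr>) e \<psi> \<longleftrightarrow> sat_env S e \<psi>"
proof (induction \<psi> arbitrary: e)
  case (Equal s t)
  then show ?case by (simp add: tm_val_carrier)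
next
  case (Rel r ts)
  have "map (tm_val (S\<lparr>carrier := skolem_hull A\<rparr>) e) ts = map (tm_val S e) ts" by (simp add: tm_val_carrier)
  then show ?case by (simp only: sat_env.simps) simp
next
  case (Neg \<psi>)
  then show ?case by simp
next
  case (Conj \<psi> \<xi>)
  then show ?case by simp
next
  case (Ex i \<psi>)
  have IH: "sat_env (S\<lparr>carrier := skolem_hull A\<rparr>) (e(i := d)) \<psi> \<longleftrightarrow> sat_env S (e(i := d)) \<psi>" if "d \<in> skolem_hull A" for d
    using that Ex.prems by (intro Ex.IH) (auto simp: image_subset_iff)
  have "\<exists>d\<in>skolem_hull A. sat_env S (e(i := d)) \<psi>" if d: "d \<in> carrier S" "sat_env S (e(i := d)) \<psi>" for d
  proof -
    \<comment> \<open>\<open>witness\<close> takes a list, so the environment is cut off beyond the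
      free variables of \<psi>.\<close>
    obtain K where K: "free_vars \<psi> \<subseteq> {..<K}" using finite_free_vars finite_nat_iff_bounded by blast
    let ?as = "map e [0..<K]"
    have eq: "sat_env S ((\<lambda>j. ?as ! j)(i := d)) \<psi> \<longleftrightarrow> sat_env S (e(i := d)) \<psi>" for d
      using K by (intro sat_env_cong) auto
    have "witness (Ex i \<psi>) ?as \<in> skolem_hull A"
      using Ex.prems by (intro hull_witness) auto
    moreover have "sat_env S (e(i := witness (Ex i \<psi>) ?as)) \<psi>"
      using witness_sat[OF d(1), of ?as i \<psi>] eq d(2) by blast
    ultimately show ?thesis by blast
  qed
  then show ?case using IH hull_carrier[OF A(1)] by auto
qed

lemma hull_small_model:
  assumes A: "small A" and ne: "A \<noteq> {}"
  shows "small_model \<kappa> S (skolem_hull A)"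
proof -
  have AC: "A \<subseteq> carrier S" using A by (simp add: small_def)
  obtain d0 where d0: "d0 \<in> skolem_hull A" using ne hull_superset by blast
  have "fint S f as \<in> skolem_hull A" if f: "f \<in> funs S" "length as = farity S f" "set as \<subseteq> skolem_hull A" for f as
  proof -
    let ?n = "length as"
    \<comment> \<open>The only witness of this formula is the value of the function, so closure
      under witnesses gives closure under function symbols.\<close>
    let ?\<xi> = "Equal (Fn f (map Var [0..<?n])) (Var ?n) :: ('f, 'r) fm"
    have sat: "sat_env S ((\<lambda>j. as ! j)(?n := d)) ?\<xi> \<longleftrightarrow> d = fint S f as" for d
    proof -
      have "map (tm_val S ((\<lambda>j. as ! j)(?n := d)) \<circ> Var) [0..<?n] = as"
        by (intro nth_equalityI) auto
      then show ?thesis by auto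
    qed
    have "fint S f as \<in> carrier S"
      using f monster hull_carrier[OF AC] unfolding monster_model_def is_struct_def by blast
    then have "sat_env S ((\<lambda>j. as ! j)(?n := witness (Ex ?n ?\<xi>) as)) ?\<xi>"
      using sat by (intro witness_sat) auto
    then have "witness (Ex ?n ?\<xi>) as = fint S f as" using sat by blast
    moreover have "fm_wf S (Ex ?n ?\<xi>)" using f by (auto simp: list_all_iff)
    ultimately show ?thesis using hull_witness[OF f(3)] by metis
  qed
  then have "is_struct (S\<lparr>carrier := skolem_hull A\<rparr>)" using d0 by (auto simp: is_struct_def)
  moreover have "sat (S\<lparr>carrier := skolem_hull A\<rparr>) as \<psi> \<longleftrightarrow> sat S as \<psi>"
    if "set as \<subseteq> skolem_hull A" "\<psi> \<in> formulas S (length as)" for as \<psi>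
  proof -
    define e where "e i = (if i < length as then as ! i else d0)" for i
    have "range e \<subseteq> skolem_hull A" using that d0 by (auto simp: e_def)
    then have "sat_env (S\<lparr>carrier := skolem_hull A\<rparr>) e \<psi> \<longleftrightarrow> sat_env S e \<psi>"
      using that d0 AC by (intro hull_sat) (auto simp: formulas_def)
    moreover have "sat_env S' (\<lambda>i. as ! i) \<psi> \<longleftrightarrow> sat_env S' e \<psi>" for S' :: "('f, 'r, 'm) struct"
      using that by (intro sat_env_cong) (auto simp: e_def formulas_def)
    ultimately show ?thesis by (simp add: sat_def)
  qed
  ultimately show ?thesis
    using hull_small[OF A] by (auto simp: small_model_def elementary_substruct_def small_def)
qed

text \<open>Ensures that the choice of a model in \<open>keisler_product\<close> has something to
  choose from.\<close>

lemma ex_small_model: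
  assumes "small A"
  obtains N where "small_model \<kappa> S N" "A \<subseteq> N"
proof -
  obtain d where d: "d \<in> carrier S" using carrier_nonempty by blast
  have "small (A \<union> {d})" using d by (intro small_Un assms small_finite) auto
  from hull_small_model[OF this] show ?thesis using that hull_superset[of "A \<union> {d}"] by blast
qed

end


subsection \<open>Spaces of types\<close>

context monster
begin

text \<open>Recovers a definable set from its clopen set of types, so \<mu> can be carried over to
  clopen sets without choosing representatives.\<close>

lemma cylinder_tp: "X \<in> definable S n A \<Longrightarrow> {a \<in> tuples S n. tp S n A a \<in> cylinder S n A X} = X"
  using tp_complete[OF carrier_nonempty] definable_subset[of X S n A] by (auto simp: cylinder_def tp_def)

lemma cylinder_Int:
  assumes "X \<in> definable S n A" "Y \<in> definable S n A"
  shows "cylinder S n A X \<inter> cylinder S n A Y = cylinder S n A (X \<inter> Y)"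
proof -
  have XY: "X \<inter> Y \<in> definable S n A" using assms by (rule definable_Int)
  have "X \<in> t \<and> Y \<in> t \<longleftrightarrow> X \<inter> Y \<in> t" if t: "t \<in> complete_types S n A" for t
    using complete_type_Int[OF t] complete_type_mono[OF t, of "X \<inter> Y"] assms by blast
  then show ?thesis by (auto simp: cylinder_def)
qed

lemma cylinder_Compl:
  "X \<in> definable S n A \<Longrightarrow> complete_types S n A - cylinder S n A X = cylinder S n A (tuples S n - X)"
  by (auto simp: cylinder_def complete_type_Compl)

lemma cylinder_tuples: "cylinder S n A (tuples S n) = complete_types S n A"
  using complete_type_finite[of _ S n A "{}"] tuples_definable[OF carrier_nonempty]
  by (auto simp: cylinder_def)

lemma topspace_type_space: "topspace (type_space S n A) = complete_types S n A"
proof -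
  have "complete_types S n A \<subseteq> \<Union>(cylinder S n A ` definable S n A)"
    unfolding cylinder_tuples[symmetric] using tuples_definable[OF carrier_nonempty] by blast
  then have "\<Union>(cylinder S n A ` definable S n A) = complete_types S n A"
    by (auto simp: cylinder_def)
  then show ?thesis by (simp add: type_space_def)
qed

lemma openin_cylinder: "X \<in> definable S n A \<Longrightarrow> openin (type_space S n A) (cylinder S n A X)"
  unfolding type_space_def by (intro topology_generated_by_Basis) blast

lemma type_space_base:
  assumes "openin (type_space S n A) U" "t \<in> U"
  shows "\<exists>X\<in>definable S n A. t \<in> cylinder S n A X \<and> cylinder S n A X \<subseteq> U"
proof -
  have "generate_topology_on (cylinder S n A ` definable S n A) U"
    using assms(1) by (simp add: type_space_def openin_topology_generated_by_iff)
  then show ?thesis using assms(2)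
  proof (induction arbitrary: t)
    case (Int U V)
    then obtain X Y where X: "X \<in> definable S n A" "t \<in> cylinder S n A X" "cylinder S n A X \<subseteq> U"
      and Y: "Y \<in> definable S n A" "t \<in> cylinder S n A Y" "cylinder S n A Y \<subseteq> V"
      by (metis IntE)
    then show ?case
      using cylinder_Int[OF X(1) Y(1)] definable_Int[OF X(1) Y(1)] by (intro bexI[of _ "X \<inter> Y"]) auto
  next
    case (UN K)
    then obtain V where V: "V \<in> K" "t \<in> V" by blast
    then show ?case using UN.IH[OF V] by blast
  qed auto
qed

text \<open>Without a finite subcover, the complements of the definable sets whose cylinders lie
  inside members of the cover are finitely consistent; a complete type containing all of them
  escapes the cover.\<close>

lemma compact_type_space: "compact_space (type_space S n A)"
  unfolding compact_space_def compactin_def topspace_type_space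
proof (intro conjI allI impI, simp, elim conjE)
  fix \<U> assume op: "\<forall>U\<in>\<U>. openin (type_space S n A) U" and cov: "complete_types S n A \<subseteq> \<Union>\<U>"
  show "\<exists>F. finite F \<and> F \<subseteq> \<U> \<and> complete_types S n A \<subseteq> \<Union>F"
  proof (rule ccontr)
    assume neg: "\<not> ?thesis"
    define \<X> where "\<X> = {X \<in> definable S n A. \<exists>U\<in>\<U>. cylinder S n A X \<subseteq> U}"
    have "tuples S n \<inter> \<Inter>F \<noteq> {}" if F: "F \<subseteq> (\<lambda>X. tuples S n - X) ` \<X>" "finite F" for F
    proof
      assume empty: "tuples S n \<inter> \<Inter>F = {}"
      obtain G where G: "G \<subseteq> \<X>" "finite G" "F = (\<lambda>X. tuples S n - X) ` G"
        using F by (meson finite_subset_image)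
      have "\<forall>X\<in>G. \<exists>U\<in>\<U>. cylinder S n A X \<subseteq> U" using G(1) by (auto simp: \<X>_def)
      then obtain g where g: "\<And>X. X \<in> G \<Longrightarrow> g X \<in> \<U>" "\<And>X. X \<in> G \<Longrightarrow> cylinder S n A X \<subseteq> g X"
        by metis
      have "t \<in> \<Union>(g ` G)" if t: "t \<in> complete_types S n A" for t
      proof (rule ccontr)
        assume "t \<notin> \<Union>(g ` G)"
        then have "X \<notin> t" if "X \<in> G" for X using g(2)[OF that] that t by (auto simp: cylinder_def)
        then have "F \<subseteq> t" using G complete_type_Compl[OF t] by (auto simp: \<X>_def)
        then show False using complete_type_fip[OF t _ F(2)] empty by blast
      qed
      moreover have "finite (g ` G)" "g ` G \<subseteq> \<U>" using G(2) g(1) by auto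
      ultimately show False using neg by (meson subsetI)
    qed
    moreover have "(\<lambda>X. tuples S n - X) ` \<X> \<subseteq> definable S n A" using definable_Compl by (auto simp: \<X>_def)
    ultimately obtain t where t: "t \<in> complete_types S n A" "(\<lambda>X. tuples S n - X) ` \<X> \<subseteq> t"
      using extend_to_complete_type by metis
    then obtain U where U: "U \<in> \<U>" "t \<in> U" using cov by blast
    then obtain X where X: "X \<in> definable S n A" "t \<in> cylinder S n A X" "cylinder S n A X \<subseteq> U"
      using type_space_base op by meson
    then have "tuples S n - X \<in> t" using U t(2) by (auto simp: \<X>_def)
    then show False using complete_type_Compl[OF t(1) X(1)] X(2) by (simp add: cylinder_def)
  qed
qed

lemma Hausdorff_type_space: "Hausdorff_space (type_space S n A)"
  unfolding Hausdorff_space_def topspace_type_space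
proof (intro allI impI, elim conjE)
  fix t u assume t: "t \<in> complete_types S n A" and u: "u \<in> complete_types S n A" and "t \<noteq> u"
  then obtain X where X: "X \<in> t" "X \<notin> u" using complete_type_eqI[OF t u] by blast
  have Xd: "X \<in> definable S n A" using complete_type_definable[OF t X(1)] .
  have "t \<in> cylinder S n A X" "u \<in> cylinder S n A (tuples S n - X)"
    using t u X complete_type_Compl[OF u Xd] by (auto simp: cylinder_def)
  moreover have "disjnt (cylinder S n A X) (cylinder S n A (tuples S n - X))"
    using cylinder_Compl[OF Xd] by (auto simp: disjnt_def)
  ultimately show "\<exists>U V. openin (type_space S n A) U \<and> openin (type_space S n A) V \<and> t \<in> U \<and> u \<in> V \<and> disjnt U V"
    using openin_cylinder[OF Xd] openin_cylinder[OF definable_Compl[OF Xd]]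
    by (intro exI[of _ "cylinder S n A X"] exI[of _ "cylinder S n A (tuples S n - X)"]) simp
qed

section \<open>Regular Borel measures on type spaces induced by Keisler measures\<close>

lemma keisler_finitely_additive:
  assumes \<mu>: "keisler_measure S n \<mu>" and A: "A \<subseteq> carrier S"
  shows "finitely_additive_prob (tuples S n) (definable S n A) \<mu>"
proof -
  interpret algebra "tuples S n" "definable S n A" by (rule algebra_definable[OF carrier_nonempty])
  show ?thesis
    using \<mu> subsetD[OF definable_mono[OF A]] by unfold_locales (auto simp: keisler_measure_def)
qed

lemma stone_content_types:
  assumes \<mu>: "keisler_measure S n \<mu>" and A: "A \<subseteq> carrier S"
  shows "stone_content (type_space S n A) (cylinder S n A ` definable S n A)
    (\<lambda>C. \<mu> {a \<in> tuples S n. tp S n A a \<in> C})"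
proof -
  interpret \<mu>: finitely_additive_prob "tuples S n" "definable S n A" \<mu>
    by (rule keisler_finitely_additive[OF assms])
  let ?T = "type_space S n A" and ?\<C> = "cylinder S n A ` definable S n A"
  have "algebra (topspace ?T) ?\<C>"
    unfolding algebra_iff_Int topspace_type_space
  proof (intro conjI ballI)
    show "?\<C> \<subseteq> Pow (complete_types S n A)" by (auto simp: cylinder_def)
    have "cylinder S n A {} = {}"
      using cylinder_Compl[OF \<mu>.top] cylinder_tuples by auto
    then show "{} \<in> ?\<C>" using \<mu>.empty_sets by (metis image_eqI)
  qed (auto simp: cylinder_Int cylinder_Compl intro!: imageI definable_Int definable_Compl)
  then interpret algebra "topspace ?T" ?\<C> .
  show ?thesis
  proof unfold_locales
    fix C assume "C \<in> ?\<C>"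
    then show "0 \<le> \<mu> {a \<in> tuples S n. tp S n A a \<in> C}"
      using cylinder_tp \<mu>.nonneg by auto
  next
    fix C D assume C: "C \<in> ?\<C>" and D: "D \<in> ?\<C>" and disj: "C \<inter> D = {}"
    then obtain X Y where X: "X \<in> definable S n A" "C = cylinder S n A X"
      and Y: "Y \<in> definable S n A" "D = cylinder S n A Y" by blast
    have eq: "{a \<in> tuples S n. tp S n A a \<in> C} = X" "{a \<in> tuples S n. tp S n A a \<in> D} = Y"
      using cylinder_tp X Y by auto
    then have "{a \<in> tuples S n. tp S n A a \<in> C \<union> D} = X \<union> Y" "X \<inter> Y = {}" using disj by auto
    then show "\<mu> {a \<in> tuples S n. tp S n A a \<in> C \<union> D} =
        \<mu> {a \<in> tuples S n. tp S n A a \<in> C} + \<mu> {a \<in> tuples S n. tp S n A a \<in> D}"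
      using eq \<mu>.additive X(1) Y(1) by simp
  next
    have "{a \<in> tuples S n. tp S n A a \<in> topspace ?T} = tuples S n"
      using tp_complete[OF carrier_nonempty] by (auto simp: topspace_type_space)
    then show "\<mu> {a \<in> tuples S n. tp S n A a \<in> topspace ?T} = 1" using \<mu>.total by simp
  next
    fix U t assume "openin ?T U" "t \<in> U"
    from type_space_base[OF this] obtain X where
      "X \<in> definable S n A" "t \<in> cylinder S n A X" "cylinder S n A X \<subseteq> U" by blast
    then show "\<exists>C\<in>?\<C>. t \<in> C \<and> C \<subseteq> U" by (intro bexI[of _ "cylinder S n A X"]) auto
  next
    fix C assume "C \<in> ?\<C>"
    then show "openin ?T C" using openin_cylinder by auto
  qed (rule compact_type_space Hausdorff_type_space)+
qed

lemma ex1_restriction: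
  assumes "keisler_measure S n \<mu>" "A \<subseteq> carrier S"
  shows "\<exists>!m. regular_borel_probability (type_space S n A) m \<and>
    (\<forall>X\<in>definable S n A. measure m (cylinder S n A X) = \<mu> X)"
proof -
  interpret stone_content "type_space S n A" "cylinder S n A ` definable S n A"
    "\<lambda>C. \<mu> {a \<in> tuples S n. tp S n A a \<in> C}"
    by (rule stone_content_types[OF assms])
  show ?thesis using ex1_regular_extension cylinder_tp by (simp cong: ball_cong)
qed

lemma restriction:
  assumes "keisler_measure S n \<mu>" "A \<subseteq> carrier S"
  shows restriction_regular: "regular_borel_probability (type_space S n A) (restriction_measure S n \<mu> A)"
    and measure_restriction: "X \<in> definable S n A \<Longrightarrow>
      measure (restriction_measure S n \<mu> A) (cylinder S n A X) = \<mu> X"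
  using theI'[OF ex1_restriction[OF assms]] unfolding restriction_measure_def by blast+

lemma restriction_prob_space:
  "keisler_measure S n \<mu> \<Longrightarrow> A \<subseteq> carrier S \<Longrightarrow> prob_space (restriction_measure S n \<mu> A)"
  using restriction_regular by (auto simp: regular_borel_probability_def)

lemma sets_restriction:
  "keisler_measure S n \<mu> \<Longrightarrow> A \<subseteq> carrier S \<Longrightarrow>
    sets (restriction_measure S n \<mu> A) = sets (borel_sets_of (type_space S n A))"
  using restriction_regular by (auto simp: regular_borel_probability_def)

lemma space_restriction:
  "keisler_measure S n \<mu> \<Longrightarrow> A \<subseteq> carrier S \<Longrightarrow>
    space (restriction_measure S n \<mu> A) = complete_types S n A"
  using sets_eq_imp_space_eq[OF sets_restriction] by (simp add: space_borel_sets_of topspace_type_space)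

lemma cylinder_sets_restriction:
  "keisler_measure S n \<mu> \<Longrightarrow> A \<subseteq> carrier S \<Longrightarrow> X \<in> definable S n A \<Longrightarrow>
    cylinder S n A X \<in> sets (restriction_measure S n \<mu> A)"
  by (simp add: sets_restriction openin_borel openin_cylinder)

lemma continuous_restrict_type:
  assumes "A \<subseteq> B"
  shows "continuous_map (type_space S n B) (type_space S n A) (\<lambda>t. t \<inter> definable S n A)"
  unfolding type_space_def[of S n A]
proof (rule continuous_on_generated_topo)
  fix U assume "U \<in> cylinder S n A ` definable S n A"
  then obtain X where X: "X \<in> definable S n A" "U = cylinder S n A X" by blast
  have "(\<lambda>t. t \<inter> definable S n A) -` U \<inter> topspace (type_space S n B) = cylinder S n B X"
    using X restrict_complete_type[OF _ assms] by (auto simp: cylinder_def topspace_type_space)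
  then show "openin (type_space S n B) ((\<lambda>t. t \<inter> definable S n A) -` U \<inter> topspace (type_space S n B))"
    using openin_cylinder[OF subsetD[OF definable_mono[OF assms] X(1)]] by simp
next
  have "\<Union>(cylinder S n A ` definable S n A) = complete_types S n A"
    using topspace_type_space[of n A] by (simp add: type_space_def)
  then show "(\<lambda>t. t \<inter> definable S n A) ` topspace (type_space S n B) \<subseteq> \<Union>(cylinder S n A ` definable S n A)"
    using restrict_complete_type[OF _ assms, of _ S n] by (simp only: topspace_type_space) blast
qed

lemma measurable_restrict_type:
  assumes "keisler_measure S n \<mu>" "A \<subseteq> B" "B \<subseteq> carrier S"
  shows "(\<lambda>t. t \<inter> definable S n A) \<in>
    restriction_measure S n \<mu> B \<rightarrow>\<^sub>M borel_sets_of (type_space S n A)"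
  using continuous_map_borel[OF continuous_restrict_type[OF assms(2)]]
    measurable_cong_sets[OF sets_restriction[OF assms(1,3)] refl] by blast

text \<open>The image measure is regular and has the right values on cylinders, so it is the unique
  extension. This governs every change of base, for integrals as well as for the choice of wide
  tuples.\<close>

lemma distr_restriction:
  assumes \<mu>: "keisler_measure S n \<mu>" and A: "A \<subseteq> B" "B \<subseteq> carrier S"
  shows "distr (restriction_measure S n \<mu> B) (borel_sets_of (type_space S n A)) (\<lambda>t. t \<inter> definable S n A) =
    restriction_measure S n \<mu> A"
proof -
  let ?m = "distr (restriction_measure S n \<mu> B) (borel_sets_of (type_space S n A)) (\<lambda>t. t \<inter> definable S n A)"
  have AC: "A \<subseteq> carrier S" using A by blast
  have "regular_borel_probability (type_space S n A) ?m"
    by (intro regular_borel_probability_distr[OF restriction_regular[OF \<mu> A(2)]]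
      continuous_restrict_type A Hausdorff_type_space compact_type_space)
  moreover have "measure ?m (cylinder S n A X) = \<mu> X" if X: "X \<in> definable S n A" for X
  proof -
    have XB: "X \<in> definable S n B" using X definable_mono[OF A(1)] by blast
    have "measure ?m (cylinder S n A X) = measure (restriction_measure S n \<mu> B)
        ((\<lambda>t. t \<inter> definable S n A) -` cylinder S n A X \<inter> space (restriction_measure S n \<mu> B))"
      using X by (intro measure_distr measurable_restrict_type[OF \<mu> A] openin_borel openin_cylinder)
    also have "(\<lambda>t. t \<inter> definable S n A) -` cylinder S n A X \<inter> space (restriction_measure S n \<mu> B) =
        cylinder S n B X"
      using X restrict_complete_type[OF _ A(1)]
      by (auto simp: cylinder_def space_restriction[OF \<mu> A(2)])
    finally show ?thesis using measure_restriction[OF \<mu> A(2) XB] by simp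
  qed
  ultimately show ?thesis
    using ex1_restriction[OF \<mu> AC] restriction_regular[OF \<mu> AC] measure_restriction[OF \<mu> AC] by blast
qed


subsection \<open>Wide tuples\<close>

text \<open>A finite part of a complete type is equivalent to a single member, so positivity of the
  members suffices.\<close>

lemma wide_overI:
  assumes \<mu>: "keisler_measure S n \<mu>" and A: "A \<subseteq> carrier S" and a: "a \<in> tuples S n"
    and pos: "\<And>X. X \<in> definable S n A \<Longrightarrow> a \<in> X \<Longrightarrow> 0 < \<mu> X"
  shows "wide_over S n \<mu> A a"
  unfolding wide_over_def wide_type_def type_implies_def
proof (intro conjI a notI, elim bexE conjE exE)
  fix Y F assume Y: "Y \<in> definable S n (carrier S)" "\<mu> Y = 0"
    and F: "F \<subseteq> tp S n A a" "finite F" "tuples S n \<inter> \<Inter>F \<subseteq> Y"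
  interpret \<mu>: finitely_additive_prob "tuples S n" "definable S n (carrier S)" \<mu>
    by (rule keisler_finitely_additive[OF \<mu> order_refl])
  let ?X = "tuples S n \<inter> \<Inter>F"
  have "?X \<in> tp S n A a"
    by (rule complete_type_Inter[OF tp_complete[OF carrier_nonempty a] F(2,1) carrier_nonempty])
  then have X: "?X \<in> definable S n A" "a \<in> ?X" by (auto simp: tp_def)
  then have "\<mu> ?X \<le> \<mu> Y" using F(3) Y definable_mono[OF A] by (intro \<mu>.measure_mono) auto
  then show False using pos[OF X] Y by simp
qed

lemma wide_over_anti:
  assumes "wide_over S n \<mu> B a" "A \<subseteq> B"
  shows "wide_over S n \<mu> A a"
proof -
  have "tp S n A a \<subseteq> tp S n B a" using definable_mono[OF assms(2)] by (auto simp: tp_def)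
  then show ?thesis
    using assms(1) unfolding wide_over_def wide_type_def type_implies_def by (meson order_trans)
qed

lemma definable_small:
  assumes "X \<in> definable S n (carrier S)"
  obtains C where "small C" "X \<in> definable S n C"
proof -
  obtain \<psi> c where c: "set c \<subseteq> carrier S" "\<psi> \<in> formulas S (n + length c)" "X = fibre_x S n \<psi> c"
    using assms by (auto simp: definable_def)
  show ?thesis
  proof (rule that)
    show "small (set c)" using c by (intro small_finite) auto
    show "X \<in> definable S n (set c)" using fibre_x_definable[OF c(2) order_refl] c(3) by simp
  qed
qed

text \<open>The union may be uncountable, so countable additivity is no help. It is open, however,
  and each compact subset meets only finitely many of the null cylinders needed to cover it; inner
  regularity concludes. The types outside it are the wide ones.\<close>

lemma restriction_null:
  assumes \<mu>: "keisler_measure S n \<mu>" and A: "A \<subseteq> carrier S"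
  shows "(\<Union>X\<in>{X \<in> definable S n A. \<mu> X = 0}. cylinder S n A X) \<in> null_sets (restriction_measure S n \<mu> A)"
proof -
  let ?m = "restriction_measure S n \<mu> A" and ?\<Z> = "{X \<in> definable S n A. \<mu> X = 0}"
  let ?O = "\<Union>X\<in>?\<Z>. cylinder S n A X"
  interpret prob_space ?m by (rule restriction_prob_space[OF assms])
  have "openin (type_space S n A) ?O" using openin_cylinder by (intro openin_Union) auto
  then have O: "?O \<in> sets ?m" by (simp add: sets_restriction[OF assms] openin_borel)
  have "emeasure ?m K \<le> 0" if K: "compactin (type_space S n A) K" "K \<subseteq> ?O" for K
  proof -
    have cov: "(\<forall>U\<in>cylinder S n A ` ?\<Z>. openin (type_space S n A) U) \<and> K \<subseteq> \<Union>(cylinder S n A ` ?\<Z>)"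
      using K(2) openin_cylinder by auto
    have "\<forall>\<U>. (\<forall>U\<in>\<U>. openin (type_space S n A) U) \<and> K \<subseteq> \<Union>\<U> \<longrightarrow>
        (\<exists>F. finite F \<and> F \<subseteq> \<U> \<and> K \<subseteq> \<Union>F)"
      using K(1) unfolding compactin_def by (rule conjunct2)
    from mp[OF spec[OF this] cov] obtain F where
      F: "finite F" "F \<subseteq> cylinder S n A ` ?\<Z>" "K \<subseteq> \<Union>F" by (elim exE conjE)
    have "C \<in> null_sets ?m" if C: "C \<in> F" for C
    proof -
      obtain X where "X \<in> definable S n A" "\<mu> X = 0" "C = cylinder S n A X" using C F(2) by blast
      then show ?thesis
        using measure_restriction[OF assms] cylinder_sets_restriction[OF assms]
        by (auto simp: null_sets_def emeasure_eq_measure)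
    qed
    then have "(\<Union>C\<in>F. C) \<in> null_sets ?m" using F(1) by (intro null_sets_UN') (auto simp: countable_finite)
    then have "emeasure ?m (\<Union>F) = 0" "\<Union>F \<in> sets ?m" by auto
    then show ?thesis using emeasure_mono[OF F(3), of ?m] by simp
  qed
  then have "(SUP K\<in>{K. compactin (type_space S n A) K \<and> K \<subseteq> ?O}. emeasure ?m K) \<le> 0"
    by (intro SUP_least) (elim CollectE conjE)
  moreover have "emeasure ?m ?O = (SUP K\<in>{K. compactin (type_space S n A) K \<and> K \<subseteq> ?O}. emeasure ?m K)"
    using restriction_regular[OF assms] O unfolding regular_borel_probability_def by blast
  ultimately show ?thesis using O by (simp add: null_sets_def)
qed

text \<open>\<open>F\<close> is pulled back to types over a small set containing \<open>C\<close>
  and parameters for \<open>D\<close>. Its measure is unchanged, so something remains after removing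
  the cylinder of \<open>D\<close> and the null set of types that are not wide; saturation realizes
  it.\<close>

lemma ex_wide_over:
  assumes \<nu>: "keisler_measure S n \<nu>" and N: "small N" and C: "small C" "N \<subseteq> C"
    and F: "F \<in> sets (restriction_measure S n \<nu> N)"
    and D: "D \<in> definable S n (carrier S)" "\<nu> D < measure (restriction_measure S n \<nu> N) F"
  shows "\<exists>b. wide_over S n \<nu> C b \<and> tp S n N b \<in> F \<and> b \<notin> D"
proof -
  obtain C' where C': "small C'" "D \<in> definable S n C'" using definable_small[OF D(1)] .
  define B where "B = C \<union> C'"
  have B: "small B" "N \<subseteq> B" "C \<subseteq> B" using small_Un C C' by (auto simp: B_def)
  have BC: "B \<subseteq> carrier S" "N \<subseteq> carrier S" using B N by (auto simp: small_def)
  have DB: "D \<in> definable S n B" using C' definable_mono[of C' B] by (auto simp: B_def)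
  let ?m = "restriction_measure S n \<nu> B" and ?r = "\<lambda>t. t \<inter> definable S n N"
  interpret prob_space ?m by (rule restriction_prob_space[OF \<nu> BC(1)])
  let ?O = "\<Union>X\<in>{X \<in> definable S n B. \<nu> X = 0}. cylinder S n B X"
  have O: "?O \<in> null_sets ?m" by (rule restriction_null[OF \<nu> BC(1)])
  let ?F = "?r -` F \<inter> space ?m"
  have Fb: "F \<in> sets (borel_sets_of (type_space S n N))" using F sets_restriction[OF \<nu> BC(2)] by simp
  have F': "?F \<in> sets ?m"
    using measurable_sets[OF measurable_restrict_type[OF \<nu> B(2) BC(1)] Fb] .
  have "measure (restriction_measure S n \<nu> N) F = prob ?F"
    unfolding distr_restriction[OF \<nu> B(2) BC(1), symmetric]
    by (rule measure_distr[OF measurable_restrict_type[OF \<nu> B(2) BC(1)] Fb])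
  moreover have cyl: "cylinder S n B D \<in> sets ?m" "prob (cylinder S n B D) = \<nu> D"
    using cylinder_sets_restriction[OF \<nu> BC(1) DB] measure_restriction[OF \<nu> BC(1) DB] by auto
  ultimately have lt: "prob (cylinder S n B D) < prob ?F" using D(2) by simp
  have "\<not> ?F \<subseteq> cylinder S n B D \<union> ?O"
  proof
    assume sub: "?F \<subseteq> cylinder S n B D \<union> ?O"
    have Os: "?O \<in> sets ?m" using O by blast
    have "prob ?F \<le> prob (cylinder S n B D \<union> ?O)"
      using cyl Os by (intro finite_measure_mono[OF sub]) auto
    also have "\<dots> = prob (cylinder S n B D)" using measure_Un_null_set[OF cyl(1) O] .
    finally show False using lt by simp
  qed
  then obtain t where t: "t \<in> ?F" "t \<notin> cylinder S n B D" "t \<notin> ?O" by blast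
  have tc: "t \<in> complete_types S n B" using t(1) space_restriction[OF \<nu> BC(1)] by simp
  define b where "b = realization S n t"
  have b: "b \<in> tuples S n" "tp S n B b = t" using realization[OF B(1) tc] by (auto simp: b_def)
  interpret \<nu>: finitely_additive_prob "tuples S n" "definable S n B" \<nu>
    by (rule keisler_finitely_additive[OF \<nu> BC(1)])
  have "0 < \<nu> X" if "X \<in> definable S n B" "b \<in> X" for X
  proof -
    have "t \<in> cylinder S n B X" using that b tc by (auto simp: cylinder_def tp_def)
    then have "\<nu> X \<noteq> 0" using t(3) that by blast
    then show ?thesis using \<nu>.nonneg[OF that(1)] by simp
  qed
  then have "wide_over S n \<nu> B b" using b by (intro wide_overI[OF \<nu> BC(1)])
  then have "wide_over S n \<nu> C b" using wide_over_anti B(3) by blast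
  moreover have "tp S n N b \<in> F" using t(1) b(2) tp_restrict[OF B(2), of S n b] by auto
  moreover have "b \<notin> D" using t(2) DB b(2) tc by (auto simp: cylinder_def tp_def)
  ultimately show ?thesis by blast
qed

lemma ex_wide_over_in:
  assumes \<nu>: "keisler_measure S n \<nu>" and C: "small C" and B: "B \<in> definable S n (carrier S)" "0 < \<nu> B"
  shows "\<exists>b\<in>B. wide_over S n \<nu> C b"
proof -
  interpret \<nu>: finitely_additive_prob "tuples S n" "definable S n (carrier S)" \<nu>
    by (rule keisler_finitely_additive[OF \<nu> order_refl])
  have CC: "C \<subseteq> carrier S" using C by (simp add: small_def)
  interpret prob_space "restriction_measure S n \<nu> C" by (rule restriction_prob_space[OF \<nu> CC])
  have "\<nu> (tuples S n - B) < prob (space (restriction_measure S n \<nu> C))"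
    using \<nu>.measure_diff[of "tuples S n" B] B definable_subset[OF B(1)] \<nu>.total by (simp add: prob_space)
  then obtain b where "wide_over S n \<nu> C b" "b \<notin> tuples S n - B"
    using ex_wide_over[OF \<nu> C C order_refl sets.top definable_Compl[OF B(1)]] by blast
  then show ?thesis by (auto simp: wide_over_def)
qed

end


subsection \<open>The product of Keisler measures\<close>

context monster
begin

lemma small_empty: "small {}"
  by (intro small_finite) auto

lemma definable_params:
  assumes "X \<in> definable S n A"
  obtains \<psi> c where "set c \<subseteq> A" "\<psi> \<in> formulas S (n + length c)" "X = fibre_x S n \<psi> c"
  using assms by (auto simp: definable_def)

lemma section_fibre:
  assumes "b \<in> tuples S q"
  shows "{a \<in> tuples S p. a @ b \<in> fibre_x S (p + q) \<psi> c} = fibre_x S p \<psi> (b @ c)"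
  using tuples_append[OF _ assms] by (auto simp: fibre_x_def)

lemma section_fibre_y:
  assumes "c \<in> tuples S l"
  shows "{b \<in> tuples S q. b @ c \<in> fibre_x S (q + l) \<psi> []} = fibre_x S q \<psi> c"
  using tuples_append[OF _ assms] by (auto simp: fibre_x_def)

lemma section_definable:
  assumes "X \<in> definable S (p + q) A" "b \<in> tuples S q" "A \<subseteq> carrier S"
  shows "{a \<in> tuples S p. a @ b \<in> X} \<in> definable S p (carrier S)"
proof -
  obtain \<psi> c where c: "set c \<subseteq> A" "\<psi> \<in> formulas S (p + q + length c)" "X = fibre_x S (p + q) \<psi> c"
    using definable_params[OF assms(1)] .
  have "set (b @ c) \<subseteq> carrier S" using c(1) assms by (auto simp: tuples_def)
  moreover have "length b = q" using assms(2) by (simp add: tuples_def)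
  ultimately show ?thesis
    unfolding c(3) section_fibre[OF assms(2)]
    using c(2) by (intro fibre_x_definable) (auto simp: add.assoc)
qed

text \<open>Invariance and Borel definability refer to types over the empty set, so parameters have
  to be moved into the tuple.\<close>

lemma tp_append:
  assumes b: "b \<in> tuples S q" "b' \<in> tuples S q" "tp S q A b = tp S q A b'"
    and c: "set c \<subseteq> A" "A \<subseteq> carrier S"
  shows "tp S (q + length c) {} (b @ c) = tp S (q + length c) {} (b' @ c)"
proof -
  have ct: "c \<in> tuples S (length c)" using c by (auto simp: tuples_def)
  have "b @ c \<in> Z \<longleftrightarrow> b' @ c \<in> Z" if Z: "Z \<in> definable S (q + length c) {}" for Z
  proof -
    obtain \<xi> where \<xi>: "\<xi> \<in> formulas S (q + length c)" "Z = fibre_x S (q + length c) \<xi> []"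
      using definable_params[OF Z] by (metis add.right_neutral list.set_intros(1) list.size(3) neq_Nil_conv subset_empty empty_iff)
    have d: "fibre_x S q \<xi> c \<in> definable S q A" using fibre_x_definable[OF \<xi>(1) c(1)] .
    have "u @ c \<in> Z \<longleftrightarrow> fibre_x S q \<xi> c \<in> tp S q A u" if u: "u \<in> tuples S q" for u
      using section_fibre_y[OF ct, of q \<xi>] u d by (auto simp: tp_def \<xi>(2))
    then show ?thesis using b by simp
  qed
  then show ?thesis by (auto simp: tp_def)
qed

lemma rectangle_append:
  assumes "a \<in> tuples S p" "X \<subseteq> tuples S p"
  shows "a @ b \<in> rectangle X Y \<longleftrightarrow> a \<in> X \<and> b \<in> Y"
proof
  assume "a @ b \<in> rectangle X Y"
  then obtain a' b' where ab: "a @ b = a' @ b'" "a' \<in> X" "b' \<in> Y" by (auto simp: rectangle_def)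
  then have "length a' = length a" using assms by (auto simp: tuples_def)
  then show "a \<in> X \<and> b \<in> Y" using ab by simp
qed (auto simp: rectangle_def)

definition section_measure :: "nat \<Rightarrow> nat \<Rightarrow> ('m list set \<Rightarrow> real) \<Rightarrow> 'm list set \<Rightarrow> 'm list set set \<Rightarrow> real" where
  "section_measure p q \<mu> X t = \<mu> {a \<in> tuples S p. a @ realization S q t \<in> X}"

text \<open>The chosen realization need not be \<open>b\<close>, but with the parameters
  \<open>c\<close> appended both tuples have the same type over the empty set, and invariance
  applies.\<close>

lemma section_measure_tp:
  assumes \<mu>: "invariant_measure S p \<mu>" and A: "small A" and X: "X \<in> definable S (p + q) A"
    and b: "b \<in> tuples S q"
  shows "section_measure p q \<mu> X (tp S q A b) = \<mu> {a \<in> tuples S p. a @ b \<in> X}"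
proof -
  have AC: "A \<subseteq> carrier S" using A by (simp add: small_def)
  obtain \<psi> c where c: "set c \<subseteq> A" "\<psi> \<in> formulas S (p + q + length c)" "X = fibre_x S (p + q) \<psi> c"
    using definable_params[OF X] .
  let ?r = "realization S q (tp S q A b)"
  have r: "?r \<in> tuples S q" "tp S q A ?r = tp S q A b"
    using realization[OF A tp_complete[OF carrier_nonempty b]] by auto
  have ct: "c \<in> tuples S (length c)" using c AC by (auto simp: tuples_def)
  have "\<mu> (fibre_x S p \<psi> (?r @ c)) = \<mu> (fibre_x S p \<psi> (b @ c))"
    using \<mu> c(2) tp_append[OF r(1) b r(2) c(1) AC] tuples_append[OF r(1) ct] tuples_append[OF b ct]
    unfolding invariant_measure_def by (metis add.assoc)
  then show ?thesis
    by (simp add: section_measure_def c(3) section_fibre[OF r(1)] section_fibre[OF b])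
qed

lemma section_measure_bounds:
  assumes \<mu>: "keisler_measure S p \<mu>" and A: "small A" and X: "X \<in> definable S (p + q) A"
    and t: "t \<in> complete_types S q A"
  shows "0 \<le> section_measure p q \<mu> X t" "section_measure p q \<mu> X t \<le> 1"
proof -
  interpret \<mu>: finitely_additive_prob "tuples S p" "definable S p (carrier S)" \<mu>
    by (rule keisler_finitely_additive[OF \<mu> order_refl])
  have AC: "A \<subseteq> carrier S" using A by (simp add: small_def)
  have d: "{a \<in> tuples S p. a @ realization S q t \<in> X} \<in> definable S p (carrier S)"
    by (rule section_definable[OF X realization(1)[OF A t] AC])
  show "0 \<le> section_measure p q \<mu> X t" "section_measure p q \<mu> X t \<le> 1"
    using \<mu>.nonneg[OF d] \<mu>.measure_mono[OF d \<mu>.top] \<mu>.total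
    by (auto simp: section_measure_def)
qed

text \<open>The map factors through types over the empty set, where Borel definability is assumed.
  The factor \<open>g\<close> uses chosen realizations and is continuous nevertheless, because the
  type alone decides which definable sets contain them.\<close>

lemma measurable_section_measure:
  assumes \<mu>: "borel_definable S p \<mu>" and A: "small A" and X: "X \<in> definable S (p + q) A"
  shows "section_measure p q \<mu> X \<in> borel_measurable (borel_sets_of (type_space S q A))"
proof -
  have AC: "A \<subseteq> carrier S" using A by (simp add: small_def)
  have inv: "invariant_measure S p \<mu>" using \<mu> by (simp add: borel_definable_def)
  obtain \<psi> c where c: "set c \<subseteq> A" "\<psi> \<in> formulas S (p + q + length c)" "X = fibre_x S (p + q) \<psi> c"
    using definable_params[OF X] .
  let ?l = "length c"
  have ct: "c \<in> tuples S ?l" using c AC by (auto simp: tuples_def)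
  define g where "g t = tp S (q + ?l) {} (realization S q t @ c)" for t
  have g_in: "g t \<in> complete_types S (q + ?l) {}" if "t \<in> complete_types S q A" for t
    unfolding g_def
    using tuples_append[OF realization(1)[OF A that] ct] by (rule tp_complete[OF carrier_nonempty])
  have "continuous_map (type_space S q A) (type_space S (q + ?l) {}) g"
    unfolding type_space_def[of S "q + ?l"]
  proof (rule continuous_on_generated_topo)
    fix U assume "U \<in> cylinder S (q + ?l) {} ` definable S (q + ?l) {}"
    then obtain Z where Z: "Z \<in> definable S (q + ?l) {}" "U = cylinder S (q + ?l) {} Z" by blast
    obtain \<xi> d where "set d \<subseteq> {}" "\<xi> \<in> formulas S (q + ?l + length d)" "Z = fibre_x S (q + ?l) \<xi> d"
      using definable_params[OF Z(1)] .
    then have \<xi>: "\<xi> \<in> formulas S (q + ?l)" "Z = fibre_x S (q + ?l) \<xi> []" by auto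
    let ?Y = "fibre_x S q \<xi> c"
    have Y: "?Y \<in> definable S q A" using fibre_x_definable[OF \<xi>(1) c(1)] .
    have "g t \<in> U \<longleftrightarrow> ?Y \<in> t" if t: "t \<in> complete_types S q A" for t
    proof -
      have "g t \<in> U \<longleftrightarrow> realization S q t @ c \<in> Z"
        using g_in[OF t] Z by (simp add: cylinder_def) (simp add: g_def tp_def)
      also have "\<dots> \<longleftrightarrow> realization S q t \<in> ?Y"
        using section_fibre_y[OF ct, of q \<xi>] realization(1)[OF A t] \<xi>(2) by auto
      also have "\<dots> \<longleftrightarrow> ?Y \<in> tp S q A (realization S q t)" using Y by (simp add: tp_def)
      finally show ?thesis using realization(2)[OF A t] by simp
    qed
    then have "g -` U \<inter> topspace (type_space S q A) = cylinder S q A ?Y"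
      by (auto simp: topspace_type_space cylinder_def)
    then show "openin (type_space S q A) (g -` U \<inter> topspace (type_space S q A))"
      using openin_cylinder[OF Y] by simp
  next
    have "\<Union>(cylinder S (q + ?l) {} ` definable S (q + ?l) {}) = complete_types S (q + ?l) {}"
      using topspace_type_space[of "q + ?l" "{}"] by (simp add: type_space_def)
    then show "g ` topspace (type_space S q A) \<subseteq> \<Union>(cylinder S (q + ?l) {} ` definable S (q + ?l) {})"
      using g_in by (simp only: topspace_type_space) blast
  qed
  then have gm: "g \<in> borel_sets_of (type_space S q A) \<rightarrow>\<^sub>M borel_sets_of (type_space S (q + ?l) {})"
    by (rule continuous_map_borel)
  have "\<psi> \<in> formulas S (p + (q + ?l))" using c(2) by (simp add: add.assoc)
  then have "(\<lambda>s. \<mu> (fibre_x S p \<psi> (realization S (q + ?l) s)))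
      \<in> borel_measurable (borel_sets_of (type_space S (q + ?l) {}))"
    using \<mu> unfolding borel_definable_def by blast
  from measurable_compose[OF gm this]
  have m: "(\<lambda>t. \<mu> (fibre_x S p \<psi> (realization S (q + ?l) (g t))))
      \<in> borel_measurable (borel_sets_of (type_space S q A))" .
  show ?thesis
  proof (rule measurable_cong[THEN iffD1, OF _ m])
    fix t assume "t \<in> space (borel_sets_of (type_space S q A))"
    then have t: "t \<in> complete_types S q A" by (simp add: space_borel_sets_of topspace_type_space)
    note r = realization[OF A t]
    note s = realization[OF small_empty g_in[OF t]]
    have "\<mu> (fibre_x S p \<psi> (realization S (q + ?l) (g t))) = \<mu> (fibre_x S p \<psi> (realization S q t @ c))"
      using inv \<open>\<psi> \<in> formulas S (p + (q + ?l))\<close> s tuples_append[OF r(1) ct]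
      unfolding invariant_measure_def g_def by blast
    then show "\<mu> (fibre_x S p \<psi> (realization S (q + ?l) (g t))) = section_measure p q \<mu> X t"
      by (simp add: section_measure_def c(3) section_fibre[OF r(1)])
  qed
qed

text \<open>Change of variables along the restriction of types; by invariance the integrand does not
  see the difference between a type and its restriction.\<close>

lemma integral_section_measure_mono:
  assumes \<mu>: "borel_definable S p \<mu>" and \<nu>: "keisler_measure S q \<nu>"
    and A: "A \<subseteq> B" "small B" and X: "X \<in> definable S (p + q) A"
  shows "(\<integral>t. section_measure p q \<mu> X t \<partial>restriction_measure S q \<nu> A) =
    (\<integral>t. section_measure p q \<mu> X t \<partial>restriction_measure S q \<nu> B)"
proof -
  have BC: "B \<subseteq> carrier S" "A \<subseteq> carrier S" using A by (auto simp: small_def)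
  have sA: "small A"
    using A card_of_mono1[OF A(1)] ordLeq_ordLess_trans BC by (auto simp: small_def)
  have inv: "invariant_measure S p \<mu>" using \<mu> by (simp add: borel_definable_def)
  let ?r = "\<lambda>t. t \<inter> definable S q A"
  have XB: "X \<in> definable S (p + q) B" using X definable_mono[OF A(1)] by blast
  have "(\<integral>t. section_measure p q \<mu> X t \<partial>restriction_measure S q \<nu> A) =
      (\<integral>t. section_measure p q \<mu> X (?r t) \<partial>restriction_measure S q \<nu> B)"
    unfolding distr_restriction[OF \<nu> A(1) BC(1), symmetric]
    by (rule integral_distr[OF measurable_restrict_type[OF \<nu> A(1) BC(1)] measurable_section_measure[OF \<mu> sA X]])
  also have "\<dots> = (\<integral>t. section_measure p q \<mu> X t \<partial>restriction_measure S q \<nu> B)"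
  proof (rule Bochner_Integration.integral_cong[OF refl])
    fix t assume "t \<in> space (restriction_measure S q \<nu> B)"
    then have t: "t \<in> complete_types S q B" by (simp add: space_restriction[OF \<nu> BC(1)])
    note r = realization[OF A(2) t]
    show "section_measure p q \<mu> X (?r t) = section_measure p q \<mu> X t"
      using section_measure_tp[OF inv sA X r(1)] section_measure_tp[OF inv A(2) XB r(1)]
        tp_restrict[OF A(1), of S q "realization S q t"] r(2) by simp
  qed
  finally show ?thesis .
qed

text \<open>The chosen model and \<open>C\<close> are compared through their union, a small set that
  need not be a model. The product can thus be computed over any small set of parameters.\<close>

lemma keisler_product_eq:
  assumes \<mu>: "borel_definable S p \<mu>" and \<nu>: "keisler_measure S q \<nu>"
    and C: "small C" and X: "X \<in> definable S (p + q) C"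
  shows "keisler_product \<kappa> S p q \<mu> \<nu> X = (\<integral>t. section_measure p q \<mu> X t \<partial>restriction_measure S q \<nu> C)"
proof -
  define N where "N = (SOME N. small_model \<kappa> S N \<and> X \<in> definable S (p + q) N)"
  obtain N' where "small_model \<kappa> S N'" "C \<subseteq> N'" using ex_small_model[OF C] .
  then have "small_model \<kappa> S N' \<and> X \<in> definable S (p + q) N'" using X definable_mono[of C N'] by blast
  then have N: "small_model \<kappa> S N \<and> X \<in> definable S (p + q) N" unfolding N_def by (rule someI)
  then have sN: "small N" using small_model_small by blast
  have "keisler_product \<kappa> S p q \<mu> \<nu> X = (\<integral>t. section_measure p q \<mu> X t \<partial>restriction_measure S q \<nu> N)"
    by (simp add: keisler_product_def N_def[symmetric] Let_def section_measure_def)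
  also have "\<dots> = (\<integral>t. section_measure p q \<mu> X t \<partial>restriction_measure S q \<nu> (N \<union> C))"
    using N by (intro integral_section_measure_mono[OF \<mu> \<nu> _ small_Un[OF sN C]]) auto
  also have "\<dots> = (\<integral>t. section_measure p q \<mu> X t \<partial>restriction_measure S q \<nu> C)"
    by (rule integral_section_measure_mono[OF \<mu> \<nu> _ small_Un[OF sN C] X, symmetric]) auto
  finally show ?thesis .
qed

text \<open>Markov's inequality for the measure of sections.\<close>

lemma keisler_product_ge:
  assumes \<mu>: "borel_definable S p \<mu>" "keisler_measure S p \<mu>" and \<nu>: "keisler_measure S q \<nu>"
    and C: "small C" and X: "X \<in> definable S (p + q) C" and r: "0 \<le> r"
  defines "F \<equiv> {t \<in> complete_types S q C. r \<le> section_measure p q \<mu> X t}"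
  shows "F \<in> sets (restriction_measure S q \<nu> C)"
    and "r * measure (restriction_measure S q \<nu> C) F \<le> keisler_product \<kappa> S p q \<mu> \<nu> X"
proof -
  have CC: "C \<subseteq> carrier S" using C by (simp add: small_def)
  let ?m = "restriction_measure S q \<nu> C" and ?f = "section_measure p q \<mu> X"
  interpret prob_space ?m by (rule restriction_prob_space[OF \<nu> CC])
  have f: "?f \<in> borel_measurable ?m"
    using measurable_section_measure[OF \<mu>(1) C X] measurable_cong_sets[OF sets_restriction[OF \<nu> CC] refl]
    by blast
  have sp: "space ?m = complete_types S q C" by (rule space_restriction[OF \<nu> CC])
  have "{t \<in> space ?m. r \<le> ?f t} \<in> sets ?m" using f by measurable
  then show F: "F \<in> sets ?m" by (simp add: F_def sp)
  have bd: "0 \<le> ?f t" "?f t \<le> 1" if "t \<in> space ?m" for t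
    using section_measure_bounds[OF \<mu>(2) C X] that sp by auto
  have int: "integrable ?m ?f"
    by (rule integrable_const_bound[where B = 1]) (use bd f in \<open>auto intro!: AE_I2\<close>)
  have "r * measure ?m F = (\<integral>t. r * indicator F t \<partial>?m)" using F by simp
  also have "\<dots> \<le> (\<integral>t. ?f t \<partial>?m)"
  proof (rule integral_mono[OF _ int])
    show "integrable ?m (\<lambda>t. r * indicator F t)" using F by (intro integrable_mult_right integrable_real_indicator) (auto simp: emeasure_eq_measure)
    fix t assume "t \<in> space ?m"
    then show "r * indicator F t \<le> ?f t" using bd by (auto simp: F_def indicator_def)
  qed
  also have "\<dots> = keisler_product \<kappa> S p q \<mu> \<nu> X" by (rule keisler_product_eq[OF \<mu>(1) \<nu> C X, symmetric])
  finally show "r * measure ?m F \<le> keisler_product \<kappa> S p q \<mu> \<nu> X" .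
qed

lemma keisler_product_rectangle:
  assumes \<mu>: "borel_definable S p \<mu>" "keisler_measure S p \<mu>" and \<nu>: "keisler_measure S q \<nu>"
    and C: "small C" and X: "X \<in> definable S p C" and Y: "Y \<in> definable S q C"
  shows "keisler_product \<kappa> S p q \<mu> \<nu> (rectangle X Y) = \<mu> X * \<nu> Y"
proof -
  have CC: "C \<subseteq> carrier S" using C by (simp add: small_def)
  let ?m = "restriction_measure S q \<nu> C"
  interpret prob_space ?m by (rule restriction_prob_space[OF \<nu> CC])
  interpret \<mu>: finitely_additive_prob "tuples S p" "definable S p C" \<mu>
    by (rule keisler_finitely_additive[OF \<mu>(2) CC])
  have "keisler_product \<kappa> S p q \<mu> \<nu> (rectangle X Y) = (\<integral>t. section_measure p q \<mu> (rectangle X Y) t \<partial>?m)"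
    by (rule keisler_product_eq[OF \<mu>(1) \<nu> C rectangle_definable[OF X Y]])
  also have "\<dots> = (\<integral>t. \<mu> X * indicator (cylinder S q C Y) t \<partial>?m)"
  proof (rule Bochner_Integration.integral_cong[OF refl])
    fix t assume "t \<in> space ?m"
    then have t: "t \<in> complete_types S q C" by (simp add: space_restriction[OF \<nu> CC])
    note r = realization[OF C t]
    have iff: "realization S q t \<in> Y \<longleftrightarrow> t \<in> cylinder S q C Y"
    proof -
      have "realization S q t \<in> Y \<longleftrightarrow> Y \<in> tp S q C (realization S q t)" using Y by (simp add: tp_def)
      then show ?thesis using r(2) t by (simp add: cylinder_def)
    qed
    have "{a \<in> tuples S p. a @ realization S q t \<in> rectangle X Y} =
        (if realization S q t \<in> Y then X else {})"
      using definable_subset[OF X] by (auto simp: rectangle_append) (auto simp: rectangle_def)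
    then show "section_measure p q \<mu> (rectangle X Y) t = \<mu> X * indicator (cylinder S q C Y) t"
      using iff \<mu>.measure_empty by (simp add: section_measure_def indicator_def)
  qed
  also have "\<dots> = \<mu> X * \<nu> Y"
    using cylinder_sets_restriction[OF \<nu> CC Y] measure_restriction[OF \<nu> CC Y] by simp
  finally show ?thesis .
qed

end


subsection \<open>Almost sure stability\<close>

definition entries :: "'m list + 'm list \<Rightarrow> 'm set" where
  "entries e = set (case_sum id id e)"

definition wide_entry ::
  "('f, 'r, 'm) struct \<Rightarrow> nat \<Rightarrow> nat \<Rightarrow> ('m list set \<Rightarrow> real) \<Rightarrow> ('m list set \<Rightarrow> real)
     \<Rightarrow> 'm set \<Rightarrow> 'm list + 'm list \<Rightarrow> bool" where
  "wide_entry S p q \<mu> \<nu> A e = (case e of Inl a \<Rightarrow> wide_over S p \<mu> A a | Inr b \<Rightarrow> wide_over S q \<nu> A b)"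

lemma independent_seq_snoc:
  "independent_seq S p q \<mu> \<nu> M (s @ [e]) \<longleftrightarrow> independent_seq S p q \<mu> \<nu> M s \<and>
    wide_entry S p q \<mu> \<nu> (M \<union> (\<Union>x\<in>set s. entries x)) e"
proof -
  have seq: "independent_seq S p q \<mu> \<nu> M s \<longleftrightarrow>
      (\<forall>i<length s. wide_entry S p q \<mu> \<nu> (M \<union> (\<Union>j<i. entries (s ! j))) (s ! i))" for s
    by (simp add: independent_seq_def wide_entry_def entries_def Let_def)
  have "(\<Union>j<i. entries ((s @ [e]) ! j)) = (\<Union>j<i. entries (s ! j))" if "i \<le> length s" for i
    using that by (intro SUP_cong) (auto simp: nth_append)
  moreover have "(\<Union>j<length s. entries (s ! j)) = (\<Union>x\<in>set s. entries x)"
    by (auto simp: set_conv_nth)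
  ultimately show ?thesis
    unfolding seq by (auto simp: less_Suc_eq nth_append)
qed

text \<open>Formulated for tagged entries, so that sequences starting in either sort are
  covered.\<close>

lemma independent_seq_alternating:
  assumes "\<And>i. i < k \<Longrightarrow> wide_entry S p q \<mu> \<nu> (M \<union> (\<Union>j<i. entries (u j) \<union> entries (v j))) (u i)"
    and "\<And>i. i < k \<Longrightarrow> wide_entry S p q \<mu> \<nu> (M \<union> (\<Union>j<i. entries (u j) \<union> entries (v j)) \<union> entries (u i)) (v i)"
  shows "independent_seq S p q \<mu> \<nu> M (concat (map (\<lambda>i. [u i, v i]) [0..<k]))"
  using assms
proof (induction k)
  case 0
  show ?case by (simp add: independent_seq_def)
next
  case (Suc k)
  let ?s = "concat (map (\<lambda>i. [u i, v i]) [0..<k])"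
  have e: "(\<Union>x\<in>set ?s. entries x) = (\<Union>j<k. entries (u j) \<union> entries (v j))"
    by auto
  have "independent_seq S p q \<mu> \<nu> M ?s" by (rule Suc.IH) (simp_all add: Suc.prems)
  then have "independent_seq S p q \<mu> \<nu> M (?s @ [u k])"
    unfolding independent_seq_snoc e using Suc.prems(1)[of k] by simp
  moreover have "(\<Union>x\<in>set (?s @ [u k]). entries x) = (\<Union>j<k. entries (u j) \<union> entries (v j)) \<union> entries (u k)"
    using e by auto
  ultimately have "independent_seq S p q \<mu> \<nu> M ((?s @ [u k]) @ [v k])"
    unfolding independent_seq_snoc[of _ _ _ _ _ _ "?s @ [u k]"]
    using Suc.prems(2)[of k] by (simp add: Un_assoc)
  then show ?case by simp
qed

text \<open>The substitution of k - i for i carries the indices 1, ..., k to k - 1, ..., 0, so the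
  reversed sequence is one built forwards from 0 with the sorts exchanged.\<close>

lemma rev_alternating:
  "rev (concat (map (\<lambda>i. [u (k - i), v (k - i)]) [1..<Suc k])) =
    concat (map (\<lambda>i. [v i, u i]) [0..<k])"
proof -
  have "rev [1..<Suc k] = map (\<lambda>i. k - i) [0..<k]"
    by (intro nth_equalityI) (auto simp: rev_nth simp del: upt_Suc)
  then show ?thesis
    by (auto simp: rev_concat rev_map comp_def simp del: upt_Suc intro!: arg_cong[where f = concat])
qed

text \<open>The wideness predicates are arguments so that exchanging them and transposing
  \<open>E\<close> describes a graph whose construction begins with the other sort.\<close>

definition half_graph where
  "half_graph WX WY E M k a b \<longleftrightarrow> (\<forall>i<k::nat.
     WX (M \<union> (\<Union>j<i. set (a j) \<union> set (b j))) (a i) \<and>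
     WY (M \<union> (\<Union>j<i. set (a j) \<union> set (b j)) \<union> set (a i)) (b i)) \<and>
     (\<forall>i<k. \<forall>j<k. E (a i) (b j) \<longleftrightarrow> i \<le> j)"

lemma almost_sure_stable_no_graph:
  assumes "almost_sure_stable \<kappa> S p q \<mu> \<nu> \<phi>" "small_model \<kappa> S M"
  shows "\<exists>k. \<forall>a b.
    \<not> half_graph (wide_over S p \<mu>) (wide_over S q \<nu>) (\<lambda>a b. sat S (a @ b) \<phi>) M k a b \<and>
    \<not> half_graph (wide_over S q \<nu>) (wide_over S p \<mu>) (\<lambda>b a. sat S (a @ b) \<phi>) M k b a"
proof -
  obtain k where k: "\<not> (\<exists>M a b. small_model \<kappa> S M \<and>
        (let s = concat (map (\<lambda>i. [Inl (a i), Inr (b i)]) [1..<Suc k])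
         in independent_seq S p q \<mu> \<nu> M s \<or> independent_seq S p q \<mu> \<nu> M (rev s)) \<and>
        (\<forall>i\<in>{1..k}. \<forall>j\<in>{1..k}. sat S (a i @ b j) \<phi> \<longleftrightarrow> i \<le> j))"
    using assms(1) unfolding almost_sure_stable_def by blast
  have no: False if "independent_seq S p q \<mu> \<nu> M (concat (map (\<lambda>i. [Inl (a i), Inr (b i)]) [1..<Suc k])) \<or>
      independent_seq S p q \<mu> \<nu> M (rev (concat (map (\<lambda>i. [Inl (a i), Inr (b i)]) [1..<Suc k])))"
    "\<forall>i\<in>{1..k}. \<forall>j\<in>{1..k}. sat S (a i @ b j) \<phi> \<longleftrightarrow> i \<le> j" for a b
    using k[unfolded not_ex, rule_format, of M a b] assms(2) that unfolding Let_def by blast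
  show ?thesis
  proof (intro exI[of _ k] allI conjI notI)
    fix a b
    assume "half_graph (wide_over S p \<mu>) (wide_over S q \<nu>) (\<lambda>a b. sat S (a @ b) \<phi>) M k a b"
    then have w: "\<forall>i<k. wide_over S p \<mu> (M \<union> (\<Union>j<i. set (a j) \<union> set (b j))) (a i)"
      "\<forall>i<k. wide_over S q \<nu> (M \<union> (\<Union>j<i. set (a j) \<union> set (b j)) \<union> set (a i)) (b i)"
      and E: "\<forall>i<k. \<forall>j<k. sat S (a i @ b j) \<phi> \<longleftrightarrow> i \<le> j"
      by (simp_all add: half_graph_def)
    have "independent_seq S p q \<mu> \<nu> M (concat (map (\<lambda>i. [Inl (a i), Inr (b i)]) [0..<k]))"
      using w by (intro independent_seq_alternating) (auto simp: wide_entry_def entries_def)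
    moreover have "[1..<Suc k] = map Suc [0..<k]" by (simp add: map_Suc_upt del: upt_Suc)
    then have "map (\<lambda>i. [Inl (a (i - 1)), Inr (b (i - 1))]) [1..<Suc k] =
        map (\<lambda>i. [Inl (a i), Inr (b i)]) [0..<k]" by (simp add: comp_def del: upt_Suc)
    ultimately show False
      using no[of "\<lambda>i. a (i - 1)" "\<lambda>i. b (i - 1)"] E by fastforce
  next
    fix a b
    assume "half_graph (wide_over S q \<nu>) (wide_over S p \<mu>) (\<lambda>b a. sat S (a @ b) \<phi>) M k b a"
    then have w: "\<forall>i<k. wide_over S q \<nu> (M \<union> (\<Union>j<i. set (b j) \<union> set (a j))) (b i)"
      "\<forall>i<k. wide_over S p \<mu> (M \<union> (\<Union>j<i. set (b j) \<union> set (a j)) \<union> set (b i)) (a i)"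
      and E: "\<forall>i<k. \<forall>j<k. sat S (a i @ b j) \<phi> \<longleftrightarrow> j \<le> i"
      by (simp_all add: half_graph_def)
    have ind: "independent_seq S p q \<mu> \<nu> M (concat (map (\<lambda>i. [Inr (b i), Inl (a i)]) [0..<k]))"
      using w by (intro independent_seq_alternating) (auto simp: wide_entry_def entries_def)
    show False
    \<comment> \<open>Reversing both index sets turns j \<le> i into i \<le> j.\<close>
    proof (rule no[of "\<lambda>i. a (k - i)" "\<lambda>i. b (k - i)"])
      show "independent_seq S p q \<mu> \<nu> M (concat (map (\<lambda>i. [Inl (a (k - i)), Inr (b (k - i))]) [1..<Suc k])) \<or>
        independent_seq S p q \<mu> \<nu> M (rev (concat (map (\<lambda>i. [Inl (a (k - i)), Inr (b (k - i))]) [1..<Suc k])))"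
        using ind rev_alternating[of "\<lambda>i. Inl (a i)" k "\<lambda>i. Inr (b i)"] by simp
      show "\<forall>i\<in>{1..k}. \<forall>j\<in>{1..k}. sat S (a (k - i) @ b (k - j)) \<phi> \<longleftrightarrow> i \<le> j"
        using E by auto
    qed
  qed
qed

text \<open>If \<open>c\<close> is false, dropping the first entry gives a half-graph built in the opposite order.\<close>

lemma no_coloured_half_graph:
  assumes fw: "\<And>a b. \<not> half_graph WX WY E M k a b"
    and bw: "\<And>a b. \<not> half_graph WY WX (\<lambda>b a. E a b) M k b a"
    and WX_anti: "\<And>C C' a. WX C a \<Longrightarrow> C' \<subseteq> C \<Longrightarrow> WX C' a"
    and WY_anti: "\<And>C C' b. WY C b \<Longrightarrow> C' \<subseteq> C \<Longrightarrow> WY C' b"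
  shows "\<not> (\<exists>a b c.
    (\<forall>i<Suc k. WX (M \<union> (\<Union>j<i. set (a j) \<union> set (b j))) (a i) \<and>
      WY (M \<union> (\<Union>j<i. set (a j) \<union> set (b j)) \<union> set (a i)) (b i)) \<and>
    (\<forall>i<Suc k. \<forall>j<Suc k. E (a i) (b j) = (if i \<le> j then c else \<not> c)))"
proof (intro notI, elim exE conjE)
  fix a b c
  assume w: "\<forall>i<Suc k. WX (M \<union> (\<Union>j<i. set (a j) \<union> set (b j))) (a i) \<and>
    WY (M \<union> (\<Union>j<i. set (a j) \<union> set (b j)) \<union> set (a i)) (b i)"
    and E: "\<forall>i<Suc k. \<forall>j<Suc k. E (a i) (b j) = (if i \<le> j then c else \<not> c)"
  show False
  proof (cases c)
    case True
    have "half_graph WX WY E M k a b"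
      unfolding half_graph_def using w E True by simp
    then show ?thesis using fw by simp
  next
    case False
    show ?thesis
    \<comment> \<open>For false \<open>c\<close> the relation holds exactly when j < i; after the
      shift of \<open>a\<close> this is j < i + 1, that is, j \<le> i.\<close>
    proof (rule notE[OF bw[of b "\<lambda>i. a (Suc i)"]], unfold half_graph_def, intro conjI allI impI)
      fix i assume i: "i < k"
      show "WY (M \<union> (\<Union>j<i. set (b j) \<union> set (a (Suc j)))) (b i)"
      proof (rule WY_anti)
        show "WY (M \<union> (\<Union>j<i. set (a j) \<union> set (b j)) \<union> set (a i)) (b i)"
          using w i by simp
        have "set (a (Suc j)) \<subseteq> (\<Union>j<i. set (a j)) \<union> set (a i)" if "j < i" for j
          using that by (cases "Suc j = i") (auto intro!: bexI[of _ "Suc j"])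
        then show "M \<union> (\<Union>j<i. set (b j) \<union> set (a (Suc j))) \<subseteq>
            M \<union> (\<Union>j<i. set (a j) \<union> set (b j)) \<union> set (a i)" by fastforce
      qed
      show "WX (M \<union> (\<Union>j<i. set (b j) \<union> set (a (Suc j))) \<union> set (b i)) (a (Suc i))"
      proof (rule WX_anti)
        show "WX (M \<union> (\<Union>j<Suc i. set (a j) \<union> set (b j))) (a (Suc i))"
          using w i by blast
        have "set (a (Suc j)) \<subseteq> (\<Union>j<Suc i. set (a j))" if "j < i" for j
          using that by auto
        then show "M \<union> (\<Union>j<i. set (b j) \<union> set (a (Suc j))) \<union> set (b i) \<subseteq>
            M \<union> (\<Union>j<Suc i. set (a j) \<union> set (b j))" by fastforce
      qed
    next
      fix i j assume "i < k" "j < k"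
      then show "E (a (Suc i)) (b j) \<longleftrightarrow> j \<le> i" using E False by auto
    qed
  qed
qed

section \<open>From the monster model to the abstract setting, for both orders of the sorts\<close>

lemma wide_relation_of_stable:
  assumes mon: "monster_model \<kappa> T S"
    and \<mu>: "keisler_measure S p \<mu>" and \<nu>: "keisler_measure S q \<nu>"
    and \<phi>: "\<phi> \<in> formulas S (p + q)"
    and st: "almost_sure_stable \<kappa> S p q \<mu> \<nu> \<phi>" and M: "small_model \<kappa> S M"
  obtains k :: nat where
    "wide_relation (tuples S p) (definable S p (carrier S)) \<mu> (tuples S q) (definable S q (carrier S)) \<nu>
      (wide_over S p \<mu>) (wide_over S q \<nu>) set set (monster.small \<kappa> S) (\<lambda>a b. sat S (a @ b) \<phi>) M k"
    "wide_relation (tuples S q) (definable S q (carrier S)) \<nu> (tuples S p) (definable S p (carrier S)) \<mu>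
      (wide_over S q \<nu>) (wide_over S p \<mu>) set set (monster.small \<kappa> S) (\<lambda>b a. sat S (a @ b) \<phi>) M k"
proof -
  interpret monster \<kappa> T S using mon by (simp add: monster_def)
  interpret x: finitely_additive_prob "tuples S p" "definable S p (carrier S)" \<mu>
    by (rule keisler_finitely_additive[OF \<mu> order_refl])
  interpret y: finitely_additive_prob "tuples S q" "definable S q (carrier S)" \<nu>
    by (rule keisler_finitely_additive[OF \<nu> order_refl])
  obtain k where fw: "\<And>a b. \<not> half_graph (wide_over S p \<mu>) (wide_over S q \<nu>) (\<lambda>a b. sat S (a @ b) \<phi>) M k a b"
    and bw: "\<And>a b. \<not> half_graph (wide_over S q \<nu>) (wide_over S p \<mu>) (\<lambda>b a. sat S (a @ b) \<phi>) M k b a"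
    using almost_sure_stable_no_graph[OF st M] by blast
  have fibre1: "{a \<in> tuples S p. sat S (a @ b) \<phi>} \<in> definable S p (carrier S)" if "b \<in> tuples S q" for b
    using fibre_x_definable[of \<phi> S p b "carrier S"] \<phi> that by (auto simp: fibre_x_def tuples_def)
  have fibre2: "{b \<in> tuples S q. sat S (a @ b) \<phi>} \<in> definable S q (carrier S)" if "a \<in> tuples S p" for a
    using fibre_y_definable[of \<phi> S a q "carrier S"] \<phi> that by (auto simp: fibre_y_def tuples_def)
  have wide_in: "a \<in> tuples S n" if "wide_over S n \<theta> C a" for n \<theta> C a
    using that by (simp add: wide_over_def)
  note no1 = no_coloured_half_graph[where E = "\<lambda>a b. sat S (a @ b) \<phi>", OF fw bw]
    and no2 = no_coloured_half_graph[where E = "\<lambda>b a. sat S (a @ b) \<phi>", OF bw fw]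
  show ?thesis
  \<comment> \<open>One additional pair makes up for the entry dropped in
    \<open>no_coloured_half_graph\<close>.\<close>
  proof (rule that[of "Suc k"])
    show "wide_relation (tuples S p) (definable S p (carrier S)) \<mu> (tuples S q) (definable S q (carrier S)) \<nu>
      (wide_over S p \<mu>) (wide_over S q \<nu>) set set small (\<lambda>a b. sat S (a @ b) \<phi>) M (Suc k)"
      by (rule wide_relation.intro[OF x.finitely_additive_prob_axioms y.finitely_additive_prob_axioms],
          rule wide_relation_axioms.intro)
        (fact fibre1 fibre2 ex_wide_over_in[OF \<mu>] ex_wide_over_in[OF \<nu>] wide_in wide_over_anti
          small_model_small[OF M] small_Un small_set | rule no1; erule (1) wide_over_anti)+
    show "wide_relation (tuples S q) (definable S q (carrier S)) \<nu> (tuples S p) (definable S p (carrier S)) \<mu>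
      (wide_over S q \<nu>) (wide_over S p \<mu>) set set small (\<lambda>b a. sat S (a @ b) \<phi>) M (Suc k)"
      by (rule wide_relation.intro[OF y.finitely_additive_prob_axioms x.finitely_additive_prob_axioms],
          rule wide_relation_axioms.intro)
        (fact fibre1 fibre2 ex_wide_over_in[OF \<mu>] ex_wide_over_in[OF \<nu>] wide_in wide_over_anti
          small_model_small[OF M] small_Un small_set | rule no2; erule (1) wide_over_anti)+
  qed
qed


text \<open>A homogeneous pair: once both alternatives fail for the product, both majority colours
  occupy more than an \<open>\<epsilon>\<close>-fraction of \<open>B\<close>, contradicting \<open>good_pair\<close>.\<close>

lemma good_pair_product:
  fixes \<epsilon> \<eta> :: real
  assumes mon: "monster_model \<kappa> T S"
    and \<mu>: "keisler_measure S p \<mu>" "borel_definable S p \<mu>" and \<nu>: "keisler_measure S q \<nu>"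
    and \<phi>: "\<phi> \<in> formulas S (p + q)"
    and wr1: "wide_relation (tuples S p) (definable S p (carrier S)) \<mu> (tuples S q) (definable S q (carrier S)) \<nu>
      (wide_over S p \<mu>) (wide_over S q \<nu>) set set (monster.small \<kappa> S) (\<lambda>a b. sat S (a @ b) \<phi>) M k"
    and wr2: "wide_relation (tuples S q) (definable S q (carrier S)) \<nu> (tuples S p) (definable S p (carrier S)) \<mu>
      (wide_over S q \<nu>) (wide_over S p \<mu>) set set (monster.small \<kappa> S) (\<lambda>b a. sat S (a @ b) \<phi>) M k"
    and A: "wide_relation.good (tuples S p) (definable S p (carrier S)) \<mu>
      (wide_over S q \<nu>) (monster.small \<kappa> S) (\<lambda>a b. sat S (a @ b) \<phi>) \<eta> A"
    and B: "wide_relation.good (tuples S q) (definable S q (carrier S)) \<nu>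
      (wide_over S p \<mu>) (monster.small \<kappa> S) (\<lambda>b a. sat S (a @ b) \<phi>) \<eta> B"
    and \<eta>: "0 < \<eta>" "\<eta> \<le> \<epsilon>" "2 * real k * \<eta> < \<epsilon>" "\<epsilon> < 1"
  shows "(1 - \<epsilon>)\<^sup>2 * keisler_product \<kappa> S p q \<mu> \<nu> (rectangle A B)
        \<le> keisler_product \<kappa> S p q \<mu> \<nu> (relation_set S p q \<phi> \<inter> rectangle A B) \<or>
      (1 - \<epsilon>)\<^sup>2 * keisler_product \<kappa> S p q \<mu> \<nu> (rectangle A B)
        \<le> keisler_product \<kappa> S p q \<mu> \<nu> (rectangle A B - relation_set S p q \<phi>)"
proof -
  interpret monster \<kappa> T S using mon by (simp add: monster_def)
  interpret R: wide_relation "tuples S p" "definable S p (carrier S)" \<mu> "tuples S q" "definable S q (carrier S)" \<nu>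
    "wide_over S p \<mu>" "wide_over S q \<nu>" set set small "\<lambda>a b. sat S (a @ b) \<phi>" M k by (rule wr1)
  interpret R': wide_relation "tuples S q" "definable S q (carrier S)" \<nu> "tuples S p" "definable S p (carrier S)" \<mu>
    "wide_over S q \<nu>" "wide_over S p \<mu>" set set small "\<lambda>b a. sat S (a @ b) \<phi>" M k by (rule wr2)
  have inv: "invariant_measure S p \<mu>" using \<mu>(2) by (simp add: borel_definable_def)
  obtain CA where AD: "A \<in> definable S p (carrier S)" "0 < \<mu> A" and CA: "small CA"
    "\<And>b. wide_over S q \<nu> CA b \<Longrightarrow> \<mu> (A \<inter> R.fib b) \<le> \<eta> * \<mu> A \<or> \<mu> (A - R.fib b) \<le> \<eta> * \<mu> A"
    using A unfolding R.good_def by blast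
  obtain CB where BD: "B \<in> definable S q (carrier S)" "0 < \<nu> B" and CB: "small CB"
    "\<And>a. wide_over S p \<mu> CB a \<Longrightarrow> \<nu> (B \<inter> R'.fib a) \<le> \<eta> * \<nu> B \<or> \<nu> (B - R'.fib a) \<le> \<eta> * \<nu> B"
    using B unfolding R'.good_def by blast
  obtain DA where DA: "small DA" "A \<in> definable S p DA" using definable_small[OF AD(1)] .
  obtain DB where DB: "small DB" "B \<in> definable S q DB" using definable_small[OF BD(1)] .
  \<comment> \<open>Over this base \<open>A\<close> and \<open>B\<close> are definable, and every
    parameter wide over it has a majority value on \<open>A\<close>.\<close>
  define C where "C = CA \<union> DA \<union> DB"
  have C: "small C" "CA \<subseteq> C" using CA DA DB by (auto simp: C_def intro!: small_Un)
  have CC: "C \<subseteq> carrier S" using C by (simp add: small_def)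
  have AC: "A \<in> definable S p C" and BC: "B \<in> definable S q C"
    using DA(2) DB(2) definable_mono[of DA C S] definable_mono[of DB C S] by (simp_all add: C_def subset_iff)
  define Z where "Z d = (if d then relation_set S p q \<phi> \<inter> rectangle A B else rectangle A B - relation_set S p q \<phi>)"
    for d
  interpret alg: algebra "tuples S (p + q)" "definable S (p + q) C"
    by (rule algebra_definable[OF carrier_nonempty])
  have Z: "Z d \<in> definable S (p + q) C" for d
    using rectangle_definable[OF AC BC] relation_set_definable[OF \<phi>, of C] by (auto simp: Z_def)
  let ?m = "restriction_measure S q \<nu> C"
  interpret m: prob_space ?m by (rule restriction_prob_space[OF \<nu> CC])
  define f where "f d = section_measure p q \<mu> (Z d)" for d
  \<comment> \<open>A section of measure at least \<open>r\<close> leaves a minority of at most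
    \<open>\<eta> * \<mu> A\<close>.\<close>
  define r where "r = (1 - \<eta>) * \<mu> A"
  have r: "0 < r" using \<eta> AD(2) by (simp add: r_def)
  define F where "F d = {t \<in> complete_types S q C. r \<le> f d t}" for d
  note ge = keisler_product_ge[OF \<mu>(2,1) \<nu> C(1) Z, of r, folded f_def, folded F_def]
  have Fs: "F d \<in> sets ?m" and Fle: "r * measure ?m (F d) \<le> keisler_product \<kappa> S p q \<mu> \<nu> (Z d)" for d
    using ge r by auto
  have sec: "{a \<in> tuples S p. a @ b \<in> Z d} =
      (if b \<in> B then (if d then A \<inter> R.fib b else A - R.fib b) else {})" if b: "b \<in> tuples S q" for b d
  proof -
    have "a @ b \<in> relation_set S p q \<phi> \<longleftrightarrow> sat S (a @ b) \<phi>" if a: "a \<in> tuples S p" for a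
    proof
      assume "a @ b \<in> relation_set S p q \<phi>"
      then show "sat S (a @ b) \<phi>" by (auto simp: relation_set_def)
    next
      assume "sat S (a @ b) \<phi>"
      then show "a @ b \<in> relation_set S p q \<phi>" using a b unfolding relation_set_def by blast
    qed
    then show ?thesis
      using definable_subset[OF AD(1)] by (auto simp: Z_def rectangle_append) (auto simp: rectangle_def)
  qed
  have f_tp: "f d (tp S q C b) = \<mu> (if b \<in> B then (if d then A \<inter> R.fib b else A - R.fib b) else {})"
    if "b \<in> tuples S q" for b d
    unfolding f_def section_measure_tp[OF inv C(1) Z that] sec[OF that] ..
  have split: "\<mu> A = \<mu> (A \<inter> R.fib b) + \<mu> (A - R.fib b)" if "b \<in> tuples S q" for b
    using R.x.measure_split[OF AD(1) R.fibreX[OF that]] .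
  have in_F: "tp S q C b \<in> F d \<longleftrightarrow> r \<le> f d (tp S q C b)" if "b \<in> tuples S q" for b d
    using tp_complete[OF carrier_nonempty that] by (simp add: F_def)
  have rect: "keisler_product \<kappa> S p q \<mu> \<nu> (rectangle A B) = \<mu> A * \<nu> B"
    by (rule keisler_product_rectangle[OF \<mu>(2,1) \<nu> C(1) AC BC])
  \<comment> \<open>One factor comes from \<open>r\<close>, by
    \<open>\<eta> \<le> \<epsilon>\<close>; the other is the share of \<open>B\<close> whose
    majority value is \<open>d\<close>.\<close>
  have big: "(1 - \<epsilon>)\<^sup>2 * keisler_product \<kappa> S p q \<mu> \<nu> (rectangle A B) \<le> keisler_product \<kappa> S p q \<mu> \<nu> (Z d)"
    if "(1 - \<epsilon>) * \<nu> B \<le> measure ?m (F d)" for d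
  proof -
    have "(1 - \<epsilon>)\<^sup>2 * (\<mu> A * \<nu> B) = ((1 - \<epsilon>) * \<mu> A) * ((1 - \<epsilon>) * \<nu> B)"
      by (simp add: power2_eq_square)
    also have "\<dots> \<le> r * ((1 - \<epsilon>) * \<nu> B)"
      unfolding r_def using \<eta> AD BD by (intro mult_right_mono) auto
    also have "\<dots> \<le> r * measure ?m (F d)" using that r by (intro mult_left_mono) auto
    finally show ?thesis using Fle[of d] by (simp add: rect)
  qed
  have cylB: "cylinder S q C B \<in> sets ?m" "measure ?m (cylinder S q C B) = \<nu> B"
    using cylinder_sets_restriction[OF \<nu> CC BC] measure_restriction[OF \<nu> CC BC] by auto
  \<comment> \<open>Almost every type in \<open>B\<close> has a majority value: a positive set of
    exceptions would contain the type of a parameter wide over \<open>CA\<close>, against the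
    goodness of \<open>A\<close>.\<close>
  have cover: "\<nu> B \<le> measure ?m (F True) + measure ?m (F False)"
  proof (rule ccontr)
    assume "\<not> ?thesis"
    moreover have "measure ?m (F True \<union> F False) \<le> measure ?m (F True) + measure ?m (F False)"
      using Fs by (intro measure_Un_le) auto
    moreover have "measure ?m (cylinder S q C B) \<le>
        measure ?m ((cylinder S q C B - (F True \<union> F False)) \<union> (F True \<union> F False))"
      using Fs cylB by (intro m.finite_measure_mono) auto
    moreover have "\<dots> \<le> measure ?m (cylinder S q C B - (F True \<union> F False)) + measure ?m (F True \<union> F False)"
      using Fs cylB by (intro measure_Un_le) auto
    ultimately have "\<nu> {} < measure ?m (cylinder S q C B - (F True \<union> F False))"
      using cylB(2) R.y.measure_empty by simp
    then obtain b where b: "wide_over S q \<nu> C b" "tp S q C b \<in> cylinder S q C B - (F True \<union> F False)"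
      using ex_wide_over[OF \<nu> C(1) C(1) order_refl, of "cylinder S q C B - (F True \<union> F False)" "{}"] Fs cylB
        R.y.empty_sets by auto
    then have bt: "b \<in> tuples S q" by (simp add: wide_over_def)
    have "b \<in> B" using b(2) by (auto simp: cylinder_def tp_def)
    then have "\<not> r \<le> \<mu> (A \<inter> R.fib b)" "\<not> r \<le> \<mu> (A - R.fib b)"
      using b(2) in_F[OF bt, of True] in_F[OF bt, of False] f_tp[OF bt, of True] f_tp[OF bt, of False] by auto
    moreover have "wide_over S q \<nu> CA b" using b(1) C(2) by (rule wide_over_anti)
    ultimately show False using CA(2)[of b] split[OF bt] by (auto simp: r_def algebra_simps)
  qed
  show ?thesis
  proof (rule ccontr)
    assume "\<not> ?thesis"
    then have small_F: "measure ?m (F d) < (1 - \<epsilon>) * \<nu> B" for d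
      using big[of d] by (cases d) (auto simp: Z_def not_le[symmetric])
    have large_F: "\<epsilon> * \<nu> B < measure ?m (F d)" for d
      using cover small_F[of "\<not> d"] by (cases d) (auto simp: algebra_simps)
    \<comment> \<open>Wide parameters are drawn from \<open>F d\<close>, a Borel set of types.
      Outside \<open>B\<close> the section is empty and has measure 0 < \<open>r\<close>, so such
      parameters automatically lie in \<open>B\<close>.\<close>
    have thick: "R.thick (\<epsilon> * \<nu> B) (B \<inter> {b. \<mu> (if d then A - R.fib b else A \<inter> R.fib b) \<le> \<eta> * \<mu> A})" for d
      unfolding R.thick_def
    proof (intro allI impI)
      fix C' D assume C': "small C'" and D: "D \<in> definable S q (carrier S)" "\<nu> D < \<epsilon> * \<nu> B"
      have "\<nu> D < measure ?m (F d)" using D large_F[of d] by simp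
      then obtain b where b: "wide_over S q \<nu> (C \<union> C') b" "tp S q C b \<in> F d" "b \<notin> D"
        using ex_wide_over[OF \<nu> C(1) small_Un[OF C(1) C'] _ Fs D(1)] by blast
      then have bt: "b \<in> tuples S q" by (simp add: wide_over_def)
      have le: "r \<le> \<mu> (if b \<in> B then (if d then A \<inter> R.fib b else A - R.fib b) else {})"
        using b(2) in_F[OF bt] f_tp[OF bt, of d] by simp
      then have "b \<in> B" using r R.x.measure_empty by (auto split: if_splits)
      then have "\<mu> (if d then A - R.fib b else A \<inter> R.fib b) \<le> \<eta> * \<mu> A"
        using le split[OF bt] by (cases d) (auto simp: r_def algebra_simps)
      then show "\<exists>b\<in>B \<inter> {b. \<mu> (if d then A - R.fib b else A \<inter> R.fib b) \<le> \<eta> * \<mu> A} - D. wide_over S q \<nu> C' b"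
        using b \<open>b \<in> B\<close> wide_over_anti[OF b(1), of C'] by blast
    qed
    have k\<eta>: "real (2 * k) * \<eta> < \<epsilon>" using \<eta>(3) by simp
    show False
      using R.good_pair[OF AD BD CB(1) CB(2) k\<eta> less_imp_le[OF \<eta>(4)] less_imp_le[OF \<eta>(1)]]
        thick[of True] thick[of False] by simp
  qed
qed

theorem theorem5p8:
  fixes S :: "('f, 'r, 'm) struct" and T :: "('f, 'r) fm set" and \<kappa> :: "'k rel"
    and p q :: nat and \<mu> \<nu> :: "'m list set \<Rightarrow> real"
    and \<phi> :: "('f, 'r) fm" and M :: "'m set" and \<epsilon> :: real
  assumes "monster_model \<kappa> T S"
    and "keisler_measure S p \<mu>" and "invariant_measure S p \<mu>"
    and "keisler_measure S q \<nu>" and "invariant_measure S q \<nu>"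
    and "borel_definable S p \<mu>"
    and "\<phi> \<in> formulas S (p + q)"
    and "almost_sure_stable \<kappa> S p q \<mu> \<nu> \<phi>"
    and "small_model \<kappa> S M"
    and "0 < \<epsilon>" and "\<epsilon> < 2"
  shows "\<exists>(n::nat) (m::nat) (\<Phi> :: nat \<Rightarrow> 'm list set) (\<Theta> :: nat \<Rightarrow> 'm list set).
      (\<forall>i\<in>{1..n}. \<Phi> i \<in> boolean_combinations (tuples S p)
                          {fibre_x S p \<phi> b |b. wide_over S q \<nu> M b}) \<and>
      (\<forall>j\<in>{1..m}. \<Theta> j \<in> boolean_combinations (tuples S q)
                          {fibre_y S q \<phi> a |a. wide_over S p \<mu> M a}) \<and>
      \<mu> (\<Union>i\<in>{1..n}. \<Phi> i) = 1 \<and> \<nu> (\<Union>j\<in>{1..m}. \<Theta> j) = 1 \<and>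
      (\<forall>i\<in>{1..n}. \<forall>j\<in>{1..m}.
         keisler_product \<kappa> S p q \<mu> \<nu> (relation_set S p q \<phi> \<inter> rectangle (\<Phi> i) (\<Theta> j))
           \<ge> (1 - \<epsilon>)\<^sup>2 * keisler_product \<kappa> S p q \<mu> \<nu> (rectangle (\<Phi> i) (\<Theta> j)) \<or>
         keisler_product \<kappa> S p q \<mu> \<nu> (rectangle (\<Phi> i) (\<Theta> j) - relation_set S p q \<phi>)
           \<ge> (1 - \<epsilon>)\<^sup>2 * keisler_product \<kappa> S p q \<mu> \<nu> (rectangle (\<Phi> i) (\<Theta> j)))"
proof -
  interpret monster \<kappa> T S using assms(1) by (simp add: monster_def)
  note \<mu> = assms(2) and \<nu> = assms(4)
  obtain k where
    wr1: "wide_relation (tuples S p) (definable S p (carrier S)) \<mu> (tuples S q) (definable S q (carrier S)) \<nu>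
      (wide_over S p \<mu>) (wide_over S q \<nu>) set set small (\<lambda>a b. sat S (a @ b) \<phi>) M k" and
    wr2: "wide_relation (tuples S q) (definable S q (carrier S)) \<nu> (tuples S p) (definable S p (carrier S)) \<mu>
      (wide_over S q \<nu>) (wide_over S p \<mu>) set set small (\<lambda>b a. sat S (a @ b) \<phi>) M k"
    by (rule wide_relation_of_stable[OF assms(1) \<mu> \<nu> assms(7,8,9)])
  interpret R: wide_relation "tuples S p" "definable S p (carrier S)" \<mu> "tuples S q" "definable S q (carrier S)" \<nu>
    "wide_over S p \<mu>" "wide_over S q \<nu>" set set small "\<lambda>a b. sat S (a @ b) \<phi>" M k by (rule wr1)
  interpret R': wide_relation "tuples S q" "definable S q (carrier S)" \<nu> "tuples S p" "definable S p (carrier S)" \<mu>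
    "wide_over S q \<nu>" "wide_over S p \<mu>" set set small "\<lambda>b a. sat S (a @ b) \<phi>" M k by (rule wr2)
  \<comment> \<open>\<open>good_pair_product\<close> asks for a number below 1, while \<epsilon> may
    exceed 1. Half the distance from \<open>\<bar>1 - \<epsilon>\<bar>\<close> to 1 is positive for
    0 < \<epsilon> < 2 and gives a stronger bound than the one wanted.\<close>
  define e where "e = (1 - \<bar>1 - \<epsilon>\<bar>) / 2"
  have e: "0 < e" "e < 1" using assms(10,11) by (auto simp: e_def)
  have "\<bar>1 - \<epsilon>\<bar> \<le> 1 - e" using assms(10,11) by (auto simp: e_def abs_if field_simps)
  then have sq: "(1 - \<epsilon>)\<^sup>2 \<le> (1 - e)\<^sup>2" using power_mono[of "\<bar>1 - \<epsilon>\<bar>" "1 - e" 2] by simp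
  \<comment> \<open>The summand 1 makes \<open>2 * k * \<eta> < e\<close> strict and keeps the
    quotient meaningful for \<open>k = 0\<close>.\<close>
  define \<eta> where "\<eta> = e / (2 * real k + 1)"
  have \<eta>: "0 < \<eta>" "\<eta> \<le> e" "2 * real k * \<eta> < e" using e by (auto simp: \<eta>_def field_simps)
  have \<eta>1: "\<eta> \<le> 1" using \<eta>(2) e(2) by simp
  obtain P where P: "finite P" "P \<subseteq> R.bc" "\<forall>A\<in>P. R.good \<eta> A" "\<Union>P = tuples S p"
    by (rule R.good_cover[OF \<eta>(1) \<eta>1])
  obtain Q where Q: "finite Q" "Q \<subseteq> R'.bc" "\<forall>B\<in>Q. R'.good \<eta> B" "\<Union>Q = tuples S q"
    by (rule R'.good_cover[OF \<eta>(1) \<eta>1])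
  obtain \<Phi> where \<Phi>: "bij_betw \<Phi> {1..card P} P" using ex_bij_betw_nat_finite_1[OF P(1)] by blast
  obtain \<Theta> where \<Theta>: "bij_betw \<Theta> {1..card Q} Q" using ex_bij_betw_nat_finite_1[OF Q(1)] by blast
  have \<Phi>P: "\<Phi> i \<in> P" if "i \<in> {1..card P}" for i using \<Phi> that by (auto simp: bij_betw_def)
  have \<Theta>Q: "\<Theta> j \<in> Q" if "j \<in> {1..card Q}" for j using \<Theta> that by (auto simp: bij_betw_def)
  have "(\<Union>i\<in>{1..card P}. \<Phi> i) = tuples S p" using \<Phi> P(4) by (simp add: bij_betw_def)
  then have mu1: "\<mu> (\<Union>i\<in>{1..card P}. \<Phi> i) = 1" using R.x.total by simp
  have "(\<Union>j\<in>{1..card Q}. \<Theta> j) = tuples S q" using \<Theta> Q(4) by (simp add: bij_betw_def)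
  then have nu1: "\<nu> (\<Union>j\<in>{1..card Q}. \<Theta> j) = 1" using R.y.total by simp
  have bc: "\<Phi> i \<in> boolean_combinations (tuples S p) {fibre_x S p \<phi> b |b. wide_over S q \<nu> M b}"
    if "i \<in> {1..card P}" for i
    using \<Phi>P[OF that] P(2) unfolding R.bc_def fibre_x_def by blast
  have bc': "\<Theta> j \<in> boolean_combinations (tuples S q) {fibre_y S q \<phi> a |a. wide_over S p \<mu> M a}"
    if "j \<in> {1..card Q}" for j
    using \<Theta>Q[OF that] Q(2) unfolding R'.bc_def fibre_y_def by blast
  let ?\<omega> = "keisler_product \<kappa> S p q \<mu> \<nu>"
  have pair: "(1 - \<epsilon>)\<^sup>2 * ?\<omega> (rectangle A B) \<le> ?\<omega> (relation_set S p q \<phi> \<inter> rectangle A B) \<or>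
      (1 - \<epsilon>)\<^sup>2 * ?\<omega> (rectangle A B) \<le> ?\<omega> (rectangle A B - relation_set S p q \<phi>)"
    if "A \<in> P" "B \<in> Q" for A B
  proof -
    have gA: "R.good \<eta> A" and gB: "R'.good \<eta> B" using P(3) Q(3) that by auto
    obtain C where C: "small C" "A \<in> definable S p C" "B \<in> definable S q C"
    proof -
      obtain DA where DA: "small DA" "A \<in> definable S p DA"
        using definable_small[of A p] gA by (auto simp: R.good_def)
      obtain DB where DB: "small DB" "B \<in> definable S q DB"
        using definable_small[of B q] gB by (auto simp: R'.good_def)
      show ?thesis
        using that[of "DA \<union> DB"] DA DB small_Un definable_mono[of DA "DA \<union> DB"] definable_mono[of DB "DA \<union> DB"]
        by blast
    qed
    have "?\<omega> (rectangle A B) = \<mu> A * \<nu> B"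
      by (rule keisler_product_rectangle[OF assms(6) \<mu> \<nu> C])
    \<comment> \<open>The bound for \<open>e\<close> implies the one for \<epsilon> because the
      rectangle has nonnegative product measure.\<close>
    then have "0 \<le> ?\<omega> (rectangle A B)" using gA gB by (simp add: R.good_def R'.good_def)
    then have "(1 - \<epsilon>)\<^sup>2 * ?\<omega> (rectangle A B) \<le> (1 - e)\<^sup>2 * ?\<omega> (rectangle A B)"
      using sq by (rule mult_right_mono[rotated])
    then show ?thesis
      using good_pair_product[OF assms(1) \<mu> assms(6) \<nu> assms(7) wr1 wr2 gA gB \<eta> e(2)]
      by (elim disjE) (meson order_trans)+
  qed
  show ?thesis
    by (intro exI[of _ "card P"] exI[of _ "card Q"] exI[of _ \<Phi>] exI[of _ \<Theta>] conjI ballI bc bc' mu1 nu1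
        pair \<Phi>P \<Theta>Q)
qed

end
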